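(* Consider an $L$-level random hierarchy model (RHM) with branching factor $s$ that is induced by a context-free grammar, is $(V,m)$-uniform and non-ambiguous, and satisfies the following two conditions for parameters $\kappa$ and $K_\rho>0$: (a) (Non-degeneracy) for every $l\in[L]$ and $\boldsymbol\mu\in\mathcal P_l$, $\mathbb P[\text{the first patch at level } l \text{ is } \boldsymbol\mu]\ge(\kappa|\mathcal P_l|)^{-1}$; (b) (Nontrivial signal) for every $l\in[L]$ and all non-synonyms $\boldsymbol\mu,\boldsymbol\mu'\in\mathcal P_l$, $\|\boldsymbol q^{(l)}_{\boldsymbol\mu}-\boldsymbol q^{(l)}_{\boldsymbol\mu'}\|\ge K_\rho m^{-l/2}$, where $K_\rho$ does not depend on $l$ and is at least inverse polynomial in $m,V,L,s,\kappa$ and $d^{o(1)}$ (with $d:=s^L$ the input length). Let $\delta_{\mathbb P}\in(0,1)$. Then the convolutional learner model with random Fourier features of the RBF kernel described in the context can be trained (that is, its hyperparameters can be chosen and it can be trained) by the layerwise gradient descent described in the context so that, with probability at least $1-\delta_{\mathbb P}$, it learns this RHM instance. Moreover, the total number of samples needed is at most $$\mathrm{poly}\big(\kappa,m,V,s,L,\log(1/\delta_{\mathbb P})\big)\,K_\rho^{-2}\,m^L,$$ and the model width and the number of gradient descent steps are both bounded by $$\mathrm{poly}\big(K_\rho^{-1},\kappa,V,s,L,\log(1/\delta_{\mathbb P}),m^L\big).$$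
   Context: Notation: $[n]=\{1,\dots,n\}$, $[n]_0=\{0,\dots,n\}$; $\|\cdot\|$ is the Euclidean norm; $\mathbf 1$ is the all-ones vector; $\boldsymbol a=\boldsymbol b\pm_2\delta$ means $\|\boldsymbol a-\boldsymbol b\|\le\delta$. $\mathrm{poly}(z)$ denotes a quantity bounded by $|z|^C$ for some universal constant $C$ (polynomially bounded in all listed arguments). $o(1)$ is with respect to $d=s^L\to\infty$. **RHM.** An $L$-level RHM with branching factor $s$ consists of finite vocabularies $\mathcal V_0,\dots,\mathcal V_L$, a label distribution $\mathcal D_0$ on $\mathcal V_0$, and, for $l\in[L-1]_0$, transition probabilities $\mathcal Q_l:\mathcal V_l\times\mathcal V_{l+1}^s\to[0,1]$ such that $\mathcal Q_l(\nu,\cdot)$ is a probability distribution on $\mathcal V_{l+1}^s$ for each $\nu\in\mathcal V_l$. A sentence is generated by sampling the label $\zeta\sim\mathcal D_0$, setting the level-0 sentence to $(\zeta)$, and, for $l=0,\dots,L-1$, replacing each token $\mu^{(l)}_k$ ($k\in[s^l]$) of the level-$l$ sentence by an independent sample from $\mathcal Q_l(\mu^{(l)}_k,\cdot)$, concatenating to get the level-$(l+1)$ sentence in $\mathcal V_{l+1}^{s^{l+1}}$. The level-$L$ sentence (length $d=s^L$) is the observed input; $\zeta$ is the label; intermediate sentences are not observed. The $k$-th patch at level $l$ ($k\in[s^{l-1}]$) is $\boldsymbol\mu_k^{(l)}=(\mu^{(l)}_{(k-1)s+1},\dots,\mu^{(l)}_{ks})$. The RHM is induced by a context-free grammar with production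 rules $\mathcal R_l\subset\mathcal V_l\times\mathcal V_{l+1}^s$ if $\mathcal D_0$ is uniform on $\mathcal V_0$ and $\mathcal Q_l(\nu,\cdot)$ is the uniform distribution on the (nonempty) set $\{\boldsymbol\mu:(\nu,\boldsymbol\mu)\in\mathcal R_l\}$. It is $(V,m)$-uniform if $|\mathcal V_0|=\dots=|\mathcal V_L|=V$ and every $\nu\in\mathcal V_l$, $l\in[L-1]_0$, has exactly $m$ distinct production rules in $\mathcal R_l$. It is non-ambiguous if for every $l\in[L-1]_0$ each $\boldsymbol\mu\in\mathcal V_{l+1}^s$ satisfies $(\nu,\boldsymbol\mu)\in\mathcal R_l$ for at most one $\nu$. For $l\in[L]$, $\mathcal P_l:=\bigcup_{\nu\in\mathcal V_{l-1}}\operatorname{supp}\mathcal Q_{l-1}(\nu,\cdot)$ is the set of possible level-$l$ patches. Two patches in $\mathcal P_l$ are synonyms if they can be generated by the same level-$(l-1)$ symbol. For $\boldsymbol\mu\in\mathcal P_l$, $$\boldsymbol q^{(l)}_{\boldsymbol\mu}:=\big(\mathbb P[\text{label is }\zeta\mid\text{the first patch at level } l\text{ is }\boldsymbol\mu]\big)_{\zeta\in\mathcal V_0}.$$ **Learner model.** Identify $\mathcal V_0\cong[V]$ and put $d_e=V$. The level-$L$ token embeddings $\boldsymbol h^{(L)}_1,\dots,\boldsymbol h^{(L)}_{s^L}\in\mathbb R^{d_e}$ are the one-hot encodings of the input tokens. For $l=L,L-1,\dots,1$ and $k\in[s^{l-1}]$, with $\circ$ denoting concatenation, $$\boldsymbol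 x_{\boldsymbol\mu^{(l)}_k}:=\boldsymbol\Phi^{(l)}\big(\boldsymbol h^{(l)}_{(k-1)s+1}\circ\dots\circ\boldsymbol h^{(l)}_{ks}\big),\qquad \boldsymbol h^{(l-1)}_k:=\frac{\boldsymbol W^{(l)}\boldsymbol x_{\boldsymbol\mu^{(l)}_k}}{\langle\mathbf 1,\boldsymbol W^{(l)}\boldsymbol x_{\boldsymbol\mu^{(l)}_k}\rangle}\in\mathbb R^{d_e},$$ where $\boldsymbol W^{(l)}\in\mathbb R^{V\times 2M^{(l)}}$ is trainable and $\boldsymbol\Phi^{(l)}:\mathbb R^{sd_e}\to\mathbb R^{2M^{(l)}}$ is the random Fourier feature map of the RBF kernel with bandwidth $\sigma^{(l)}>0$, $$\boldsymbol\Phi^{(l)}(\boldsymbol h)=(M^{(l)})^{-1/2}\big(\cos(\boldsymbol\omega_j\cdot\boldsymbol h),\sin(\boldsymbol\omega_j\cdot\boldsymbol h)\big)_{j\in[M^{(l)}]},\qquad \boldsymbol\omega_j\overset{\text{i.i.d.}}{\sim}\mathcal N\big(0,(\sigma^{(l)})^{-2}\boldsymbol I_{sd_e}\big).$$ The model width is governed by the $M^{(l)}$. The network output is $\boldsymbol h^{(0)}_1\in\mathbb R^V$ and the predicted label is the $\arg\max$ of its entries. **Training.** Stages run from $l=L$ down to $l=1$. In stage $l$, with levels $L,\dots,l+1$ already trained and fixed, draw $N^{(l)}$ i.i.d. samples (input sequence, label $\zeta$) from the RHM, let $\hat{\mathbb E}^{(l)}$ be the empirical expectation over them, and consider $$\mathcal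 L^{(l)}(\boldsymbol W)=\tfrac12\hat{\mathbb E}^{(l)}\big\|\boldsymbol e_\zeta-\boldsymbol W\boldsymbol x_{\boldsymbol\mu^{(l)}_1}\big\|^2+\tfrac{\lambda_W}{2}\|\boldsymbol W\|_F^2,$$ which uses only the first level-$l$ patch; run $T^{(l)}$ gradient descent steps $\boldsymbol W^{(l)}_{t+1}=\boldsymbol W^{(l)}_t-\eta^{(l)}\nabla\mathcal L^{(l)}(\boldsymbol W^{(l)}_t)$ from $\boldsymbol W^{(l)}_0=0$. The hyperparameters are $\sigma^{(l)},M^{(l)},N^{(l)},T^{(l)},\eta^{(l)}>0,\lambda_W\ge0$. The total number of samples is $\sum_l N^{(l)}$; the probability is over the training samples and the random features. **Learning.** By non-ambiguity the label $\zeta$ is determined by the input. The model learns the RHM instance if on the inputs generated by the RHM it outputs $\boldsymbol e_\zeta\pm_2o(1)$, where $\zeta$ is the label of the input, so that the label is recovered by taking the $\arg\max$ of the output.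
   Formalization: For V = 1 the claim is stated only for K_ρ ≤ 1: with one symbol per level condition (b) is vacuous, so K_ρ could be arbitrarily large and the sample bound would fall below one sample. Vocabularies are taken to be finite sets of natural numbers. *)

theory Defs
  imports "HOL-Probability.Probability"
begin

section \<open>Random hierarchy models\<close>

text \<open>Levels are numbered as in the mathematics (\<open>0\<close> is the label, \<open>depth\<close> the observed input);
  positions inside a sentence, patches and coordinates are numbered from \<open>0\<close>.\<close>

record 'a rhm =
  depth :: nat
  branching :: nat
  vocab :: "nat \<Rightarrow> 'a set"
  label_dist :: "'a pmf"
  trans_dist :: "nat \<Rightarrow> 'a \<Rightarrow> 'a list pmf"

definition words :: "nat \<Rightarrow> 'a set \<Rightarrow> 'a list set" where
  "words n A = {w. set w \<subseteq> A \<and> length w = n}"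

definition is_rhm :: "'a rhm \<Rightarrow> bool" where
  "is_rhm H \<longleftrightarrow>
     depth H \<ge> 1 \<and> branching H \<ge> 1 \<and>
     (\<forall>l\<le>depth H. finite (vocab H l)) \<and>
     set_pmf (label_dist H) \<subseteq> vocab H 0 \<and>
     (\<forall>l<depth H. \<forall>\<nu>\<in>vocab H l.
        set_pmf (trans_dist H l \<nu>) \<subseteq> words (branching H) (vocab H (Suc l)))"

primrec expand :: "('a \<Rightarrow> 'a list pmf) \<Rightarrow> 'a list \<Rightarrow> 'a list pmf" where
  "expand q [] = return_pmf []"
| "expand q (x # xs) =
     bind_pmf (q x) (\<lambda>p. bind_pmf (expand q xs) (\<lambda>r. return_pmf (p @ r)))"

text \<open>\<open>derivation H l\<close> is the joint law of the sentences at levels \<open>0, \<dots>, l\<close>.\<close>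

primrec derivation :: "'a rhm \<Rightarrow> nat \<Rightarrow> 'a list list pmf" where
  "derivation H 0 = map_pmf (\<lambda>\<zeta>. [[\<zeta>]]) (label_dist H)"
| "derivation H (Suc l) =
     bind_pmf (derivation H l)
       (\<lambda>ss. map_pmf (\<lambda>t. ss @ [t]) (expand (trans_dist H l) (last ss)))"

abbreviation rhm_pmf :: "'a rhm \<Rightarrow> 'a list list pmf" where
  "rhm_pmf H \<equiv> derivation H (depth H)"

definition label_of :: "'a list list \<Rightarrow> 'a" where
  "label_of ss = hd (ss ! 0)"

definition first_patch :: "'a rhm \<Rightarrow> nat \<Rightarrow> 'a list list \<Rightarrow> 'a list" where
  "first_patch H l ss = take (branching H) (ss ! l)"

definition sample_pmf :: "'a rhm \<Rightarrow> ('a list \<times> 'a) pmf" where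
  "sample_pmf H = map_pmf (\<lambda>ss. (ss ! depth H, label_of ss)) (rhm_pmf H)"

definition patches :: "'a rhm \<Rightarrow> nat \<Rightarrow> 'a list set" where
  "patches H l = (\<Union>\<nu>\<in>vocab H (l - 1). set_pmf (trans_dist H (l - 1) \<nu>))"

definition synonyms :: "'a rhm \<Rightarrow> nat \<Rightarrow> 'a list \<Rightarrow> 'a list \<Rightarrow> bool" where
  "synonyms H l \<mu> \<mu>' \<longleftrightarrow>
     (\<exists>\<nu>\<in>vocab H (l - 1). \<mu> \<in> set_pmf (trans_dist H (l - 1) \<nu>) \<and>
                         \<mu>' \<in> set_pmf (trans_dist H (l - 1) \<nu>))"

definition patch_prob :: "'a rhm \<Rightarrow> nat \<Rightarrow> 'a list \<Rightarrow> real" where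
  "patch_prob H l \<mu> = \<P>(ss in measure_pmf (rhm_pmf H). first_patch H l ss = \<mu>)"

definition label_posterior :: "'a rhm \<Rightarrow> nat \<Rightarrow> 'a list \<Rightarrow> 'a \<Rightarrow> real" where
  "label_posterior H l \<mu> \<zeta> =
     \<P>(ss in measure_pmf (rhm_pmf H). label_of ss = \<zeta> \<bar> first_patch H l ss = \<mu>)"


subsection \<open>Models induced by context-free grammars\<close>

definition induced_by_cfg :: "'a rhm \<Rightarrow> (nat \<Rightarrow> ('a \<times> 'a list) set) \<Rightarrow> bool" where
  "induced_by_cfg H R \<longleftrightarrow>
     (\<forall>l<depth H. R l \<subseteq> vocab H l \<times> words (branching H) (vocab H (Suc l))) \<and>
     label_dist H = pmf_of_set (vocab H 0) \<and>
     (\<forall>l<depth H. \<forall>\<nu>\<in>vocab H l.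
        {\<mu>. (\<nu>, \<mu>) \<in> R l} \<noteq> {} \<and> trans_dist H l \<nu> = pmf_of_set {\<mu>. (\<nu>, \<mu>) \<in> R l})"

definition uniform_cfg :: "'a rhm \<Rightarrow> (nat \<Rightarrow> ('a \<times> 'a list) set) \<Rightarrow> nat \<Rightarrow> nat \<Rightarrow> bool" where
  "uniform_cfg H R V m \<longleftrightarrow>
     (\<forall>l\<le>depth H. card (vocab H l) = V) \<and>
     (\<forall>l<depth H. \<forall>\<nu>\<in>vocab H l. card {\<mu>. (\<nu>, \<mu>) \<in> R l} = m)"

definition non_ambiguous :: "'a rhm \<Rightarrow> (nat \<Rightarrow> ('a \<times> 'a list) set) \<Rightarrow> bool" where
  "non_ambiguous H R \<longleftrightarrow>
     (\<forall>l<depth H. \<forall>\<mu>\<in>words (branching H) (vocab H (Suc l)).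
        \<forall>\<nu> \<nu>'. (\<nu>, \<mu>) \<in> R l \<longrightarrow> (\<nu>', \<mu>) \<in> R l \<longrightarrow> \<nu> = \<nu>')"

definition non_degenerate :: "'a rhm \<Rightarrow> real \<Rightarrow> bool" where
  "non_degenerate H \<kappa> \<longleftrightarrow>
     (\<forall>l\<in>{1..depth H}. \<forall>\<mu>\<in>patches H l. patch_prob H l \<mu> \<ge> 1 / (\<kappa> * card (patches H l)))"

definition nontrivial_signal :: "'a rhm \<Rightarrow> nat \<Rightarrow> real \<Rightarrow> bool" where
  "nontrivial_signal H m K\<rho> \<longleftrightarrow>
     (\<forall>l\<in>{1..depth H}. \<forall>\<mu>\<in>patches H l. \<forall>\<mu>'\<in>patches H l. \<not> synonyms H l \<mu> \<mu>' \<longrightarrow>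
        L2_set (\<lambda>\<zeta>. label_posterior H l \<mu> \<zeta> - label_posterior H l \<mu>' \<zeta>) (vocab H 0)
          \<ge> K\<rho> * real m powr (- (real l / 2)))"


section \<open>The learner\<close>

text \<open>Vectors and matrices are functions on \<open>nat\<close>; only the coordinates below the relevant
  dimension are meaningful, and every sum below is restricted to them.\<close>

type_synonym rvec = "nat \<Rightarrow> real"
type_synonym rmat = "nat \<Rightarrow> nat \<Rightarrow> real"

text \<open>All fields except \<open>weight_decay\<close> are indexed by the level; \<open>num_freqs\<close> is the number of random
  frequencies, so the feature map has twice as many coordinates.\<close>

record hyperparams =
  bandwidth :: "nat \<Rightarrow> real"
  num_freqs :: "nat \<Rightarrow> nat"
  num_samples :: "nat \<Rightarrow> nat"
  num_steps :: "nat \<Rightarrow> nat"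
  step_size :: "nat \<Rightarrow> real"
  weight_decay :: real

definition valid_hyperparams :: "nat \<Rightarrow> hyperparams \<Rightarrow> bool" where
  "valid_hyperparams L p \<longleftrightarrow>
     (\<forall>l\<in>{1..L}. bandwidth p l > 0 \<and> num_freqs p l > 0 \<and> num_samples p l > 0 \<and>
                 num_steps p l > 0 \<and> step_size p l > 0) \<and>
     weight_decay p \<ge> 0"

definition one_hot :: "nat \<Rightarrow> rvec" where
  "one_hot i = (\<lambda>j. if j = i then 1 else 0)"

definition mat_vec :: "nat \<Rightarrow> rmat \<Rightarrow> rvec \<Rightarrow> rvec" where
  "mat_vec n W x = (\<lambda>i. \<Sum>j<n. W i j * x j)"

text \<open>Random Fourier features of a vector of dimension \<open>n\<close> for \<open>M\<close> frequencies; the frequency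
  \<open>j\<close> contributes the coordinates \<open>2 * j\<close> (cosine) and \<open>2 * j + 1\<close> (sine).\<close>

definition rff :: "nat \<Rightarrow> nat \<Rightarrow> (nat \<Rightarrow> rvec) \<Rightarrow> rvec \<Rightarrow> rvec" where
  "rff M n \<omega> h = (\<lambda>i. let a = (\<Sum>r<n. \<omega> (i div 2) r * h r) in
                      (if even i then cos a else sin a) / sqrt (real M))"

text \<open>The concatenation of the \<open>k\<close>-th block of \<open>s\<close> consecutive vectors of dimension \<open>V\<close>.\<close>

definition concat_patch :: "nat \<Rightarrow> nat \<Rightarrow> (nat \<Rightarrow> rvec) \<Rightarrow> nat \<Rightarrow> rvec" where
  "concat_patch s V h k = (\<lambda>r. h (k * s + r div V) (r mod V))"

definition patch_features ::
  "nat \<Rightarrow> nat \<Rightarrow> nat \<Rightarrow> (nat \<Rightarrow> rvec) \<Rightarrow> (nat \<Rightarrow> rvec) \<Rightarrow> nat \<Rightarrow> rvec" where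
  "patch_features s V M \<omega> h k = rff M (s * V) \<omega> (concat_patch s V h k)"

definition normalize_sum :: "nat \<Rightarrow> rvec \<Rightarrow> rvec" where
  "normalize_sum V y = (\<lambda>i. y i / (\<Sum>j<V. y j))"

text \<open>\<open>embedding H encL p \<omega> W x n k\<close> is the embedding of the token at position \<open>k\<close> of level
  \<open>depth H - n\<close>, i.e.\ after the top \<open>n\<close> layers have been applied to the input \<open>x\<close>; \<open>encL\<close> numbers
  the input vocabulary by \<open>{..<V}\<close>. The frequencies \<open>\<omega>\<close> and weights \<open>W\<close> are indexed by the level.\<close>

primrec embedding ::
  "'a rhm \<Rightarrow> ('a \<Rightarrow> nat) \<Rightarrow> hyperparams \<Rightarrow> (nat \<Rightarrow> nat \<Rightarrow> rvec) \<Rightarrow> (nat \<Rightarrow> rmat) \<Rightarrow>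
     'a list \<Rightarrow> nat \<Rightarrow> nat \<Rightarrow> rvec" where
  "embedding H encL p \<omega> W x 0 = (\<lambda>k. one_hot (encL (x ! k)))"
| "embedding H encL p \<omega> W x (Suc n) =
     (let l = depth H - n; V = card (vocab H 0); M = num_freqs p l in
      (\<lambda>k. normalize_sum V
             (mat_vec (2 * M) (W l)
               (patch_features (branching H) V M (\<omega> l) (embedding H encL p \<omega> W x n) k))))"

definition network_output ::
  "'a rhm \<Rightarrow> ('a \<Rightarrow> nat) \<Rightarrow> hyperparams \<Rightarrow> (nat \<Rightarrow> nat \<Rightarrow> rvec) \<Rightarrow> (nat \<Rightarrow> rmat) \<Rightarrow>
     'a list \<Rightarrow> rvec" where
  "network_output H encL p \<omega> W x = embedding H encL p \<omega> W x (depth H) 0"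


subsection \<open>Layerwise gradient descent\<close>

text \<open>The regularized empirical loss for \<open>N\<close> data points with features \<open>x i\<close> (of dimension \<open>n\<close>)
  and numbered labels \<open>y i\<close>.\<close>

definition loss ::
  "nat \<Rightarrow> nat \<Rightarrow> nat \<Rightarrow> real \<Rightarrow> (nat \<Rightarrow> rvec) \<Rightarrow> (nat \<Rightarrow> nat) \<Rightarrow> rmat \<Rightarrow> real" where
  "loss V n N lam x y W =
     1 / 2 * ((\<Sum>i<N. (L2_set (\<lambda>r. one_hot (y i) r - mat_vec n W (x i) r) {..<V})\<^sup>2) / real N)
     + lam / 2 * (\<Sum>r<V. \<Sum>j<n. (W r j)\<^sup>2)"

text \<open>The matrix of partial derivatives.\<close>

definition gradient :: "(rmat \<Rightarrow> real) \<Rightarrow> rmat \<Rightarrow> rmat" where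
  "gradient F W = (\<lambda>r j. deriv (\<lambda>u. F (W(r := (W r)(j := u)))) (W r j))"

primrec grad_descent :: "(rmat \<Rightarrow> real) \<Rightarrow> real \<Rightarrow> nat \<Rightarrow> rmat" where
  "grad_descent F \<eta> 0 = (\<lambda>r j. 0)"
| "grad_descent F \<eta> (Suc t) =
     (\<lambda>r j. grad_descent F \<eta> t r j - \<eta> * gradient F (grad_descent F \<eta> t) r j)"

text \<open>\<open>trained H enc0 encL p \<omega> D n\<close> are the weights after the first \<open>n\<close> stages, i.e.\ with the levels
  \<open>depth H, \<dots>, depth H - n + 1\<close> trained (the other levels are \<open>0\<close>); \<open>D (l, i)\<close> is the \<open>i\<close>-th
  training pair (input, label) of the stage for level \<open>l\<close>.\<close>

primrec trained ::
  "'a rhm \<Rightarrow> ('a \<Rightarrow> nat) \<Rightarrow> ('a \<Rightarrow> nat) \<Rightarrow> hyperparams \<Rightarrow> (nat \<Rightarrow> nat \<Rightarrow> rvec) \<Rightarrow>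
     (nat \<times> nat \<Rightarrow> 'a list \<times> 'a) \<Rightarrow> nat \<Rightarrow> nat \<Rightarrow> rmat" where
  "trained H enc0 encL p \<omega> D 0 = (\<lambda>l r j. 0)"
| "trained H enc0 encL p \<omega> D (Suc n) =
     (let l = depth H - n; V = card (vocab H 0); M = num_freqs p l;
          W = trained H enc0 encL p \<omega> D n;
          x = (\<lambda>i. patch_features (branching H) V M (\<omega> l)
                     (embedding H encL p \<omega> W (fst (D (l, i))) n) 0);
          y = (\<lambda>i. enc0 (snd (D (l, i))))
      in W(l := grad_descent (loss V (2 * M) (num_samples p l) (weight_decay p) x y)
                  (step_size p l) (num_steps p l)))"

text \<open>The training samples are indexed by (level, sample number), the coordinates of the frequencies by
  (level, frequency number, coordinate).\<close>

definition training_measure ::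
  "'a rhm \<Rightarrow> hyperparams \<Rightarrow>
     ((nat \<times> nat \<Rightarrow> 'a list \<times> 'a) \<times> (nat \<times> nat \<times> nat \<Rightarrow> real)) measure" where
  "training_measure H p =
     (\<Pi>\<^sub>M (l, i)\<in>(SIGMA l:{1..depth H}. {..<num_samples p l}). measure_pmf (sample_pmf H))
     \<Otimes>\<^sub>M
     (\<Pi>\<^sub>M (l, j, r)\<in>(SIGMA l:{1..depth H}. {..<num_freqs p l} \<times> {..<branching H * card (vocab H 0)}).
        density lborel (normal_density 0 (1 / bandwidth p l)))"

text \<open>The output is within \<open>\<epsilon>\<close> of the one-hot encoding of the label, on every input that the model can
  generate, and the label is the unique index of the largest output.\<close>

definition learns ::
  "'a rhm \<Rightarrow> ('a \<Rightarrow> nat) \<Rightarrow> ('a list \<Rightarrow> rvec) \<Rightarrow> real \<Rightarrow> bool" where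
  "learns H enc0 f \<epsilon> \<longleftrightarrow>
     (let V = card (vocab H 0) in
      \<forall>(x, \<zeta>)\<in>set_pmf (sample_pmf H).
        L2_set (\<lambda>r. f x r - one_hot (enc0 \<zeta>) r) {..<V} \<le> \<epsilon> \<and>
        (\<forall>r<V. r \<noteq> enc0 \<zeta> \<longrightarrow> f x r < f x (enc0 \<zeta>)))"

definition training_succeeds ::
  "'a rhm \<Rightarrow> ('a \<Rightarrow> nat) \<Rightarrow> ('a \<Rightarrow> nat) \<Rightarrow> hyperparams \<Rightarrow> real \<Rightarrow>
     (nat \<times> nat \<Rightarrow> 'a list \<times> 'a) \<times> (nat \<times> nat \<times> nat \<Rightarrow> real) \<Rightarrow> bool" where
  "training_succeeds H enc0 encL p \<epsilon> = (\<lambda>(D, w).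
     let \<omega> = (\<lambda>l j r. w (l, j, r)) in
     learns H enc0 (network_output H encL p \<omega> (trained H enc0 encL p \<omega> D (depth H))) \<epsilon>)"


section \<open>Polynomial bounds\<close>

text \<open>A quantity is \<open>poly(z)\<close> if it is at most \<open>poly_bound C z\<close>, the \<open>C\<close>-th power of the Euclidean norm
  of the tuple \<open>z\<close>, for a universal constant \<open>C\<close>.\<close>

definition poly_bound :: "real \<Rightarrow> real list \<Rightarrow> real" where
  "poly_bound C z = (L2_set (\<lambda>i. z ! i) {..<length z}) powr C"

end

theory Submission
  imports Defs
begin

text \<open>The network is trained with a single gradient step of size one from zero and without weight decay.
  The weights are then the empirical cross-covariance of labels and features, and after normalization each
  layer computes the Nadaraya--Watson kernel estimate of the label posterior of a patch. For all patches
  produced by a token \<open>\<nu>\<close> this posterior is the law of the label given the first token \<open>\<nu>\<close>, so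
  inductively the embeddings of the tokens of a level form one small cluster per symbol, and distinct
  clusters are separated by the signal hypothesis. With a bandwidth between the cluster radius and the
  separation, the kernel is bounded below within the cluster of a patch and negligible across clusters.

  The sampling error is uniform over all exponentially many embeddings because it is bounded by the norm of
  the average of (label minus posterior) tensored with the feature vector. This is a mean of independent
  centred bounded vectors, by the conditional independence of the label and the subtree given its root, and
  a dimension-free Hoeffding inequality applies. The random features approximate the kernel uniformly on a
  box by a union bound over a grid. Finally, posteriors are rational with denominators at most
  \<open>V * m ^ L\<close>, so the logarithm of the inverse separation is polynomial and one can take the same
  parameters at all levels.\<close>

section \<open>A dimension-free Hoeffding inequality\<close>

text \<open>Errors do not accumulate over the stages, which allows one accuracy
  \<open>\<epsilon>\<close> for all of them. The input error only has to keep equal patches within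
  the bandwidth of each other. Among samples with the same patch the target posterior is exactly
  constant, so smoothing has no bias there. The output error comes from sampling noise and from
  kernel leakage between different patches, both measured by \<open>tol\<close>, and
  \<open>24 * tol \<le> p * \<epsilon>\<close> restores \<open>\<epsilon>\<close>. Hence
  \<open>tol\<close> is the separation divided by a polynomial, and the
  \<open>1 / tol\<^sup>2\<close> of Hoeffding's inequality produces the factor
  \<open>m ^ L / K\<^sup>2\<close> of the sample bound. Leakage below \<open>tol\<close> forces the
  ratio of separation to bandwidth to exceed the root of the logarithm of the inverse separation.
  That ratio enters the sample bound, whose polynomial factor has no argument \<open>1 / K\<close>;
  this is the obstacle that the rationality of the posteriors removes. Each stage is trained on
  first patches only, yet accuracy is needed at every position: the weights are shared, and the
  target of a patch depends on its parent symbol alone, not on its position.\<close>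

lemma convex_on_power_nonneg: "convex_on {0::real..} (\<lambda>x. x ^ k)"
proof (cases "even k")
  case True
  then show ?thesis
    using convex_on_subset[OF convex_power_even] by auto
qed (simp add: convex_power_odd)

text \<open>The series of \<open>cosh\<close> has only even terms, so in the variable under the root
  it is a series of \<open>p ^ k / fact (2 * k)\<close>, and each term is convex on the nonnegative
  reals.\<close>

lemma cosh_sqrt_convex:
  fixes p q \<theta> :: real
  assumes "p \<ge> 0" "q \<ge> 0" "0 \<le> \<theta>" "\<theta> \<le> 1"
  shows "cosh (sqrt ((1 - \<theta>) * p + \<theta> * q)) \<le> (1 - \<theta>) * cosh (sqrt p) + \<theta> * cosh (sqrt q)"
proof (rule sums_le)
  let ?c = "\<lambda>x n. if even n then x ^ n /\<^sub>R fact n else 0 :: real"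
  show "?c (sqrt ((1 - \<theta>) * p + \<theta> * q)) sums cosh (sqrt ((1 - \<theta>) * p + \<theta> * q))"
    by (rule cosh_converges)
  show "(\<lambda>n. (1 - \<theta>) * ?c (sqrt p) n + \<theta> * ?c (sqrt q) n) sums
      ((1 - \<theta>) * cosh (sqrt p) + \<theta> * cosh (sqrt q))"
    by (intro sums_add sums_mult cosh_converges)
  fix n
  show "?c (sqrt ((1 - \<theta>) * p + \<theta> * q)) n \<le> (1 - \<theta>) * ?c (sqrt p) n + \<theta> * ?c (sqrt q) n"
  proof (cases "even n")
    case True
    then obtain k where k: "n = 2 * k" by (elim evenE)
    have *: "sqrt t ^ n = t ^ k" if "t \<ge> 0" for t
      using that by (simp add: k power_mult)
    have nn: "(1 - \<theta>) * p + \<theta> * q \<ge> 0" using assms by simp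
    have "((1 - \<theta>) * p + \<theta> * q) ^ k \<le> (1 - \<theta>) * p ^ k + \<theta> * q ^ k"
      using convex_onD[OF convex_on_power_nonneg[of k], of \<theta> p q] assms by simp
    then have "((1 - \<theta>) * p + \<theta> * q) ^ k / fact n \<le> ((1 - \<theta>) * p ^ k + \<theta> * q ^ k) / fact n"
      by (simp add: divide_right_mono)
    then show ?thesis
      using True assms nn by (simp add: * field_simps)
  qed simp
qed

text \<open>For vectors of norms \<open>a\<close> and at most \<open>b\<close> with inner product
  \<open>c\<close>, the left side is \<open>cosh\<close> of the norm of their sum. After enlarging
  \<open>y\<close> to \<open>b\<^sup>2\<close>, the radicand is a convex combination of
  \<open>(a - b)\<^sup>2\<close> and \<open>(a + b)\<^sup>2\<close>, and convexity bounds the value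
  by the chord. The point is that the chord is affine in \<open>c\<close>, so a centred inner
  product disappears in expectation. If \<open>a * b = 0\<close>, then \<open>c = 0\<close> and the
  quotient is \<open>0\<close> by convention.\<close>

lemma cosh_sqrt_chord:
  fixes a b c y :: real
  assumes "a \<ge> 0" "b \<ge> 0" "\<bar>c\<bar> \<le> a * b" "y \<le> b\<^sup>2" "0 \<le> a\<^sup>2 + y + 2 * c"
  shows "cosh (sqrt (a\<^sup>2 + y + 2 * c)) \<le> cosh a * cosh b + c * (sinh a * sinh b / (a * b))"
proof -
  have "cosh (sqrt (a\<^sup>2 + y + 2 * c)) \<le> cosh (sqrt (a\<^sup>2 + b\<^sup>2 + 2 * c))"
    using assms by (subst cosh_real_nonneg_le_iff) auto
  also have "\<dots> \<le> cosh a * cosh b + c * (sinh a * sinh b / (a * b))"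
  proof (cases "a * b = 0")
    case True
    then have "c = 0" using assms by auto
    then show ?thesis using True assms by auto
  next
    case False
    then have ab: "a * b > 0" using assms by (metis mult_nonneg_nonneg order_le_less)
    define \<theta> where "\<theta> = (1 + c / (a * b)) / 2"
    have \<theta>: "0 \<le> \<theta>" "\<theta> \<le> 1"
    proof -
      have "\<bar>c / (a * b)\<bar> \<le> 1"
        using assms(3) ab unfolding abs_divide by simp
      then have "- 1 \<le> c / (a * b)" "c / (a * b) \<le> 1"
        unfolding abs_le_iff by linarith+
      then show "0 \<le> \<theta>" "\<theta> \<le> 1"
        unfolding \<theta>_def by simp_all
    qed
    have "\<theta> * (a * b) = (a * b + c) / 2"
      using False by (simp add: \<theta>_def field_simps)
    then have c: "c = 2 * (\<theta> * (a * b)) - a * b" by simp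
    have "a\<^sup>2 + b\<^sup>2 + 2 * c = (1 - \<theta>) * (a - b)\<^sup>2 + \<theta> * (a + b)\<^sup>2"
      unfolding c by (simp add: power2_eq_square algebra_simps)
    then have "cosh (sqrt (a\<^sup>2 + b\<^sup>2 + 2 * c))
        \<le> (1 - \<theta>) * cosh (sqrt ((a - b)\<^sup>2)) + \<theta> * cosh (sqrt ((a + b)\<^sup>2))"
      using cosh_sqrt_convex[of "(a - b)\<^sup>2" "(a + b)\<^sup>2" \<theta>] \<theta> by simp
    also have "\<dots> = (1 - \<theta>) * cosh (a - b) + \<theta> * cosh (a + b)"
      by simp
    also have "\<dots> = cosh a * cosh b + (2 * \<theta> - 1) * (sinh a * sinh b)"
      by (simp add: cosh_add cosh_diff algebra_simps)
    also have "2 * \<theta> - 1 = c / (a * b)"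
    proof -
      have "2 * ((1 + z) / 2) - 1 = z" for z :: real by (simp add: field_simps)
      then show ?thesis unfolding \<theta>_def .
    qed
    finally show ?thesis by simp
  qed
  finally show ?thesis .
qed

text \<open>The function \<open>cosh t * exp (- (t\<^sup>2 / 2))\<close> is decreasing for
  \<open>t \<ge> 0\<close> because \<open>sinh t \<le> t * cosh t\<close>; negative arguments follow
  by evenness.\<close>

lemma cosh_le_exp_half_square: "cosh x \<le> exp (x\<^sup>2 / 2)" for x :: real
proof -
  have pos: "cosh x \<le> exp (x\<^sup>2 / 2)" if "x \<ge> 0" for x :: real
  proof -
    have h: "sinh t \<le> t * cosh t" if "t \<ge> 0" for t :: real
    proof -
      have "(\<lambda>t. t * cosh t - sinh t) 0 \<le> (\<lambda>t. t * cosh t - sinh t) t"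
        by (rule DERIV_nonneg_imp_nondecreasing[OF that])
           (auto intro!: exI derivative_eq_intros)
      then show ?thesis by simp
    qed
    have "(\<lambda>t. - (cosh t * exp (- (t\<^sup>2 / 2)))) 0 \<le> (\<lambda>t. - (cosh t * exp (- (t\<^sup>2 / 2)))) x"
    proof (rule DERIV_nonneg_imp_nondecreasing[OF that])
      fix t :: real assume t: "0 \<le> t" "t \<le> x"
      have "((\<lambda>t. - (cosh t * exp (- (t\<^sup>2 / 2)))) has_real_derivative
          (t * cosh t - sinh t) * exp (- (t\<^sup>2 / 2))) (at t)"
        by (auto intro!: derivative_eq_intros simp: algebra_simps)
      moreover have "(t * cosh t - sinh t) * exp (- (t\<^sup>2 / 2)) \<ge> 0"
        using h[OF t(1)] by simp
      ultimately show "\<exists>y. ((\<lambda>t. - (cosh t * exp (- (t\<^sup>2 / 2)))) has_real_derivative y) (at t) \<and> 0 \<le> y"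
        by blast
    qed
    then have "cosh x * exp (- (x\<^sup>2 / 2)) \<le> 1" by simp
    then show ?thesis by (simp add: exp_minus field_simps)
  qed
  show ?thesis
  proof (cases "x \<ge> 0")
    case False
    then show ?thesis using pos[of "- x"] by simp
  qed (rule pos)
qed

lemma L2_set_add_square:
  "(L2_set (\<lambda>k. a k + y k) K)\<^sup>2 = (L2_set a K)\<^sup>2 + (\<Sum>k\<in>K. (y k)\<^sup>2) + 2 * (\<Sum>k\<in>K. a k * y k)"
proof -
  have "(L2_set (\<lambda>k. a k + y k) K)\<^sup>2 = (\<Sum>k\<in>K. (a k + y k)\<^sup>2)"
    by (simp add: L2_set_def sum_nonneg)
  also have "\<dots> = (\<Sum>k\<in>K. (a k)\<^sup>2) + (\<Sum>k\<in>K. (y k)\<^sup>2) + 2 * (\<Sum>k\<in>K. a k * y k)"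
    by (simp add: power2_sum sum.distrib sum_distrib_left mult.assoc)
  moreover have "(L2_set a K)\<^sup>2 = (\<Sum>k\<in>K. (a k)\<^sup>2)"
    by (simp add: L2_set_def sum_nonneg)
  ultimately show ?thesis by simp
qed

lemma abs_inner_le_L2_set:
  "\<bar>\<Sum>k\<in>K. a k * y k\<bar> \<le> L2_set a K * L2_set y K"
proof -
  have "\<bar>\<Sum>k\<in>K. a k * y k\<bar> \<le> (\<Sum>k\<in>K. \<bar>a k\<bar> * \<bar>y k\<bar>)"
    using sum_abs[of "\<lambda>k. a k * y k" K] by (simp add: abs_mult)
  also have "\<dots> \<le> L2_set a K * L2_set y K" by (rule L2_set_mult_ineq)
  finally show ?thesis .
qed

text \<open>Using \<open>cosh\<close> of the norm in place of an exponential of a linear functional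
  is what keeps the dimension out. The chord bound holds pointwise, and its only random term is
  linear in \<open>Y\<close> and has mean zero.\<close>

lemma (in prob_space) nn_integral_cosh_step:
  fixes Y :: "'k \<Rightarrow> 'a \<Rightarrow> real"
  assumes K: "finite K" and meas: "\<And>k. k \<in> K \<Longrightarrow> Y k \<in> borel_measurable M"
    and bnd: "\<And>x. x \<in> space M \<Longrightarrow> L2_set (\<lambda>k. Y k x) K \<le> b"
    and zero: "\<And>k. k \<in> K \<Longrightarrow> expectation (Y k) = 0"
    and l: "l \<ge> 0"
  shows "(\<integral>\<^sup>+x. ennreal (cosh (l * L2_set (\<lambda>k. a k + Y k x) K)) \<partial>M)
    \<le> ennreal (cosh (l * L2_set a K) * cosh (l * b))"
proof -
  obtain x0 where "x0 \<in> space M" using not_empty by auto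
  then have b: "b \<ge> 0" using bnd[of x0] L2_set_nonneg[of "\<lambda>k. Y k x0" K] by linarith
  let ?A = "l * L2_set a K" and ?B = "l * b"
  define \<beta> where "\<beta> = l\<^sup>2 * (sinh ?A * sinh ?B / (?A * ?B))"
  let ?f = "\<lambda>x. cosh ?A * cosh ?B + (\<Sum>k\<in>K. a k * Y k x) * \<beta>"
  have pt: "cosh (l * L2_set (\<lambda>k. a k + Y k x) K) \<le> ?f x" if x: "x \<in> space M" for x
  proof -
    let ?N = "l * L2_set (\<lambda>k. a k + Y k x) K" and ?y = "(l * L2_set (\<lambda>k. Y k x) K)\<^sup>2"
    let ?c = "l\<^sup>2 * (\<Sum>k\<in>K. a k * Y k x)"
    have "(L2_set (\<lambda>k. Y k x) K)\<^sup>2 = (\<Sum>k\<in>K. (Y k x)\<^sup>2)"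
      by (simp add: L2_set_def sum_nonneg)
    then have sq: "?N\<^sup>2 = ?A\<^sup>2 + ?y + 2 * ?c"
      unfolding power_mult_distrib L2_set_add_square by (simp add: algebra_simps)
    have eq: "?N = sqrt (?A\<^sup>2 + ?y + 2 * ?c)"
      using l unfolding sq[symmetric] by (simp add: L2_set_nonneg)
    have "\<bar>\<Sum>k\<in>K. a k * Y k x\<bar> \<le> L2_set a K * b"
      by (rule order_trans[OF abs_inner_le_L2_set])
        (intro mult_left_mono bnd x L2_set_nonneg)
    then have c: "\<bar>?c\<bar> \<le> ?A * ?B"
      using mult_left_mono[of "\<bar>\<Sum>k\<in>K. a k * Y k x\<bar>" "L2_set a K * b" "l\<^sup>2"]
      by (simp add: abs_mult power2_eq_square mult_ac)
    have y: "?y \<le> ?B\<^sup>2"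
      using l bnd[OF x] by (intro power_mono mult_left_mono) (auto simp: L2_set_nonneg)
    have "0 \<le> ?A\<^sup>2 + ?y + 2 * ?c" by (simp flip: sq)
    then have "cosh ?N \<le> cosh ?A * cosh ?B + ?c * (sinh ?A * sinh ?B / (?A * ?B))"
      unfolding eq using l b by (intro cosh_sqrt_chord c y) (auto simp: L2_set_nonneg)
    then show ?thesis by (simp add: \<beta>_def algebra_simps)
  qed
  have intY: "integrable M (Y k)" if "k \<in> K" for k
  proof (rule integrable_const_bound[where B = b])
    have "\<bar>Y k x\<bar> \<le> b" if "x \<in> space M" for x
      using member_le_L2_set[OF K \<open>k \<in> K\<close>, of "\<lambda>k. \<bar>Y k x\<bar>"] bnd[OF that]
      by (simp add: L2_set_def)
    then show "AE x in M. norm (Y k x) \<le> b" by auto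
  qed (use meas that in auto)
  have nonneg: "0 \<le> ?f x" if "x \<in> space M" for x
    using pt[OF that] cosh_real_pos[of "l * L2_set (\<lambda>k. a k + Y k x) K"] by linarith
  have int: "integrable M ?f" using intY by auto
  have "(\<integral>\<^sup>+x. ennreal (cosh (l * L2_set (\<lambda>k. a k + Y k x) K)) \<partial>M) \<le> (\<integral>\<^sup>+x. ennreal (?f x) \<partial>M)"
    by (intro nn_integral_mono ennreal_leI pt)
  also have "\<dots> = ennreal (expectation ?f)"
    by (rule nn_integral_eq_integral[OF int]) (use nonneg in auto)
  also have "expectation ?f = cosh ?A * cosh ?B"
    using intY zero prob_space by simp
  finally show ?thesis .
qed

text \<open>The arbitrary shift \<open>a\<close> carries the induction: with coordinate
  \<open>i\<close> fixed its value joins the shift, the induction hypothesis integrates out the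
  other coordinates, and one application of the step lemma removes coordinate
  \<open>i\<close>.\<close>

lemma nn_integral_cosh_sum:
  fixes M :: "'i \<Rightarrow> 'a measure" and Y :: "'i \<Rightarrow> 'k \<Rightarrow> 'a \<Rightarrow> real"
  assumes M: "\<And>i. prob_space (M i)" and I: "finite I" and K: "finite K"
    and meas: "\<And>i k. i \<in> I \<Longrightarrow> k \<in> K \<Longrightarrow> Y i k \<in> borel_measurable (M i)"
    and bnd: "\<And>i x. i \<in> I \<Longrightarrow> x \<in> space (M i) \<Longrightarrow> L2_set (\<lambda>k. Y i k x) K \<le> b"
    and zero: "\<And>i k. i \<in> I \<Longrightarrow> k \<in> K \<Longrightarrow> (\<integral>x. Y i k x \<partial>M i) = 0"
    and l: "l \<ge> 0"
  shows "(\<integral>\<^sup>+x. ennreal (cosh (l * L2_set (\<lambda>k. a k + (\<Sum>i\<in>I. Y i k (x i))) K)) \<partial>PiM I M)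
    \<le> ennreal (cosh (l * L2_set a K) * cosh (l * b) ^ card I)"
  using I meas bnd zero
proof (induction I arbitrary: a)
  case empty
  interpret prob_space "PiM {} M" by (rule prob_space_PiM) (use M in auto)
  show ?case by (simp add: emeasure_space_1)
next
  case (insert i I)
  interpret product_prob_space M by (intro product_prob_spaceI M)
  have [measurable]: "Y j k \<in> borel_measurable (M j)" if "j \<in> insert i I" "k \<in> K" for j k
    using insert.prems that by auto
  have "(\<integral>\<^sup>+x. ennreal (cosh (l * L2_set (\<lambda>k. a k + (\<Sum>j\<in>insert i I. Y j k (x j))) K)) \<partial>PiM (insert i I) M)
    = (\<integral>\<^sup>+y. \<integral>\<^sup>+x. ennreal (cosh (l * L2_set (\<lambda>k. a k + (\<Sum>j\<in>insert i I. Y j k ((x(i := y)) j))) K))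
          \<partial>PiM I M \<partial>M i)"
    using insert.hyps by (intro product_nn_integral_insert_rev) (auto simp: L2_set_def cosh_field_def)
  also have "\<dots> = (\<integral>\<^sup>+y. \<integral>\<^sup>+x. ennreal (cosh (l * L2_set (\<lambda>k. (a k + Y i k y) + (\<Sum>j\<in>I. Y j k (x j))) K))
          \<partial>PiM I M \<partial>M i)"
  proof -
    have "(\<Sum>j\<in>insert i I. Y j k ((x(i := y)) j)) = Y i k y + (\<Sum>j\<in>I. Y j k (x j))" for x y k
      using insert.hyps by (subst sum.insert) (auto intro!: sum.cong)
    then show ?thesis by (simp add: add.assoc)
  qed
  also have "\<dots> \<le> (\<integral>\<^sup>+y. ennreal (cosh (l * L2_set (\<lambda>k. a k + Y i k y) K) * cosh (l * b) ^ card I) \<partial>M i)"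
    using insert.prems by (intro nn_integral_mono insert.IH) auto
  also have "\<dots> = (\<integral>\<^sup>+y. ennreal (cosh (l * L2_set (\<lambda>k. a k + Y i k y) K)) \<partial>M i) * ennreal (cosh (l * b) ^ card I)"
  proof -
    have "(\<lambda>y. ennreal (cosh (l * L2_set (\<lambda>k. a k + Y i k y) K))) \<in> borel_measurable (M i)"
      by (simp add: L2_set_def cosh_field_def)
    from nn_integral_multc[OF this, of "ennreal (cosh (l * b) ^ card I)"] show ?thesis
      by (simp add: ennreal_mult)
  qed
  also have "\<dots> \<le> ennreal (cosh (l * L2_set a K) * cosh (l * b)) * ennreal (cosh (l * b) ^ card I)"
    using insert.prems by (intro mult_right_mono prob_space.nn_integral_cosh_step[OF M] K l) auto
  also have "\<dots> = ennreal (cosh (l * L2_set a K) * cosh (l * b) ^ card (insert i I))"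
    using insert.hyps by (simp add: ennreal_mult[symmetric] mult_ac)
  finally show ?case .
qed

text \<open>The bound does not depend on the dimension \<open>card K\<close>.\<close>

theorem vector_Hoeffding:
  fixes M :: "'i \<Rightarrow> 'a measure" and Y :: "'i \<Rightarrow> 'k \<Rightarrow> 'a \<Rightarrow> real"
  assumes M: "\<And>i. prob_space (M i)" and I: "finite I" "I \<noteq> {}" and K: "finite K"
    and meas: "\<And>i k. i \<in> I \<Longrightarrow> k \<in> K \<Longrightarrow> Y i k \<in> borel_measurable (M i)"
    and bnd: "\<And>i x. i \<in> I \<Longrightarrow> x \<in> space (M i) \<Longrightarrow> L2_set (\<lambda>k. Y i k x) K \<le> b"
    and zero: "\<And>i k. i \<in> I \<Longrightarrow> k \<in> K \<Longrightarrow> (\<integral>x. Y i k x \<partial>M i) = 0"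
    and b: "b > 0" and r: "r \<ge> 0"
  shows "emeasure (PiM I M) {x \<in> space (PiM I M). L2_set (\<lambda>k. \<Sum>i\<in>I. Y i k (x i)) K \<ge> r}
    \<le> ennreal (2 * exp (- r\<^sup>2 / (2 * real (card I) * b\<^sup>2)))"
proof -
  have [measurable]: "Y j k \<in> borel_measurable (M j)" if "j \<in> I" "k \<in> K" for j k
    using meas that by auto
  define n where "n = real (card I)"
  have n: "n > 0" using I by (simp add: n_def card_gt_0_iff)
  \<comment> \<open>The minimiser of the exponent \<open>n * (l * b)\<^sup>2 / 2 - l * r\<close> of
    the Chernoff bound.\<close>
  define l where "l = r / (n * b\<^sup>2)"
  have l: "l \<ge> 0" using r n by (simp add: l_def)
  let ?S = "\<lambda>x. L2_set (\<lambda>k. \<Sum>i\<in>I. Y i k (x i)) K"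
  let ?E = "{x \<in> space (PiM I M). ?S x \<ge> r}"
  have [measurable]: "?S \<in> borel_measurable (PiM I M)"
    unfolding L2_set_def by measurable
  have "ennreal (cosh (l * r)) * emeasure (PiM I M) ?E
      = (\<integral>\<^sup>+x. ennreal (cosh (l * r)) * indicator ?E x \<partial>PiM I M)"
    by (subst nn_integral_cmult_indicator) auto
  also have "\<dots> \<le> (\<integral>\<^sup>+x. ennreal (cosh (l * ?S x)) \<partial>PiM I M)"
  proof (intro nn_integral_mono)
    fix x
    show "ennreal (cosh (l * r)) * indicator ?E x \<le> ennreal (cosh (l * ?S x))"
    proof (cases "x \<in> ?E")
      case True
      then have "cosh (l * r) \<le> cosh (l * ?S x)"
        using l r by (subst cosh_real_nonneg_le_iff) (auto intro: mult_left_mono)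
      then show ?thesis using True by (simp add: ennreal_leI)
    qed simp
  qed
  also have "\<dots> = (\<integral>\<^sup>+x. ennreal (cosh (l * L2_set (\<lambda>k. (\<lambda>_. 0) k + (\<Sum>i\<in>I. Y i k (x i))) K)) \<partial>PiM I M)"
    by simp
  also have "\<dots> \<le> ennreal (cosh (l * L2_set (\<lambda>_. 0) K) * cosh (l * b) ^ card I)"
    by (rule nn_integral_cosh_sum) (use assms l in auto)
  also have "\<dots> \<le> ennreal (exp ((l * b)\<^sup>2 / 2 * n))"
  proof (rule ennreal_leI)
    have "cosh (l * b) ^ card I \<le> exp ((l * b)\<^sup>2 / 2) ^ card I"
      by (intro power_mono cosh_le_exp_half_square) simp
    then show "cosh (l * L2_set (\<lambda>_. 0) K) * cosh (l * b) ^ card I \<le> exp ((l * b)\<^sup>2 / 2 * n)"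
      by (simp add: n_def L2_set_def exp_of_nat_mult[symmetric] mult.commute)
  qed
  also have "(l * b)\<^sup>2 / 2 * n = l * r / 2"
    using n b by (simp add: l_def power2_eq_square field_simps)
  finally have *: "ennreal (cosh (l * r)) * emeasure (PiM I M) ?E \<le> ennreal (exp (l * r / 2))" .
  \<comment> \<open>Passing from \<open>cosh\<close> back to \<open>exp\<close> costs the factor
    \<open>2\<close> of the final bound.\<close>
  have "ennreal (exp (l * r) / 2) * emeasure (PiM I M) ?E \<le> ennreal (cosh (l * r)) * emeasure (PiM I M) ?E"
    by (intro mult_right_mono ennreal_leI) (simp_all add: cosh_def)
  also note *
  finally have **: "ennreal (exp (l * r) / 2) * emeasure (PiM I M) ?E \<le> ennreal (exp (l * r / 2))" .
  have "emeasure (PiM I M) ?E = ennreal (2 * exp (- (l * r))) * (ennreal (exp (l * r) / 2) * emeasure (PiM I M) ?E)"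
    by (simp add: mult.assoc[symmetric] ennreal_mult[symmetric] exp_minus)
  also have "\<dots> \<le> ennreal (2 * exp (- (l * r))) * ennreal (exp (l * r / 2))"
    by (intro mult_left_mono **) simp
  also have "\<dots> = ennreal (2 * exp (- (l * r / 2)))"
    by (simp add: ennreal_mult[symmetric] mult.assoc exp_add[symmetric])
  also have "l * r / 2 = r\<^sup>2 / (2 * real (card I) * b\<^sup>2)"
    using n b by (simp add: l_def n_def power2_eq_square field_simps)
  finally show ?thesis by simp
qed

section \<open>Random Fourier features\<close>

text \<open>The standard deviation is \<open>1 / \<sigma>\<close>, so the substitution of
  \<open>x / \<sigma>\<close> for \<open>x\<close> reduces to the characteristic function of the
  standard normal law.\<close>

lemma char_normal_density:
  assumes \<sigma>: "\<sigma> > 0"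
  shows "(CLINT x|density lborel (normal_density 0 (1 / \<sigma>)). iexp (t * x))
    = complex_of_real (exp (- ((t / \<sigma>)\<^sup>2 / 2)))"
proof -
  have "(CLINT x|density lborel (normal_density 0 (1 / \<sigma>)). iexp (t * x))
      = (CLINT x|lborel. complex_of_real (normal_density 0 (1 / \<sigma>) x) * iexp (t * x))"
    by (subst integral_density) (auto simp: scaleR_conv_of_real)
  also have "\<dots> = (1 / \<sigma>) *\<^sub>R
      (CLINT x|lborel. complex_of_real (normal_density 0 (1 / \<sigma>) (x / \<sigma>)) * iexp (t * (x / \<sigma>)))"
    using lborel_integral_real_affine[of "1 / \<sigma>" _ 0] \<sigma> by (subst lborel_integral_real_affine[of "1 / \<sigma>" _ 0]) auto
  also have "\<dots> = (CLINT x|lborel. complex_of_real (std_normal_density x) * iexp (t / \<sigma> * x))"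
  proof -
    have "1 / \<sigma> * normal_density 0 (1 / \<sigma>) (x / \<sigma>) = std_normal_density x" for x
      using \<sigma> by (simp add: normal_density_def real_sqrt_mult real_sqrt_divide power_divide field_simps)
    then have "(1 / \<sigma>) *\<^sub>R (complex_of_real (normal_density 0 (1 / \<sigma>) (x / \<sigma>)) * z)
        = complex_of_real (std_normal_density x) * z" for x z
      by (metis (no_types) mult.assoc of_real_mult scaleR_conv_of_real)
    then show ?thesis by (subst integral_scaleR_right[symmetric]) (simp add: mult.assoc)
  qed
  also have "\<dots> = char std_normal_distribution (t / \<sigma>)"
    unfolding char_def by (subst integral_density) (auto simp: scaleR_conv_of_real)
  also have "\<dots> = complex_of_real (exp (- ((t / \<sigma>)\<^sup>2 / 2)))"
    by (simp add: char_std_normal_distribution)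
  finally show ?thesis .
qed

text \<open>Bounds the first absolute moment by the variance \<open>1 / \<sigma>\<^sup>2\<close>,
  through the inequality between the geometric and arithmetic means of
  \<open>\<sigma> * x\<^sup>2\<close> and \<open>1 / \<sigma>\<close>.\<close>

lemma nn_integral_abs_normal_density:
  assumes \<sigma>: "\<sigma> > 0"
  shows "(\<integral>\<^sup>+x. ennreal \<bar>x\<bar> \<partial>density lborel (normal_density 0 (1 / \<sigma>))) \<le> ennreal (1 / \<sigma>)"
proof -
  let ?G = "density lborel (normal_density 0 (1 / \<sigma>))"
  interpret prob_space ?G using \<sigma> by (intro prob_space_normal_density) simp
  have hb: "has_bochner_integral lborel (\<lambda>x. normal_density 0 (1 / \<sigma>) x * (x - 0) ^ (2 * 1))
      (fact (2 * 1) / ((2 / (1 / \<sigma>)\<^sup>2) ^ 1 * fact 1))"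
    using \<sigma> by (intro normal_moment_even) simp
  then have hb': "has_bochner_integral lborel (\<lambda>x. normal_density 0 (1 / \<sigma>) x *\<^sub>R x\<^sup>2) (1 / \<sigma>\<^sup>2)"
    using \<sigma> by (simp add: power_divide)
  have int: "has_bochner_integral ?G (\<lambda>x. x\<^sup>2) (1 / \<sigma>\<^sup>2)"
    by (rule has_bochner_integral_density[OF _ _ _ hb']) auto
  have "(\<integral>\<^sup>+x. ennreal \<bar>x\<bar> \<partial>?G) \<le> (\<integral>\<^sup>+x. ennreal ((\<sigma> * x\<^sup>2 + 1 / \<sigma>) / 2) \<partial>?G)"
  proof (intro nn_integral_mono ennreal_leI)
    fix x :: real
    have "0 \<le> (\<sigma> * \<bar>x\<bar> - 1)\<^sup>2 / \<sigma>" using \<sigma> by simp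
    also have "\<dots> = \<sigma> * x\<^sup>2 + 1 / \<sigma> - 2 * \<bar>x\<bar>"
      using \<sigma> by (simp add: power2_eq_square field_simps)
    finally show "\<bar>x\<bar> \<le> (\<sigma> * x\<^sup>2 + 1 / \<sigma>) / 2" by simp
  qed
  also have "\<dots> = ennreal (\<integral>x. (\<sigma> * x\<^sup>2 + 1 / \<sigma>) / 2 \<partial>?G)"
    using int \<sigma> by (intro nn_integral_eq_integral) (auto simp: has_bochner_integral_iff)
  also have "(\<integral>x. (\<sigma> * x\<^sup>2 + 1 / \<sigma>) / 2 \<partial>?G) = 1 / \<sigma>"
  proof -
    have "(\<integral>x. (\<sigma> * x\<^sup>2 + 1 / \<sigma>) / 2 \<partial>?G) = (\<sigma> * (1 / \<sigma>\<^sup>2) + 1 / \<sigma>) / 2"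
      using int prob_space by (simp add: has_bochner_integral_iff)
    then show ?thesis using \<sigma> by (simp add: power2_eq_square)
  qed
  finally show ?thesis .
qed

lemma abs_cos_diff_le: "\<bar>cos a - cos b\<bar> \<le> \<bar>a - b\<bar>" for a b :: real
proof -
  have "\<bar>cos a - cos b\<bar> = 2 * (\<bar>sin ((a + b) / 2)\<bar> * \<bar>sin ((b - a) / 2)\<bar>)"
    by (simp add: cos_diff_cos abs_mult)
  also have "\<dots> \<le> 2 * (1 * \<bar>(b - a) / 2\<bar>)"
    by (intro mult_left_mono mult_mono abs_sin_x_le_abs_x) auto
  finally show ?thesis by simp
qed

type_synonym freqs = "nat \<times> nat \<times> nat \<Rightarrow> real"

text \<open>The inner product of two random feature vectors whose arguments differ by
  \<open>u\<close>: each pair of cosine and sine coordinates contributes the cosine of a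
  difference.\<close>

definition empirical_kernel :: "nat \<Rightarrow> nat \<Rightarrow> nat \<Rightarrow> freqs \<Rightarrow> (nat \<Rightarrow> real) \<Rightarrow> real" where
  "empirical_kernel M n l w u = (\<Sum>j<M. cos (\<Sum>r<n. w (l, j, r) * u r)) / real M"

definition rbf :: "nat \<Rightarrow> real \<Rightarrow> (nat \<Rightarrow> real) \<Rightarrow> real" where
  "rbf n \<sigma> u = exp (- ((\<Sum>r<n. (u r)\<^sup>2) / (2 * \<sigma>\<^sup>2)))"

text \<open>The index set \<open>J\<close> is larger than the block under study because the
  frequencies of all levels live on one product space; only the block of level \<open>l\<close> is
  examined.\<close>

locale gaussian_frequencies =
  fixes J :: "(nat \<times> nat \<times> nat) set" and \<sigma> :: real and l M n :: nat
  assumes finite_J: "finite J" and block: "{l} \<times> {..<M} \<times> {..<n} \<subseteq> J"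
    and \<sigma>_pos: "\<sigma> > 0" and M_pos: "M > 0" and n_pos: "n > 0"
begin

abbreviation "G \<equiv> density lborel (normal_density 0 (1 / \<sigma>))"
abbreviation "W \<equiv> PiM J (\<lambda>_. G)"

sublocale product_prob_space "\<lambda>_. G" J
  using \<sigma>_pos by (intro product_prob_spaceI prob_space_normal_density) simp

sublocale prob_space W
  by (rule prob_space_PiM) (use \<sigma>_pos in \<open>intro prob_space_normal_density, simp\<close>)

lemma mem_block: "j < M \<Longrightarrow> r < n \<Longrightarrow> (l, j, r) \<in> J"
  using block by auto

lemma measurable_freq [measurable]:
  "j < M \<Longrightarrow> r < n \<Longrightarrow> (\<lambda>w. w (l, j, r)) \<in> borel_measurable W"
  using mem_block measurable_component_singleton[of "(l, j, r)" J "\<lambda>_. G"] by simp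

text \<open>The cosine is the real part of a product of characters over independent coordinates. The
  factors \<open>f\<close> are \<open>1\<close> outside the block of frequency \<open>j\<close>, so
  the product can be taken over all of \<open>J\<close> and integrated factor by factor.\<close>

lemma expectation_cos:
  assumes j: "j < M"
  shows "expectation (\<lambda>w. cos (\<Sum>r<n. w (l, j, r) * u r)) = rbf n \<sigma> u"
proof -
  define f :: "nat \<times> nat \<times> nat \<Rightarrow> real \<Rightarrow> complex"
    where "f i x = (if i \<in> {l} \<times> {j} \<times> {..<n} then iexp (u (snd (snd i)) * x) else 1)" for i x
  have sub: "{l} \<times> {j} \<times> {..<n} \<subseteq> J" using mem_block j by auto
  have prod_eq: "(\<Prod>i\<in>J. g i) = (\<Prod>r<n. g (l, j, r))"
    if "\<And>i. i \<in> J - {l} \<times> {j} \<times> {..<n} \<Longrightarrow> g i = 1" for g :: "_ \<Rightarrow> complex"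
  proof -
    have "(\<Prod>i\<in>J. g i) = (\<Prod>i\<in>{l} \<times> {j} \<times> {..<n}. g i)"
      by (intro prod.mono_neutral_right finite_J sub) (use that in auto)
    also have "{l} \<times> {j} \<times> {..<n} = (\<lambda>r. (l, j, r)) ` {..<n}" by auto
    finally show ?thesis by (simp add: prod.reindex inj_on_def)
  qed
  have "(CLINT w|W. iexp (\<Sum>r<n. w (l, j, r) * u r)) = (CLINT w|W. (\<Prod>i\<in>J. f i (w i)))"
    by (subst prod_eq) (auto simp: f_def sum_distrib_left exp_sum mult.commute)
  also have "\<dots> = (\<Prod>i\<in>J. CLINT x|G. f i x)"
  proof (intro product_integral_prod finite_J)
    fix i
    have "integrable G (\<lambda>x. iexp (t * x))" for t
      by (intro M.integrable_const_bound[where B = 1]) auto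
    then show "integrable G (f i)"
      by (cases "i \<in> {l} \<times> {j} \<times> {..<n}") (simp_all add: f_def[abs_def])
  qed
  also have "\<dots> = (\<Prod>r<n. CLINT x|G. iexp (u r * x))"
    by (subst prod_eq) (auto simp: f_def[abs_def] M.prob_space[simplified])
  also have "\<dots> = complex_of_real (rbf n \<sigma> u)"
    unfolding char_normal_density[OF \<sigma>_pos]
    by (simp add: rbf_def exp_sum[symmetric] sum_negf[symmetric] sum_divide_distrib power_divide mult.commute
        flip: of_real_prod)
  finally have "Re (CLINT w|W. iexp (\<Sum>r<n. w (l, j, r) * u r)) = rbf n \<sigma> u" by simp
  moreover have "integrable W (\<lambda>w. iexp (\<Sum>r<n. w (l, j, r) * u r))"
    using j by (intro integrable_const_bound[where B = 1]) auto
  moreover have Re_iexp: "Re (iexp x) = cos x" for x :: real by (simp add: Re_exp)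
  ultimately show ?thesis
    using integral_Re[of W "\<lambda>w. iexp (\<Sum>r<n. w (l, j, r) * u r)"] unfolding Re_iexp by simp
qed


lemma nn_integral_abs_freq:
  assumes "j < M" "r < n"
  shows "(\<integral>\<^sup>+w. ennreal \<bar>w (l, j, r)\<bar> \<partial>W) \<le> ennreal (1 / \<sigma>)"
proof -
  have "(\<lambda>w. w (l, j, r)) \<in> measurable W G"
    by (rule measurable_component_singleton) (rule mem_block[OF assms])
  then have "(\<integral>\<^sup>+w. ennreal \<bar>w (l, j, r)\<bar> \<partial>W) = (\<integral>\<^sup>+x. ennreal \<bar>x\<bar> \<partial>distr W G (\<lambda>w. w (l, j, r)))"
    by (subst nn_integral_distr) auto
  also have "distr W G (\<lambda>w. w (l, j, r)) = G"
    by (rule PiM_component) (use mem_block[OF assms] finite_J in auto)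
  finally show ?thesis using nn_integral_abs_normal_density[OF \<sigma>_pos] by simp
qed

text \<open>The Lipschitz bound comes from the representation of the kernel as the expectation of a
  cosine, here with frequency \<open>0\<close>; the constant is then the bound on the first absolute
  moments.\<close>

lemma abs_rbf_diff_le:
  assumes uv: "\<And>r. r < n \<Longrightarrow> \<bar>u r - v r\<bar> \<le> mesh"
  shows "\<bar>rbf n \<sigma> u - rbf n \<sigma> v\<bar> \<le> mesh * (n / \<sigma>)"
proof -
  let ?a = "\<lambda>u w. cos (\<Sum>r<n. w (l, 0, r) * u r)"
  have mesh: "mesh \<ge> 0" using uv[OF n_pos] by linarith
  have int: "integrable W (?a u)" for u
    using M_pos by (intro integrable_const_bound[where B = 1]) auto
  have "ennreal \<bar>rbf n \<sigma> u - rbf n \<sigma> v\<bar> = ennreal (norm (expectation (\<lambda>w. ?a u w - ?a v w)))"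
    using int M_pos by (simp add: expectation_cos)
  also have "\<dots> \<le> (\<integral>\<^sup>+w. ennreal (norm (?a u w - ?a v w)) \<partial>W)"
    using int by (intro integral_norm_bound_ennreal) auto
  also have "\<dots> \<le> (\<integral>\<^sup>+w. (\<Sum>r<n. ennreal mesh * ennreal \<bar>w (l, 0, r)\<bar>) \<partial>W)"
  proof (intro nn_integral_mono)
    fix w
    have "norm (?a u w - ?a v w) \<le> \<bar>\<Sum>r<n. w (l, 0, r) * (u r - v r)\<bar>"
      using abs_cos_diff_le[of "\<Sum>r<n. w (l, 0, r) * u r" "\<Sum>r<n. w (l, 0, r) * v r"]
      by (simp add: sum_subtractf right_diff_distrib)
    also have "\<dots> \<le> (\<Sum>r<n. mesh * \<bar>w (l, 0, r)\<bar>)"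
      by (rule order_trans[OF sum_abs], intro sum_mono)
        (use uv in \<open>auto simp: abs_mult mult.commute intro!: mult_right_mono\<close>)
    finally have "ennreal (norm (?a u w - ?a v w)) \<le> ennreal (\<Sum>r<n. mesh * \<bar>w (l, 0, r)\<bar>)"
      by (rule ennreal_leI)
    then show "ennreal (norm (?a u w - ?a v w)) \<le> (\<Sum>r<n. ennreal mesh * ennreal \<bar>w (l, 0, r)\<bar>)"
      using mesh by (simp add: ennreal_mult[symmetric] sum_nonneg)
  qed
  also have "\<dots> = (\<Sum>r<n. ennreal mesh * (\<integral>\<^sup>+w. ennreal \<bar>w (l, 0, r)\<bar> \<partial>W))"
    using M_pos by (subst nn_integral_sum) (auto simp: nn_integral_cmult)
  also have "\<dots> \<le> (\<Sum>r<n. ennreal mesh * ennreal (1 / \<sigma>))"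
    using M_pos by (intro sum_mono mult_left_mono nn_integral_abs_freq) auto
  also have "\<dots> = ennreal (mesh * (n / \<sigma>))"
    using mesh \<sigma>_pos by (simp add: ennreal_mult[symmetric] mult_ac ennreal_of_nat_eq_real_of_nat)
  finally show ?thesis
    using mesh \<sigma>_pos by (subst (asm) ennreal_le_iff) auto
qed

lemma indep_features:
  "indep_vars (\<lambda>_. borel) (\<lambda>j w. cos (\<Sum>r<n. w (l, j, r) * u r)) {..<M}"
proof -
  have coord: "indep_vars (\<lambda>_. G) (\<lambda>i w. w i) J"
  proof -
    have False: "J \<noteq> {}" using mem_block[OF M_pos n_pos] by auto
    have "distr W W (\<lambda>x. restrict x J) = W"
      by (subst distr_cong[OF refl refl, where g = "\<lambda>x. x"]) (auto simp: space_PiM)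
    moreover have "distr W G (\<lambda>w. w i) = G" if "i \<in> J" for i
      by (rule PiM_component) (use that finite_J in auto)
    ultimately show ?thesis
      using False measurable_component_singleton[of _ J "\<lambda>_. G"]
      by (subst indep_vars_iff_distr_eq_PiM') (auto cong: PiM_cong simp: restrict_def)
  qed
  have "indep_vars (\<lambda>j. PiM ({l} \<times> {j} \<times> {..<n}) (\<lambda>_. G))
      (\<lambda>j w. restrict (\<lambda>i. w i) ({l} \<times> {j} \<times> {..<n})) {..<M}"
    by (rule indep_vars_restrict[OF coord]) (use block in \<open>auto simp: disjoint_family_on_def\<close>)
  then have "indep_vars (\<lambda>_. borel)
      (\<lambda>j w. cos (\<Sum>r<n. (restrict (\<lambda>i. w i) ({l} \<times> {j} \<times> {..<n})) (l, j, r) * u r)) {..<M}"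
  proof (rule indep_vars_compose2)
    fix j
    have [measurable]: "(\<lambda>w. w (l, j, r)) \<in> borel_measurable (PiM ({l} \<times> {j} \<times> {..<n}) (\<lambda>_. G))"
      if "r < n" for r
      using that measurable_component_singleton[of "(l, j, r)" "{l} \<times> {j} \<times> {..<n}" "\<lambda>_. G"] by simp
    show "(\<lambda>w. cos (\<Sum>r<n. w (l, j, r) * u r))
        \<in> borel_measurable (PiM ({l} \<times> {j} \<times> {..<n}) (\<lambda>_. G))" by measurable
  qed
  then show ?thesis by simp
qed

lemma prob_kernel_deviation:
  assumes tol: "tol \<ge> 0"
  shows "prob {w \<in> space W. \<bar>empirical_kernel M n l w u - rbf n \<sigma> u\<bar> \<ge> tol} \<le> 2 * exp (- (real M * tol\<^sup>2 / 2))"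
proof -
  interpret Hoeffding_ineq W "{..<M}" "\<lambda>j w. cos (\<Sum>r<n. w (l, j, r) * u r)" "\<lambda>_. -1" "\<lambda>_. 1"
      "\<Sum>j<M. expectation (\<lambda>w. cos (\<Sum>r<n. w (l, j, r) * u r))"
    by unfold_locales (auto intro: indep_features)
  have eq: "{w \<in> space W. \<bar>empirical_kernel M n l w u - rbf n \<sigma> u\<bar> \<ge> tol}
      = {w \<in> space W. \<bar>(\<Sum>j<M. cos (\<Sum>r<n. w (l, j, r) * u r))
           - (\<Sum>j<M. expectation (\<lambda>w. cos (\<Sum>r<n. w (l, j, r) * u r)))\<bar> \<ge> real M * tol}"
  proof -
    have "\<bar>S / real M - k\<bar> \<ge> tol \<longleftrightarrow> \<bar>S - real M * k\<bar> \<ge> real M * tol" for S k :: real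
    proof -
      have "S - real M * k = M * (S / real M - k)" using M_pos by (simp add: field_simps)
      then have "\<bar>S - real M * k\<bar> = M * \<bar>S / real M - k\<bar>" by (simp add: abs_mult)
      then show ?thesis using M_pos by simp
    qed
    then show ?thesis by (simp add: empirical_kernel_def expectation_cos)
  qed
  have eq2: "(real M * tol)\<^sup>2 / (2 * real M) = real M * tol\<^sup>2 / 2"
    using M_pos by (simp add: power2_eq_square)
  show ?thesis
    unfolding eq using Hoeffding_ineq_abs_ge[of "real M * tol"] tol M_pos by (simp add: eq2)
qed

text \<open>Rounding \<open>u\<close> to the grid changes the empirical and the exact kernel by at
  most \<open>mesh * R\<close> each, which uses up \<open>tol / 2\<close>; the other
  \<open>tol / 2\<close> is the deviation allowed at grid points, whence the exponent
  \<open>M * tol\<^sup>2 / 8\<close>. The number of grid points in the box enters through the union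
  bound.\<close>

lemma uniform_kernel_approximation:
  assumes tol: "tol \<ge> 0" and mesh: "mesh > 0" and R: "R \<ge> n / \<sigma>" and meshR: "mesh * R \<le> tol / 4"
    and c: "c \<ge> 0"
  obtains B where "B \<in> sets W"
    "prob B \<le> n / (\<sigma> * R) + (2 * of_int \<lceil>c / mesh\<rceil> + 1) ^ n * (2 * exp (- (real M * tol\<^sup>2 / 8)))"
    "\<And>w u. w \<in> space W - B \<Longrightarrow> (\<And>r. r < n \<Longrightarrow> \<bar>u r\<bar> \<le> c) \<Longrightarrow>
       \<bar>empirical_kernel M n l w u - rbf n \<sigma> u\<bar> \<le> tol"
proof -
  have "n / \<sigma> > 0" using n_pos \<sigma>_pos by simp
  then have R0: "R > 0" using R by linarith
  define Z where "Z = \<lceil>c / mesh\<rceil>"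
  have Z: "Z \<ge> 0" using c mesh unfolding Z_def by (metis ceiling_mono ceiling_zero divide_nonneg_pos)
  define grid where "grid = PiE {..<n} (\<lambda>_. {- Z..Z})"
  have fin: "finite grid" by (auto simp: grid_def intro!: finite_PiE)
  have card: "real (card grid) = (2 * of_int Z + 1) ^ n"
    using Z by (simp add: grid_def card_PiE)
  define v where "v g r = mesh * of_int (g r)" for g :: "nat \<Rightarrow> int" and r
  \<comment> \<open>Outside this event \<open>R\<close> is a Lipschitz constant of the empirical
    kernel for the maximum norm. Markov's inequality bounds its probability by
    \<open>n / (\<sigma> * R)\<close>.\<close>
  define B1 where "B1 = {w \<in> space W. (\<Sum>j<M. \<Sum>r<n. \<bar>w (l, j, r)\<bar>) / real M \<ge> R}"
  define B2 where "B2 g = {w \<in> space W. \<bar>empirical_kernel M n l w (v g) - rbf n \<sigma> (v g)\<bar> \<ge> tol / 2}" for g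
  have B1: "B1 \<in> sets W" unfolding B1_def by measurable
  have B2: "B2 g \<in> sets W" for g unfolding B2_def empirical_kernel_def by measurable
  have p1: "prob B1 \<le> n / (\<sigma> * R)"
  proof -
    have "ennreal (R * M) * emeasure W B1 = (\<integral>\<^sup>+w. ennreal (R * M) * indicator B1 w \<partial>W)"
      by (simp add: nn_integral_cmult_indicator B1)
    also have "\<dots> \<le> (\<integral>\<^sup>+w. (\<Sum>j<M. \<Sum>r<n. ennreal \<bar>w (l, j, r)\<bar>) \<partial>W)"
    proof (intro nn_integral_mono)
      fix w
      show "ennreal (R * M) * indicator B1 w \<le> (\<Sum>j<M. \<Sum>r<n. ennreal \<bar>w (l, j, r)\<bar>)"
      proof (cases "w \<in> B1")
        case True
        then have "R * M \<le> (\<Sum>j<M. \<Sum>r<n. \<bar>w (l, j, r)\<bar>)"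
          using M_pos by (simp add: B1_def field_simps)
        then have "ennreal (R * M) \<le> ennreal (\<Sum>j<M. \<Sum>r<n. \<bar>w (l, j, r)\<bar>)" by (rule ennreal_leI)
        then show ?thesis using True by (simp add: sum_nonneg)
      qed simp
    qed
    also have "\<dots> = (\<Sum>j<M. \<Sum>r<n. (\<integral>\<^sup>+w. ennreal \<bar>w (l, j, r)\<bar> \<partial>W))"
    proof -
      have "(\<integral>\<^sup>+w. (\<Sum>r<n. ennreal \<bar>w (l, j, r)\<bar>) \<partial>W) = (\<Sum>r<n. (\<integral>\<^sup>+w. ennreal \<bar>w (l, j, r)\<bar> \<partial>W))"
        if "j < M" for j
        using that by (intro nn_integral_sum) auto
      then show ?thesis by (subst nn_integral_sum) (auto simp del: sum_ennreal)
    qed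
    also have "\<dots> \<le> (\<Sum>j<M. \<Sum>r<n. ennreal (1 / \<sigma>))"
      by (intro sum_mono nn_integral_abs_freq) auto
    also have "\<dots> = ennreal (M * n / \<sigma>)"
      using \<sigma>_pos by (simp add: ennreal_of_nat_eq_real_of_nat ennreal_mult[symmetric])
    finally have "R * M * prob B1 \<le> M * n / \<sigma>"
      using R0 \<sigma>_pos by (simp add: emeasure_eq_measure ennreal_mult[symmetric])
    then have "real M * (R * prob B1) \<le> real M * (n / \<sigma>)"
      by (simp add: mult_ac)
    then have "R * prob B1 \<le> n / \<sigma>"
      using M_pos by (subst (asm) mult_le_cancel_left_pos) auto
    then show ?thesis using R0 \<sigma>_pos by (simp add: field_simps)
  qed
  have p2: "prob (B2 g) \<le> 2 * exp (- (real M * tol\<^sup>2 / 8))" for g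
    using prob_kernel_deviation[of "tol / 2" "v g"] tol by (simp add: B2_def power_divide)
  show thesis
  proof (rule that[of "B1 \<union> (\<Union>g\<in>grid. B2 g)"])
    show "B1 \<union> (\<Union>g\<in>grid. B2 g) \<in> sets W"
      using B1 B2 fin by auto
    have "prob (B1 \<union> (\<Union>g\<in>grid. B2 g)) \<le> prob B1 + prob (\<Union>g\<in>grid. B2 g)"
      using B1 B2 fin by (intro measure_Un_le) auto
    also have "prob (\<Union>g\<in>grid. B2 g) \<le> (\<Sum>g\<in>grid. prob (B2 g))"
      using B2 by (intro finite_measure_subadditive_finite fin) auto
    also have "\<dots> \<le> (\<Sum>g\<in>grid. 2 * exp (- (real M * tol\<^sup>2 / 8)))"
      by (intro sum_mono p2)
    finally show "prob (B1 \<union> (\<Union>g\<in>grid. B2 g))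
        \<le> n / (\<sigma> * R) + (2 * of_int \<lceil>c / mesh\<rceil> + 1) ^ n * (2 * exp (- (real M * tol\<^sup>2 / 8)))"
      using p1 by (simp add: card flip: Z_def)
  next
    fix w u assume w: "w \<in> space W - (B1 \<union> (\<Union>g\<in>grid. B2 g))" and u: "\<And>r. r < n \<Longrightarrow> \<bar>u r\<bar> \<le> c"
    define g where "g = (\<lambda>r\<in>{..<n}. \<lfloor>u r / mesh\<rfloor>)"
    have g: "g \<in> grid"
      unfolding grid_def g_def
    proof (rule restrict_PiE_iff[THEN iffD2], intro ballI)
      fix r assume "r \<in> {..<n}"
      then have "\<bar>u r / mesh\<bar> \<le> c / mesh" using u mesh by (simp add: abs_divide divide_right_mono)
      then have "u r / mesh \<le> c / mesh" "- (u r / mesh) \<le> c / mesh"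
        by (rule abs_le_D1, rule abs_le_D2)
      then show "\<lfloor>u r / mesh\<rfloor> \<in> {- Z..Z}" unfolding Z_def atLeastAtMost_iff by linarith
    qed
    have close: "\<bar>u r - v g r\<bar> \<le> mesh" if "r < n" for r
    proof -
      have "\<bar>u r / mesh - of_int \<lfloor>u r / mesh\<rfloor>\<bar> \<le> 1" by linarith
      then have "mesh * \<bar>u r / mesh - of_int \<lfloor>u r / mesh\<rfloor>\<bar> \<le> mesh * 1" using mesh by (intro mult_left_mono) auto
      then have "\<bar>mesh * (u r / mesh - of_int \<lfloor>u r / mesh\<rfloor>)\<bar> \<le> mesh" using mesh by (simp only: abs_mult)
      then show ?thesis using that mesh by (simp add: v_def g_def right_diff_distrib)
    qed
    have "\<bar>(\<Sum>j<M. cos (\<Sum>r<n. w (l, j, r) * u r)) - (\<Sum>j<M. cos (\<Sum>r<n. w (l, j, r) * v g r))\<bar>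
        \<le> (\<Sum>j<M. \<Sum>r<n. mesh * \<bar>w (l, j, r)\<bar>)"
      unfolding sum_subtractf[symmetric]
    proof (rule order_trans[OF sum_abs], intro sum_mono)
      fix j
      show "\<bar>cos (\<Sum>r<n. w (l, j, r) * u r) - cos (\<Sum>r<n. w (l, j, r) * v g r)\<bar>
          \<le> (\<Sum>r<n. mesh * \<bar>w (l, j, r)\<bar>)"
        by (rule order_trans[OF abs_cos_diff_le], unfold sum_subtractf[symmetric] right_diff_distrib[symmetric],
            rule order_trans[OF sum_abs], intro sum_mono)
          (use close in \<open>auto simp: abs_mult mult.commute intro!: mult_right_mono\<close>)
    qed
    also have "\<dots> \<le> mesh * (R * M)"
      using w M_pos mesh by (auto simp: B1_def sum_distrib_left[symmetric] field_simps)
    finally have "\<bar>empirical_kernel M n l w u - empirical_kernel M n l w (v g)\<bar> \<le> mesh * R"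
      using M_pos by (simp add: empirical_kernel_def diff_divide_distrib[symmetric] abs_divide field_simps)
    moreover have "\<bar>rbf n \<sigma> u - rbf n \<sigma> (v g)\<bar> \<le> mesh * R"
      using abs_rbf_diff_le[of u "v g", OF close] mult_left_mono[OF R, of mesh] mesh by linarith
    moreover have "\<bar>empirical_kernel M n l w (v g) - rbf n \<sigma> (v g)\<bar> \<le> tol / 2"
      using w g by (auto simp: B2_def)
    ultimately show "\<bar>empirical_kernel M n l w u - rbf n \<sigma> u\<bar> \<le> tol"
      using meshR by linarith
  qed
qed

end

section \<open>Laws of tokens, patches and labels\<close>

lemma set_pmf_expand:
  assumes "x \<in> set_pmf (expand q ts)"
    and "\<And>t w. t \<in> set ts \<Longrightarrow> w \<in> set_pmf (q t) \<Longrightarrow> length w = s"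
  shows "length x = s * length ts \<and> (\<forall>k<length ts. take s (drop (k * s) x) \<in> set_pmf (q (ts ! k)))"
  using assms
proof (induction ts arbitrary: x)
  case (Cons t ts)
  then obtain w y where x: "x = w @ y" and w: "w \<in> set_pmf (q t)" and y: "y \<in> set_pmf (expand q ts)"
    by auto
  have lw: "length w = s" using Cons.prems w by auto
  have IH: "length y = s * length ts" "\<And>k. k < length ts \<Longrightarrow> take s (drop (k * s) y) \<in> set_pmf (q (ts ! k))"
    using Cons.IH[OF y] Cons.prems by auto
  have "take s (drop (k * s) x) \<in> set_pmf (q ((t # ts) ! k))" if "k < length (t # ts)" for k
  proof (cases k)
    case (Suc k')
    then show ?thesis using that IH(2)[of k'] lw by (simp add: x)
  qed (use w lw in \<open>simp add: x\<close>)
  then show ?case using lw IH by (simp add: x)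
qed simp

lemma finite_set_pmf_expand:
  "(\<And>t. t \<in> set ts \<Longrightarrow> finite (set_pmf (q t))) \<Longrightarrow> finite (set_pmf (expand q ts))"
  by (induction ts) auto

lemma expand_append:
  "expand q (a @ b) = bind_pmf (expand q a) (\<lambda>x. map_pmf (\<lambda>y. x @ y) (expand q b))"
proof (induction a)
  case Nil
  then show ?case by (simp add: bind_return_pmf map_pmf_def bind_return_pmf')
next
  case (Cons t a)
  then show ?case by (simp add: map_pmf_def bind_assoc_pmf bind_return_pmf)
qed

text \<open>The derivation restarted at an arbitrary word of level \<open>n\<close>, without a
  record of the intermediate sentences. For a singleton word this is the law of the subtree below
  one token.\<close>

primrec leaves :: "'a rhm \<Rightarrow> nat \<Rightarrow> nat \<Rightarrow> 'a list \<Rightarrow> 'a list pmf" where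
  "leaves H n 0 t = return_pmf t"
| "leaves H n (Suc k) t = bind_pmf (leaves H n k t) (expand (trans_dist H (n + k)))"

lemma leaves_append:
  "leaves H n k (a @ b) = bind_pmf (leaves H n k a) (\<lambda>x. map_pmf (\<lambda>y. x @ y) (leaves H n k b))"
proof (induction k)
  case (Suc k)
  let ?E = "expand (trans_dist H (n + k))"
  have "leaves H n (Suc k) (a @ b) =
      bind_pmf (leaves H n k a) (\<lambda>x. bind_pmf (leaves H n k b)
        (\<lambda>y. bind_pmf (?E x) (\<lambda>x'. bind_pmf (?E y) (\<lambda>y'. return_pmf (x' @ y')))))"
    by (simp add: Suc map_pmf_def bind_assoc_pmf bind_return_pmf expand_append)
  also have "\<dots> = bind_pmf (leaves H n k a) (\<lambda>x. bind_pmf (?E x)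
        (\<lambda>x'. bind_pmf (leaves H n k b) (\<lambda>y. bind_pmf (?E y) (\<lambda>y'. return_pmf (x' @ y')))))"
    by (subst (2) bind_commute_pmf) simp
  finally show ?case by (simp add: map_pmf_def bind_assoc_pmf)
qed (simp add: bind_return_pmf map_pmf_def)

lemma length_derivation: "ss \<in> set_pmf (derivation H n) \<Longrightarrow> length ss = Suc n"
  by (induction n arbitrary: ss) auto

text \<open>Markov property of the sentences: the history up to level \<open>n\<close> influences
  level \<open>n + k\<close> only through its last sentence.\<close>

lemma derivation_add:
  "map_pmf (\<lambda>ss. (take (Suc n) ss, ss ! (n + k))) (derivation H (n + k))
    = bind_pmf (derivation H n) (\<lambda>ss. map_pmf (Pair ss) (leaves H n k (last ss)))"
proof (induction k)
  case 0
  have "last ss = ss ! n" if "ss \<in> set_pmf (derivation H n)" for ss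
    using length_derivation[OF that] by (subst last_conv_nth) auto
  then show ?case
    by (auto simp: map_pmf_def bind_return_pmf length_derivation intro!: bind_pmf_cong)
next
  case (Suc k)
  let ?E = "expand (trans_dist H (n + k))"
  have "map_pmf (\<lambda>ss. (take (Suc n) ss, ss ! (n + Suc k))) (derivation H (n + Suc k))
      = bind_pmf (derivation H (n + k)) (\<lambda>ss. map_pmf (Pair (take (Suc n) ss)) (?E (ss ! (n + k))))"
  proof -
    have "map_pmf (\<lambda>ss. (take (Suc n) ss, ss ! (n + Suc k))) (map_pmf (\<lambda>t. ss @ [t]) (?E (last ss)))
        = map_pmf (Pair (take (Suc n) ss)) (?E (ss ! (n + k)))"
      if "ss \<in> set_pmf (derivation H (n + k))" for ss
    proof -
      have len: "length ss = Suc (n + k)" using length_derivation[OF that] .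
      then have "last ss = ss ! (n + k)" by (subst last_conv_nth) auto
      then show ?thesis using len by (simp add: pmf.map_comp o_def nth_append)
    qed
    then show ?thesis by (auto simp: map_bind_pmf intro!: bind_pmf_cong)
  qed
  also have "\<dots> = bind_pmf (map_pmf (\<lambda>ss. (take (Suc n) ss, ss ! (n + k))) (derivation H (n + k)))
      (\<lambda>(p, x). map_pmf (Pair p) (?E x))"
    by (simp add: bind_map_pmf)
  also have "\<dots> = bind_pmf (derivation H n) (\<lambda>ss. map_pmf (Pair ss) (leaves H n (Suc k) (last ss)))"
    unfolding Suc by (simp add: bind_assoc_pmf bind_map_pmf map_bind_pmf)
  finally show ?case .
qed

lemma map_take_derivation:
  assumes "n \<le> n'"
  shows "map_pmf (take (Suc n)) (derivation H n') = derivation H n"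
proof -
  obtain k where n': "n' = n + k" using assms le_Suc_ex by blast
  have "map_pmf (take (Suc n)) (derivation H n')
      = map_pmf fst (map_pmf (\<lambda>ss. (take (Suc n) ss, ss ! (n + k))) (derivation H (n + k)))"
    by (simp add: n' pmf.map_comp o_def)
  also have "\<dots> = derivation H n"
    unfolding derivation_add by (simp add: map_bind_pmf pmf.map_comp o_def bind_return_pmf')
  finally show ?thesis .
qed

lemma map_take_expand:
  assumes "\<And>w. w \<in> set_pmf (q t) \<Longrightarrow> length w = s"
  shows "map_pmf (take s) (expand q (t # ts)) = q t"
proof -
  have "map_pmf (take s) (expand q (t # ts)) = bind_pmf (q t) (\<lambda>p. bind_pmf (expand q ts) (\<lambda>r. return_pmf p))"
    using assms by (auto simp: map_bind_pmf intro!: bind_pmf_cong)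
  then show ?thesis by (simp add: bind_return_pmf')
qed

lemma pmf_map_Pair: "pmf (map_pmf (Pair a) p) (b, x) = (if a = b then pmf p x else 0)"
proof (cases "a = b")
  case True
  then show ?thesis using pmf_map_inj'[of "Pair a" p x] by (simp add: inj_on_def)
next
  case False
  then show ?thesis by (auto intro!: pmf_map_outside)
qed

lemma sum_in_Nats: "(\<And>x. x \<in> A \<Longrightarrow> f x \<in> \<nat>) \<Longrightarrow> sum f A \<in> \<nat>"
  by (induction A rule: infinite_finite_induct) auto

locale cfg_model =
  fixes H :: "'a rhm" and R :: "nat \<Rightarrow> ('a \<times> 'a list) set" and V m :: nat
  assumes rhm: "is_rhm H" and cfg: "induced_by_cfg H R" and unif: "uniform_cfg H R V m"
    and nonamb: "non_ambiguous H R"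
begin

abbreviation "L \<equiv> depth H"
abbreviation "s \<equiv> branching H"
abbreviation "Q \<equiv> trans_dist H"

lemma L_pos: "L \<ge> 1" and s_pos: "s \<ge> 1" and finite_vocab: "l \<le> L \<Longrightarrow> finite (vocab H l)"
  using rhm by (auto simp: is_rhm_def)

lemma card_vocab: "l \<le> L \<Longrightarrow> card (vocab H l) = V"
  using unif by (auto simp: uniform_cfg_def)

lemma finite_words: "finite A \<Longrightarrow> finite (words n A)"
  using finite_lists_length_eq[of A n] by (simp add: words_def)

lemma rules:
  assumes "l < L" "\<nu> \<in> vocab H l"
  shows "finite {\<mu>. (\<nu>, \<mu>) \<in> R l}" "{\<mu>. (\<nu>, \<mu>) \<in> R l} \<noteq> {}" "card {\<mu>. (\<nu>, \<mu>) \<in> R l} = m"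
    "Q l \<nu> = pmf_of_set {\<mu>. (\<nu>, \<mu>) \<in> R l}" "{\<mu>. (\<nu>, \<mu>) \<in> R l} \<subseteq> words s (vocab H (Suc l))"
proof -
  show sub: "{\<mu>. (\<nu>, \<mu>) \<in> R l} \<subseteq> words s (vocab H (Suc l))"
    using cfg assms by (auto simp: induced_by_cfg_def)
  show "finite {\<mu>. (\<nu>, \<mu>) \<in> R l}"
    by (rule finite_subset[OF sub]) (use assms finite_vocab in \<open>auto intro: finite_words\<close>)
  show "{\<mu>. (\<nu>, \<mu>) \<in> R l} \<noteq> {}" "Q l \<nu> = pmf_of_set {\<mu>. (\<nu>, \<mu>) \<in> R l}"
    using cfg assms by (auto simp: induced_by_cfg_def)
  show "card {\<mu>. (\<nu>, \<mu>) \<in> R l} = m"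
    using unif assms by (auto simp: uniform_cfg_def)
qed

lemma set_pmf_Q: "l < L \<Longrightarrow> \<nu> \<in> vocab H l \<Longrightarrow> set_pmf (Q l \<nu>) = {\<mu>. (\<nu>, \<mu>) \<in> R l}"
  using rules by (simp add: set_pmf_of_set)

lemma finite_set_pmf_Q: "l < L \<Longrightarrow> \<nu> \<in> vocab H l \<Longrightarrow> finite (set_pmf (Q l \<nu>))"
  using rules(1) set_pmf_Q by simp

lemma pmf_Q: "l < L \<Longrightarrow> \<nu> \<in> vocab H l \<Longrightarrow> \<mu> \<in> set_pmf (Q l \<nu>) \<Longrightarrow> pmf (Q l \<nu>) \<mu> = 1 / m"
  using rules[of l \<nu>] set_pmf_Q[of l \<nu>] by (simp add: pmf_of_set)

lemma patch_in_words: "l < L \<Longrightarrow> \<nu> \<in> vocab H l \<Longrightarrow> \<mu> \<in> set_pmf (Q l \<nu>) \<Longrightarrow> set \<mu> \<subseteq> vocab H (Suc l) \<and> length \<mu> = s"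
  using rules(5)[of l \<nu>] set_pmf_Q[of l \<nu>] by (auto simp: words_def)

lemma Q_unique:
  assumes "l < L" "\<nu> \<in> vocab H l" "\<nu>' \<in> vocab H l" "\<mu> \<in> set_pmf (Q l \<nu>)" "\<mu> \<in> set_pmf (Q l \<nu>')"
  shows "\<nu> = \<nu>'"
proof -
  have "\<mu> \<in> words s (vocab H (Suc l))" using assms patch_in_words by (auto simp: words_def)
  then show ?thesis
    using nonamb assms set_pmf_Q[of l] unfolding non_ambiguous_def by blast
qed

lemma vocab0_nonempty: "vocab H 0 \<noteq> {}"
  using rhm set_pmf_not_empty[of "label_dist H"] by (auto simp: is_rhm_def)

lemma V_pos: "V \<ge> 1"
  using vocab0_nonempty finite_vocab[of 0] card_vocab[of 0] by (metis One_nat_def Suc_leI card_gt_0_iff le0)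

lemma m_pos: "m \<ge> 1"
proof -
  obtain \<nu> where "\<nu> \<in> vocab H 0" using vocab0_nonempty by auto
  then show ?thesis
    using rules(1-3)[of 0 \<nu>] L_pos by (metis One_nat_def Suc_leI Suc_le_lessD card_gt_0_iff)
qed

section \<open>Support of the derivation and uniqueness of parses\<close>

definition valid :: "nat \<Rightarrow> 'a list list \<Rightarrow> bool" where
  "valid n ss \<longleftrightarrow> length ss = Suc n \<and> (\<forall>l\<le>n. length (ss ! l) = s ^ l \<and> set (ss ! l) \<subseteq> vocab H l)
     \<and> (\<forall>l<n. \<forall>k<s ^ l. take s (drop (k * s) (ss ! Suc l)) \<in> set_pmf (Q l (ss ! l ! k)))"

lemma set_blocks:
  assumes "length x = s * n" "\<And>k. k < n \<Longrightarrow> set (take s (drop (k * s) x)) \<subseteq> A"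
  shows "set x \<subseteq> A"
proof
  fix a assume "a \<in> set x"
  then obtain i where i: "i < s * n" "a = x ! i" using assms(1) by (auto simp: in_set_conv_nth)
  define k where "k = i div s"
  have k: "k < n" using i by (simp add: k_def less_mult_imp_div_less mult.commute)
  have "a = take s (drop (k * s) x) ! (i mod s)"
  proof -
    have "i div s * s \<le> length x" using i assms(1) 
        by (simp add: le_trans[OF div_times_less_eq_dividend])
    then show ?thesis using i s_pos by (simp add: k_def)
  qed
  moreover have "i mod s < length (take s (drop (k * s) x))"
  proof -
    have "i div s * s + i mod s < s * n" using i by simp
    then show ?thesis using assms(1) s_pos by (simp add: k_def less_diff_conv add.commute)
  qed
  ultimately show "a \<in> A" using assms(2)[OF k] nth_mem by blast
qed

lemma last_valid: "valid n ss \<Longrightarrow> last ss = ss ! n"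
  by (subst last_conv_nth) (auto simp: valid_def)

lemma valid_last_support: 
  assumes "n < L" "valid n ss" "t \<in> set_pmf (expand (Q n) (last ss))"
  shows "valid (Suc n) (ss @ [t])"
proof -
  have len: "length ss = Suc n" and last: "last ss = ss ! n"
    using assms(2) last_valid by (auto simp: valid_def)
  have sn: "set (ss ! n) \<subseteq> vocab H n" "length (ss ! n) = s ^ n" using assms(2) by (auto simp: valid_def)
  have t: "length t = s * s ^ n" "\<And>k. k < s ^ n \<Longrightarrow> take s (drop (k * s) t) \<in> set_pmf (Q n (ss ! n ! k))"
    using set_pmf_expand[OF assms(3), of s] sn patch_in_words[OF assms(1)] by (auto simp: last)
  have "set t \<subseteq> vocab H (Suc n)"
  proof (rule set_blocks[OF t(1)])
    fix k assume k: "k < s ^ n"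
    then have "ss ! n ! k \<in> vocab H n" using sn by (metis nth_mem subsetD)
    then show "set (take s (drop (k * s) t)) \<subseteq> vocab H (Suc n)"
      using patch_in_words[OF assms(1)] t(2)[OF k] by blast
  qed
  then show ?thesis using assms(2) t len sn
    by (auto simp: valid_def nth_append less_Suc_eq_le le_Suc_eq le_less)
qed

lemma valid_derivation: "n \<le> L \<Longrightarrow> ss \<in> set_pmf (derivation H n) \<Longrightarrow> valid n ss"
proof (induction n arbitrary: ss)
  case 0
  have "set_pmf (label_dist H) \<subseteq> vocab H 0" using rhm by (simp add: is_rhm_def)
  then show ?case using 0 by (auto simp: valid_def)
next
  case (Suc n)
  then show ?case using valid_last_support[of n] by auto
qed

lemma finite_derivation: "n \<le> L \<Longrightarrow> finite (set_pmf (derivation H n))"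
proof (induction n)
  case 0
  have "set_pmf (label_dist H) \<subseteq> vocab H 0" using rhm by (simp add: is_rhm_def)
  then have "finite (set_pmf (label_dist H))" using finite_vocab[of 0] finite_subset by auto
  then show ?case by simp
next
  case (Suc n)
  have "finite (set_pmf (expand (Q n) (last ss)))" if "ss \<in> set_pmf (derivation H n)" for ss
  proof (rule finite_set_pmf_expand)
    have "valid n ss" using Suc that by (intro valid_derivation) auto
    then have "set (last ss) \<subseteq> vocab H n" using last_valid[of n ss] by (simp add: valid_def)
    then show "t \<in> set (last ss) \<Longrightarrow> finite (set_pmf (Q n t))" for t
      using Suc.prems by (intro finite_set_pmf_Q) auto
  qed
  then show ?case using Suc by auto
qed

text \<open>By non-ambiguity each patch determines its parent, so two histories with equal last
  sentences agree level by level upwards. This makes latent tokens functions of the observed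
  input.\<close>

lemma valid_unique:
  assumes "n \<le> L" "valid n ss" "valid n ss'" "ss ! n = ss' ! n"
  shows "ss = ss'"
proof -
  have "ss ! l = ss' ! l" if "l \<le> n" for l
    using that
  proof (induction l rule: inc_induct)
    case (step l)
    show ?case
    proof (rule nth_equalityI)
      show "length (ss ! l) = length (ss' ! l)" using assms step by (auto simp: valid_def)
      fix k assume "k < length (ss ! l)"
      then have k: "k < s ^ l" using assms step by (auto simp: valid_def)
      have "ss ! l ! k \<in> vocab H l" "ss' ! l ! k \<in> vocab H l"
        using assms step k unfolding valid_def by (metis less_imp_le nth_mem subsetD)+
      moreover have "take s (drop (k * s) (ss ! Suc l)) \<in> set_pmf (Q l (ss ! l ! k))"
        "take s (drop (k * s) (ss ! Suc l)) \<in> set_pmf (Q l (ss' ! l ! k))"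
        using assms step k unfolding valid_def by auto
      ultimately show "ss ! l ! k = ss' ! l ! k"
        using step assms by (intro Q_unique[of l]) auto
    qed
  qed (rule assms(4))
  then show ?thesis using assms(2,3) by (intro nth_equalityI) (auto simp: valid_def)
qed


lemma label_in_vocab: "valid n ss \<Longrightarrow> label_of ss \<in> vocab H 0"
  unfolding valid_def label_of_def
  by (metis hd_in_set le0 length_0_conv nat.simps(3) power_0 One_nat_def subsetD)

lemma token_in_vocab: "valid n ss \<Longrightarrow> l \<le> n \<Longrightarrow> k < s ^ l \<Longrightarrow> ss ! l ! k \<in> vocab H l"
  unfolding valid_def by (metis nth_mem subsetD)

lemma hd_token: "valid n ss \<Longrightarrow> l \<le> n \<Longrightarrow> hd (ss ! l) = ss ! l ! 0 \<and> ss ! l \<noteq> []"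
proof -
  assume "valid n ss" "l \<le> n"
  then have "length (ss ! l) = s ^ l" by (simp add: valid_def)
  then have "ss ! l \<noteq> []" using s_pos by auto
  then show ?thesis by (simp add: hd_conv_nth)
qed

section \<open>Joint laws of the label with the first token and the first patch\<close>

definition token_law :: "nat \<Rightarrow> ('a \<times> 'a) pmf" where
  "token_law n = map_pmf (\<lambda>ss. (label_of ss, hd (ss ! n))) (derivation H n)"

definition marg :: "nat \<Rightarrow> 'a \<Rightarrow> real" where
  "marg n \<nu> = pmf (map_pmf snd (token_law n)) \<nu>"

definition post :: "nat \<Rightarrow> 'a \<Rightarrow> 'a \<Rightarrow> real" where
  "post n \<nu> \<zeta> = pmf (token_law n) (\<zeta>, \<nu>) / marg n \<nu>"

definition patch_law :: "nat \<Rightarrow> ('a \<times> 'a list) pmf" where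
  "patch_law n = bind_pmf (token_law n) (\<lambda>(\<zeta>, \<nu>). map_pmf (Pair \<zeta>) (Q n \<nu>))"

lemma set_token_law: "n \<le> L \<Longrightarrow> set_pmf (token_law n) \<subseteq> vocab H 0 \<times> vocab H n"
  using valid_derivation[of n] label_in_vocab token_in_vocab[of n _ n 0] hd_token[of n _ n] s_pos
  by (fastforce simp: token_law_def)

lemma finite_vocab_prod: "n \<le> L \<Longrightarrow> finite (vocab H 0 \<times> vocab H n)"
  using finite_vocab by simp

lemma map_derivation_patch_law:
  assumes n: "n < L"
  shows "map_pmf (\<lambda>ss. (label_of ss, first_patch H (Suc n) ss)) (derivation H (Suc n)) = patch_law n"
proof -
  have "map_pmf (\<lambda>ss. (label_of ss, first_patch H (Suc n) ss)) (map_pmf (\<lambda>t. ss @ [t]) (expand (Q n) (last ss)))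
      = map_pmf (Pair (label_of ss)) (Q n (hd (ss ! n)))" if "ss \<in> set_pmf (derivation H n)" for ss
  proof -
    have v: "valid n ss" using that n by (intro valid_derivation) auto
    then have len: "length ss = Suc n" by (simp add: valid_def)
    obtain \<nu> r where c: "ss ! n = \<nu> # r" using hd_token[OF v, of n] by (cases "ss ! n") auto
    have \<nu>: "\<nu> \<in> vocab H n" using token_in_vocab[OF v, of n 0] c s_pos by simp
    have "map_pmf (\<lambda>ss. (label_of ss, first_patch H (Suc n) ss)) (map_pmf (\<lambda>t. ss @ [t]) (expand (Q n) (last ss)))
        = map_pmf (Pair (label_of ss)) (map_pmf (take s) (expand (Q n) (\<nu> # r)))"
      using len unfolding last_valid[OF v] c
      by (simp only: pmf.map_comp o_def) (simp add: label_of_def first_patch_def nth_append)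
    also have "map_pmf (take s) (expand (Q n) (\<nu> # r)) = Q n \<nu>"
      by (rule map_take_expand) (use patch_in_words[OF n \<nu>] in auto)
    finally show ?thesis by (simp add: c)
  qed
  then show ?thesis
    by (auto simp: patch_law_def token_law_def map_bind_pmf bind_map_pmf intro!: bind_pmf_cong)
qed

lemma map_rhm_patch_law:
  assumes n: "n < L"
  shows "map_pmf (\<lambda>ss. (label_of ss, first_patch H (Suc n) ss)) (rhm_pmf H) = patch_law n"
proof -
  have "map_pmf (\<lambda>ss. (label_of ss, first_patch H (Suc n) ss)) (rhm_pmf H)
      = map_pmf (\<lambda>ss. (label_of ss, first_patch H (Suc n) ss)) (map_pmf (take (Suc (Suc n))) (rhm_pmf H))"
    by (simp add: pmf.map_comp o_def label_of_def first_patch_def)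
  then show ?thesis using n by (simp add: map_take_derivation map_derivation_patch_law del: derivation.simps)
qed

lemma set_patch_law: "n < L \<Longrightarrow> (\<zeta>, \<mu>) \<in> set_pmf (patch_law n) \<Longrightarrow> \<exists>\<nu>\<in>vocab H n. \<mu> \<in> set_pmf (Q n \<nu>)"
  using set_token_law[of n] by (fastforce simp: patch_law_def)

text \<open>Non-ambiguity leaves a single parent in the mixture, and uniformity gives each of its
  rules the probability \<open>1 / m\<close>.\<close>

lemma pmf_patch_law:
  assumes n: "n < L" and \<nu>: "\<nu> \<in> vocab H n" and \<mu>: "\<mu> \<in> set_pmf (Q n \<nu>)"
  shows "pmf (patch_law n) (\<zeta>, \<mu>) = pmf (token_law n) (\<zeta>, \<nu>) / m"
proof -
  have "pmf (patch_law n) (\<zeta>, \<mu>) = (\<integral>z. pmf (map_pmf (Pair (fst z)) (Q n (snd z))) (\<zeta>, \<mu>) \<partial>token_law n)"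
    by (simp add: patch_law_def pmf_bind case_prod_beta)
  also have "\<dots> = (\<Sum>z\<in>{(\<zeta>, \<nu>)}. pmf (map_pmf (Pair (fst z)) (Q n (snd z))) (\<zeta>, \<mu>) * pmf (token_law n) z)"
  proof (rule integral_measure_pmf_real)
    fix z assume z: "z \<in> set_pmf (token_law n)" "pmf (map_pmf (Pair (fst z)) (Q n (snd z))) (\<zeta>, \<mu>) \<noteq> 0"
    then have "fst z = \<zeta>" "\<mu> \<in> set_pmf (Q n (snd z))"
      by (auto simp: pmf_map_Pair set_pmf_iff split: if_splits)
    moreover have "snd z \<in> vocab H n" using set_token_law[of n] n z(1) by auto
    ultimately show "z \<in> {(\<zeta>, \<nu>)}"
      using Q_unique[OF n \<nu> _ \<mu>, of "snd z"] by (metis prod.collapse singletonI)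
  qed simp
  also have "\<dots> = pmf (token_law n) (\<zeta>, \<nu>) / m"
    using pmf_Q[OF n \<nu> \<mu>] by (simp add: pmf_map_Pair)
  finally show ?thesis .
qed

lemma pmf_snd_patch_law:
  assumes n: "n < L" and \<nu>: "\<nu> \<in> vocab H n" and \<mu>: "\<mu> \<in> set_pmf (Q n \<nu>)"
  shows "pmf (map_pmf snd (patch_law n)) \<mu> = marg n \<nu> / m"
proof -
  have "map_pmf snd (patch_law n) = bind_pmf (map_pmf snd (token_law n)) (Q n)"
    by (simp add: patch_law_def map_bind_pmf bind_map_pmf case_prod_beta pmf.map_comp o_def)
  then have "pmf (map_pmf snd (patch_law n)) \<mu> = (\<integral>\<nu>'. pmf (Q n \<nu>') \<mu> \<partial>map_pmf snd (token_law n))"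
    by (simp add: pmf_bind)
  also have "\<dots> = (\<Sum>\<nu>'\<in>{\<nu>}. pmf (Q n \<nu>') \<mu> * pmf (map_pmf snd (token_law n)) \<nu>')"
  proof (rule integral_measure_pmf_real)
    fix \<nu>' assume z: "\<nu>' \<in> set_pmf (map_pmf snd (token_law n))" "pmf (Q n \<nu>') \<mu> \<noteq> 0"
    moreover have "\<nu>' \<in> vocab H n" using set_token_law[of n] n z(1) by auto
    ultimately show "\<nu>' \<in> {\<nu>}"
      using Q_unique[OF n \<nu> _ \<mu>, of "\<nu>'"] by (auto simp: set_pmf_iff)
  qed simp
  also have "\<dots> = marg n \<nu> / m"
    using pmf_Q[OF n \<nu> \<mu>] by (simp add: marg_def)
  finally show ?thesis .
qed

lemma patch_prob_eq:
  assumes n: "n < L" and \<nu>: "\<nu> \<in> vocab H n" and \<mu>: "\<mu> \<in> set_pmf (Q n \<nu>)"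
  shows "patch_prob H (Suc n) \<mu> = marg n \<nu> / m"
proof -
  have "patch_prob H (Suc n) \<mu> = pmf (map_pmf (first_patch H (Suc n)) (rhm_pmf H)) \<mu>"
    by (simp add: patch_prob_def pmf_map vimage_def)
  also have "map_pmf (first_patch H (Suc n)) (rhm_pmf H) = map_pmf snd (patch_law n)"
    unfolding map_rhm_patch_law[OF n, symmetric] by (simp add: pmf.map_comp o_def)
  finally show ?thesis using pmf_snd_patch_law[OF assms] by simp
qed

text \<open>The factor \<open>1 / m\<close> cancels between the joint and the marginal probability,
  so synonyms share one posterior. Hence the regression target of a stage is constant over the rules
  of a symbol.\<close>

lemma label_posterior_eq:
  assumes n: "n < L" and \<nu>: "\<nu> \<in> vocab H n" and \<mu>: "\<mu> \<in> set_pmf (Q n \<nu>)"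
  shows "label_posterior H (Suc n) \<mu> \<zeta> = post n \<nu> \<zeta>"
proof -
  have "label_posterior H (Suc n) \<mu> \<zeta>
      = pmf (map_pmf (\<lambda>ss. (label_of ss, first_patch H (Suc n) ss)) (rhm_pmf H)) (\<zeta>, \<mu>) / patch_prob H (Suc n) \<mu>"
    by (simp add: label_posterior_def cond_prob_def patch_prob_def pmf_map vimage_def)
  then show ?thesis
    using m_pos by (simp add: map_rhm_patch_law[OF n] pmf_patch_law[OF assms] patch_prob_eq[OF assms] post_def)
qed

lemma marg_eq_sum:
  assumes n: "n \<le> L"
  shows "marg n \<nu> = (\<Sum>\<zeta>\<in>vocab H 0. pmf (token_law n) (\<zeta>, \<nu>))"
proof -
  have "marg n \<nu> = measure (token_law n) (snd -` {\<nu>})" by (simp add: marg_def pmf_map)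
  also have "\<dots> = measure (token_law n) ((snd -` {\<nu>}) \<inter> set_pmf (token_law n))" by (simp add: measure_Int_set_pmf)
  also have "(snd -` {\<nu>}) \<inter> set_pmf (token_law n) = ((\<lambda>\<zeta>. (\<zeta>, \<nu>)) ` vocab H 0) \<inter> set_pmf (token_law n)"
    using set_token_law[OF n] by auto
  also have "measure (token_law n) \<dots> = measure (token_law n) ((\<lambda>\<zeta>. (\<zeta>, \<nu>)) ` vocab H 0)" by (simp add: measure_Int_set_pmf)
  also have "\<dots> = (\<Sum>\<zeta>\<in>vocab H 0. pmf (token_law n) (\<zeta>, \<nu>))"
    using finite_vocab[of 0] by (subst measure_measure_pmf_finite) (auto simp: sum.reindex inj_on_def)
  finally show ?thesis .
qed

lemma token_law_Suc: "n < L \<Longrightarrow> token_law (Suc n) = map_pmf (\<lambda>(\<zeta>, \<mu>). (\<zeta>, hd \<mu>)) (patch_law n)"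
  unfolding map_derivation_patch_law[symmetric] token_law_def pmf.map_comp
  by (rule map_pmf_cong) (use s_pos in \<open>auto simp: first_patch_def\<close>)

text \<open>The label contributes a denominator \<open>V\<close> and each level a denominator
  \<open>m\<close>. Taking the head of a patch only adds up finitely many such
  probabilities.\<close>

lemma pmf_token_law_Nats: "n \<le> L \<Longrightarrow> pmf (token_law n) (\<zeta>, \<nu>) * (V * m ^ n) \<in> \<nat>"
proof (induction n arbitrary: \<nu>)
  case 0
  have "label_dist H = pmf_of_set (vocab H 0)" using cfg by (simp add: induced_by_cfg_def)
  then have "token_law 0 = map_pmf (\<lambda>\<zeta>. (\<zeta>, \<zeta>)) (pmf_of_set (vocab H 0))"
    by (simp add: token_law_def pmf.map_comp o_def label_of_def)
  moreover have "measure (pmf_of_set (vocab H 0)) ((\<lambda>\<zeta>. (\<zeta>, \<zeta>)) -` {(\<zeta>, \<nu>)}) * V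
      = card (vocab H 0 \<inter> ((\<lambda>\<zeta>. (\<zeta>, \<zeta>)) -` {(\<zeta>, \<nu>)}))"
    using vocab0_nonempty finite_vocab[of 0] card_vocab[of 0] V_pos
    by (subst measure_pmf_of_set) auto
  ultimately show ?case by (simp add: pmf_map)
next
  case (Suc n)
  let ?f = "\<lambda>(\<zeta>, \<mu>). (\<zeta>, hd \<mu>)" and ?c = "real V * real m ^ n"
  let ?B = "(?f -` {(\<zeta>, \<nu>)}) \<inter> set_pmf (patch_law n)"
  have n: "n < L" using Suc by simp
  have fin: "finite (set_pmf (patch_law n))"
    using finite_derivation[of "Suc n"] n unfolding map_derivation_patch_law[OF n, symmetric] by simp
  have "pmf (token_law (Suc n)) (\<zeta>, \<nu>) = measure (patch_law n) ?B"
    by (simp add: token_law_Suc[OF n] pmf_map measure_Int_set_pmf)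
  also have "\<dots> = (\<Sum>z\<in>?B. pmf (patch_law n) z)"
    using fin by (intro measure_measure_pmf_finite) auto
  finally have "pmf (token_law (Suc n)) (\<zeta>, \<nu>) * (V * m ^ Suc n) = (\<Sum>z\<in>?B. pmf (patch_law n) z * m * ?c)"
    by (simp add: sum_distrib_left mult_ac)
  also have "\<dots> \<in> \<nat>"
  proof (intro sum_in_Nats)
    fix z assume z: "z \<in> ?B"
    obtain \<nu>' where "\<nu>' \<in> vocab H n" "snd z \<in> set_pmf (Q n \<nu>')"
      using set_patch_law[OF n, of "fst z" "snd z"] z by auto
    then have "pmf (patch_law n) (fst z, snd z) = pmf (token_law n) (fst z, \<nu>') / m"
      by (rule pmf_patch_law[OF n])
    then show "pmf (patch_law n) z * m * ?c \<in> \<nat>"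
      using Suc.IH[of \<nu>'] z m_pos n by (auto simp: case_prod_beta)
  qed
  finally show ?case .
qed


text \<open>Scaled by \<open>V * m ^ n\<close>, numerators and denominators are natural numbers and
  the denominators are at most \<open>V * m ^ n\<close>. Over the common denominator, a nonzero
  difference has a numerator that is a nonzero integer.\<close>

lemma post_gap:
  assumes n: "n \<le> L" and pos: "marg n \<nu> > 0" "marg n \<nu>' > 0" and ne: "post n \<nu> \<zeta> \<noteq> post n \<nu>' \<zeta>"
  shows "\<bar>post n \<nu> \<zeta> - post n \<nu>' \<zeta>\<bar> \<ge> 1 / (real V * real m ^ n)\<^sup>2"
proof -
  let ?c = "real V * real m ^ n"
  have c: "?c > 0" using V_pos m_pos by simp
  have denominator_Nats: "marg n \<nu> * ?c \<in> \<nat>" for \<nu>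
    unfolding marg_eq_sum[OF n] sum_distrib_right using pmf_token_law_Nats[OF n] by (intro sum_in_Nats) simp
  have post_eq: "post n \<nu> \<zeta> = (pmf (token_law n) (\<zeta>, \<nu>) * ?c) / (marg n \<nu> * ?c)" for \<nu>
    unfolding post_def using c by (intro mult_divide_mult_cancel_right[symmetric]) linarith
  have numerator_Nats: "pmf (token_law n) (\<zeta>, \<nu>) * ?c \<in> \<nat>" for \<nu>
    using pmf_token_law_Nats[OF n, of \<zeta> \<nu>] by simp
  obtain a where a: "pmf (token_law n) (\<zeta>, \<nu>) * ?c = real a" using numerator_Nats by (rule Nats_cases)
  obtain a' where a': "pmf (token_law n) (\<zeta>, \<nu>') * ?c = real a'" using numerator_Nats by (rule Nats_cases)
  obtain b where b: "marg n \<nu> * ?c = real b" using denominator_Nats by (rule Nats_cases)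
  obtain b' where b': "marg n \<nu>' * ?c = real b'" using denominator_Nats by (rule Nats_cases)
  note ab = a a' b b'
  have b: "real b > 0" "real b' > 0" using pos c by (simp_all flip: ab(3,4))
  have bc: "real b \<le> ?c" "real b' \<le> ?c"
    using c pmf_le_1 by (auto simp: marg_def simp flip: ab(3,4) intro!: mult_left_le_one_le)
  have eq: "post n \<nu> \<zeta> - post n \<nu>' \<zeta> = real_of_int (int a * int b' - int a' * int b) / (real b * real b')"
    unfolding post_eq ab using b by (simp add: field_simps)
  have "int a * int b' - int a' * int b \<noteq> 0"
  proof
    assume h: "int a * int b' - int a' * int b = 0"
    have "post n \<nu> \<zeta> - post n \<nu>' \<zeta> = 0" unfolding eq h by simp
    then show False using ne by simp
  qed
  then have "\<bar>int a * int b' - int a' * int b\<bar> \<ge> 1" by linarith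
  then have 1: "\<bar>real_of_int (int a * int b' - int a' * int b)\<bar> \<ge> 1" by linarith
  have "1 / ?c\<^sup>2 \<le> 1 / (real b * real b')"
    using b bc c by (intro divide_left_mono) (auto simp: power2_eq_square intro!: mult_mono)
  also have "\<dots> \<le> \<bar>post n \<nu> \<zeta> - post n \<nu>' \<zeta>\<bar>"
    unfolding eq abs_divide using b 1 by (auto intro!: divide_right_mono)
  finally show ?thesis .
qed

lemma post_nonneg: "post n \<nu> \<zeta> \<ge> 0"
  by (simp add: post_def marg_def)

lemma sum_post: "n \<le> L \<Longrightarrow> marg n \<nu> > 0 \<Longrightarrow> (\<Sum>\<zeta>\<in>vocab H 0. post n \<nu> \<zeta>) = 1"
  by (simp add: post_def marg_eq_sum flip: sum_divide_distrib)

lemma pmf_token_law_0: "\<zeta> \<noteq> \<nu> \<Longrightarrow> pmf (token_law 0) (\<zeta>, \<nu>) = 0"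
  by (auto simp: token_law_def label_of_def pmf.map_comp o_def intro!: pmf_map_outside)

lemma post_0:
  assumes "\<nu> \<in> vocab H 0" "marg 0 \<nu> > 0"
  shows "post 0 \<nu> \<zeta> = of_bool (\<zeta> = \<nu>)"
proof -
  have "marg 0 \<nu> = (\<Sum>\<zeta>\<in>vocab H 0. if \<zeta> = \<nu> then pmf (token_law 0) (\<nu>, \<nu>) else 0)"
    unfolding marg_eq_sum[OF le0] by (intro sum.cong) (auto simp: pmf_token_law_0)
  also have "\<dots> = pmf (token_law 0) (\<nu>, \<nu>)" using assms finite_vocab[of 0] by simp
  finally show ?thesis using assms(2) by (auto simp: post_def pmf_token_law_0)
qed

section \<open>Subtrees below a token and their independence of the label\<close>

lemma leaves_support:
  assumes "set t \<subseteq> vocab H n" "n + k \<le> L" "x \<in> set_pmf (leaves H n k t)"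
  shows "length x = s ^ k * length t \<and> set x \<subseteq> vocab H (n + k)"
  using assms(2,3)
proof (induction k arbitrary: x)
  case 0
  then show ?case using assms(1) by simp
next
  case (Suc k)
  then obtain y where y: "y \<in> set_pmf (leaves H n k t)" "x \<in> set_pmf (expand (Q (n + k)) y)" by auto
  have IH: "length y = s ^ k * length t" "set y \<subseteq> vocab H (n + k)" using Suc y by auto
  have nk: "n + k < L" using Suc by simp
  have x: "length x = s * length y" "\<And>j. j < length y \<Longrightarrow> take s (drop (j * s) x) \<in> set_pmf (Q (n + k) (y ! j))"
    using set_pmf_expand[OF y(2), of s] patch_in_words[OF nk] IH by auto
  have "set x \<subseteq> vocab H (Suc (n + k))"
  proof (rule set_blocks[OF x(1)])
    fix j assume j: "j < length y"
    then show "set (take s (drop (j * s) x)) \<subseteq> vocab H (Suc (n + k))"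
      using patch_in_words[OF nk, of "y ! j"] x(2)[OF j] IH by (meson nth_mem subsetD)
  qed
  then show ?case using x IH by simp
qed

lemma finite_leaves:
  assumes "set t \<subseteq> vocab H n" "n + k \<le> L"
  shows "finite (set_pmf (leaves H n k t))"
proof (rule finite_subset)
  show "set_pmf (leaves H n k t) \<subseteq> words (s ^ k * length t) (vocab H (n + k))"
    using leaves_support[OF assms] by (auto simp: words_def)
  show "finite (words (s ^ k * length t) (vocab H (n + k)))"
    using assms(2) by (intro finite_words finite_vocab)
qed

text \<open>The subtree of the first token fills exactly the first \<open>s ^ k\<close> positions,
  and the independent rest is marginalised.\<close>

lemma map_take_leaves:
  assumes "\<nu> \<in> vocab H n" "n + k \<le> L"
  shows "map_pmf (take (s ^ k)) (leaves H n k (\<nu> # r)) = leaves H n k [\<nu>]"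
proof -
  have "leaves H n k (\<nu> # r) = bind_pmf (leaves H n k [\<nu>]) (\<lambda>x. map_pmf (\<lambda>y. x @ y) (leaves H n k r))"
    using leaves_append[of H n k "[\<nu>]" r] by simp
  then have "map_pmf (take (s ^ k)) (leaves H n k (\<nu> # r))
      = bind_pmf (leaves H n k [\<nu>]) (\<lambda>x. map_pmf (\<lambda>y. take (s ^ k) (x @ y)) (leaves H n k r))"
    by (simp add: map_bind_pmf pmf.map_comp o_def)
  also have "\<dots> = bind_pmf (leaves H n k [\<nu>]) (\<lambda>x. map_pmf (\<lambda>y. x) (leaves H n k r))"
    using leaves_support[of "[\<nu>]" n k] assms by (intro bind_pmf_cong map_pmf_cong) auto
  finally show ?thesis by (simp add: bind_return_pmf')
qed

text \<open>Markov property: given the first token at level \<open>n\<close>, the label is independent of the part of the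
  input below that token.\<close>

lemma label_decorrelated:
  assumes n: "n \<le> L" and \<zeta>: "\<zeta> \<in> vocab H 0"
  shows "measure_pmf.expectation (rhm_pmf H) (\<lambda>ss. (of_bool (label_of ss = \<zeta>) - post n (hd (ss ! n)) \<zeta>)
    * \<phi> (hd (ss ! n)) (take (s ^ (L - n)) (ss ! L))) = 0"
proof -
  define k where "k = L - n"
  have L: "L = n + k" using n by (simp add: k_def)
  define T where "T = bind_pmf (token_law n) (\<lambda>z. map_pmf (Pair z) (leaves H n k [snd z]))"
  have "map_pmf (\<lambda>ss. ((label_of ss, hd (ss ! n)), take (s ^ k) (ss ! L))) (rhm_pmf H)
      = map_pmf (\<lambda>(p, x). ((label_of p, hd (p ! n)), take (s ^ k) x))
          (map_pmf (\<lambda>ss. (take (Suc n) ss, ss ! (n + k))) (derivation H (n + k)))"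
    by (simp add: pmf.map_comp o_def label_of_def L)
  also have "\<dots> = bind_pmf (derivation H n) (\<lambda>ss. map_pmf (\<lambda>x. ((label_of ss, hd (ss ! n)), take (s ^ k) x))
      (leaves H n k (last ss)))"
    unfolding derivation_add by (simp add: map_bind_pmf pmf.map_comp o_def)
  also have "\<dots> = bind_pmf (derivation H n) (\<lambda>ss. map_pmf (Pair (label_of ss, hd (ss ! n)))
      (leaves H n k [hd (ss ! n)]))"
  proof (intro bind_pmf_cong refl)
    fix ss assume "ss \<in> set_pmf (derivation H n)"
    then have v: "valid n ss" using n by (intro valid_derivation)
    obtain \<nu> r where c: "ss ! n = \<nu> # r" using hd_token[OF v, of n] by (cases "ss ! n") auto
    have \<nu>: "\<nu> \<in> vocab H n" using token_in_vocab[OF v, of n 0] c s_pos by simp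
    have "map_pmf (\<lambda>x. ((label_of ss, hd (ss ! n)), take (s ^ k) x)) (leaves H n k (last ss))
        = map_pmf (Pair (label_of ss, hd (ss ! n))) (map_pmf (take (s ^ k)) (leaves H n k (\<nu> # r)))"
      unfolding last_valid[OF v] c by (simp add: pmf.map_comp o_def)
    then show "map_pmf (\<lambda>x. ((label_of ss, hd (ss ! n)), take (s ^ k) x)) (leaves H n k (last ss))
        = map_pmf (Pair (label_of ss, hd (ss ! n))) (leaves H n k [hd (ss ! n)])"
      using L \<nu> by (simp add: map_take_leaves c)
  qed
  also have "\<dots> = T" by (simp add: T_def token_law_def bind_map_pmf)
  finally have T: "map_pmf (\<lambda>ss. ((label_of ss, hd (ss ! n)), take (s ^ k) (ss ! L))) (rhm_pmf H) = T" .
  define g where "g = (\<lambda>((\<zeta>', \<nu>), x). (of_bool (\<zeta>' = \<zeta>) - post n \<nu> \<zeta>) * \<phi> \<nu> x)"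
  define \<Phi> where "\<Phi> \<nu> = measure_pmf.expectation (leaves H n k [\<nu>]) (\<phi> \<nu>)" for \<nu>
  have "measure_pmf.expectation (rhm_pmf H) (\<lambda>ss. (of_bool (label_of ss = \<zeta>) - post n (hd (ss ! n)) \<zeta>)
      * \<phi> (hd (ss ! n)) (take (s ^ (L - n)) (ss ! L))) = measure_pmf.expectation T g"
    unfolding T[symmetric] by (simp add: g_def k_def)
  also have "\<dots> = (\<Sum>z\<in>vocab H 0 \<times> vocab H n. pmf (token_law n) z *\<^sub>R
      measure_pmf.expectation (map_pmf (Pair z) (leaves H n k [snd z])) g)"
    unfolding T_def
    using finite_vocab_prod[OF n] set_token_law[OF n] L
    by (intro pmf_expectation_bind) (auto intro!: finite_leaves)
  also have "\<dots> = (\<Sum>(\<zeta>', \<nu>)\<in>vocab H 0 \<times> vocab H n. \<Phi> \<nu> * (pmf (token_law n) (\<zeta>', \<nu>) * (of_bool (\<zeta>' = \<zeta>) - post n \<nu> \<zeta>)))"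
    by (intro sum.cong) (auto simp: g_def \<Phi>_def)
  also have "\<dots> = (\<Sum>\<nu>\<in>vocab H n. \<Phi> \<nu> * (\<Sum>\<zeta>'\<in>vocab H 0. pmf (token_law n) (\<zeta>', \<nu>) * (of_bool (\<zeta>' = \<zeta>) - post n \<nu> \<zeta>)))"
    by (subst sum.cartesian_product[symmetric], subst sum.swap) (simp add: sum_distrib_left)
  also have "\<dots> = 0"
  proof (intro sum.neutral ballI)
    fix \<nu>
    have "(\<Sum>\<zeta>'\<in>vocab H 0. pmf (token_law n) (\<zeta>', \<nu>) * of_bool (\<zeta>' = \<zeta>)) = pmf (token_law n) (\<zeta>, \<nu>)"
      using \<zeta> finite_vocab[of 0] by (simp add: of_bool_def if_distrib cong: if_cong)
    \<comment> \<open>This also covers tokens of probability zero: there \<open>post\<close> is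
      \<open>0\<close> by the division convention, and the joint probability vanishes as a summand
      of the marginal.\<close>
    moreover have "pmf (token_law n) (\<zeta>, \<nu>) = marg n \<nu> * post n \<nu> \<zeta>"
    proof (cases "marg n \<nu> = 0")
      case True
      then have "pmf (token_law n) (\<zeta>, \<nu>) = 0"
        using \<zeta> finite_vocab[of 0] unfolding marg_eq_sum[OF n] by (subst (asm) sum_nonneg_eq_0_iff) auto
      then show ?thesis using True by simp
    qed (simp add: post_def)
    ultimately have "(\<Sum>\<zeta>'\<in>vocab H 0. pmf (token_law n) (\<zeta>', \<nu>) * (of_bool (\<zeta>' = \<zeta>) - post n \<nu> \<zeta>)) = 0"
      by (simp add: right_diff_distrib sum_subtractf sum_distrib_right[symmetric] marg_eq_sum[OF n])
    then show "\<Phi> \<nu> * (\<Sum>\<zeta>'\<in>vocab H 0. pmf (token_law n) (\<zeta>', \<nu>) * (of_bool (\<zeta>' = \<zeta>) - post n \<nu> \<zeta>)) = 0" by simp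
  qed
  finally show ?thesis .
qed

end

section \<open>One gradient step\<close>

lemma L2_set_sum_le:
  assumes "finite I"
  shows "L2_set (\<lambda>r. \<Sum>i\<in>I. f i r) A \<le> (\<Sum>i\<in>I. L2_set (f i) A)"
  using assms
proof (induction I)
  case (insert i I)
  have "L2_set (\<lambda>r. f i r + (\<Sum>i\<in>I. f i r)) A \<le> L2_set (f i) A + L2_set (\<lambda>r. \<Sum>i\<in>I. f i r) A"
    by (rule L2_set_triangle_ineq)
  then show ?case using insert by simp
qed (simp add: L2_set_def)

lemma L2_set_mult_left: "L2_set (\<lambda>r. c * f r) A = \<bar>c\<bar> * L2_set f A"
  by (simp add: L2_set_def power_mult_distrib sum_distrib_left[symmetric] real_sqrt_mult)

text \<open>Cauchy-Schwarz in each row. The Frobenius norm on the right does not depend on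
  \<open>z\<close>, so one random bound serves every feature vector at which the network is
  evaluated.\<close>

lemma L2_set_matrix_vector_le:
  "L2_set (\<lambda>r. \<Sum>j\<in>B. a r j * z j) A \<le> L2_set (\<lambda>(r, j). a r j) (A \<times> B) * L2_set z B"
proof -
  have "L2_set (\<lambda>r. \<Sum>j\<in>B. a r j * z j) A \<le> L2_set (\<lambda>r. L2_set (a r) B * L2_set z B) A"
    unfolding L2_set_def[of _ A]
    by (intro real_sqrt_le_mono sum_mono)
      (use abs_inner_le_L2_set in \<open>auto simp: L2_set_nonneg simp flip: abs_le_square_iff\<close>)
  also have "\<dots> = L2_set z B * L2_set (\<lambda>r. L2_set (a r) B) A"
    using L2_set_mult_left[of "L2_set z B" "\<lambda>r. L2_set (a r) B" A] by (simp add: mult.commute L2_set_nonneg)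
  also have "L2_set (\<lambda>r. L2_set (a r) B) A = L2_set (\<lambda>(r, j). a r j) (A \<times> B)"
    by (simp add: L2_set_def sum_nonneg sum.cartesian_product case_prod_beta)
  finally show ?thesis by (simp add: mult.commute)
qed

text \<open>At the zero matrix the residual is the one-hot label itself, so the negative gradient is
  the empirical mean of label times feature. Entries outside the dimensions do not enter the loss,
  and their partial derivatives are \<open>0\<close>.\<close>

lemma one_gradient_step:
  "grad_descent (loss V n N 0 x y) 1 (Suc 0)
    = (\<lambda>r j. if r < V \<and> j < n then (\<Sum>i<N. one_hot (y i) r * x i j) / real N else 0)"
proof (intro ext)
  fix r j
  let ?F = "\<lambda>u. loss V n N 0 x y ((\<lambda>r j. 0)(r := (\<lambda>j. 0)(j := u)))"
  have mv: "mat_vec n ((\<lambda>r j. 0)(r := (\<lambda>j. 0)(j := u))) z r' = (if r' = r \<and> j < n then u * z j else 0)" for u z r'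
  proof -
    have "mat_vec n ((\<lambda>r j. 0)(r := (\<lambda>j. 0)(j := u))) z r' = (\<Sum>j'<n. if j' = j then (if r' = r then u * z j else 0) else 0)"
      unfolding mat_vec_def by (intro sum.cong) auto
    then show ?thesis by simp
  qed
  define e where "e i r' = (if r' = r \<and> j < n then x i j else 0)" for i r'
  have F: "?F u = (\<Sum>i<N. \<Sum>r'<V. (one_hot (y i) r' - u * e i r')\<^sup>2) * (1 / (2 * real N))" for u
    by (auto simp: loss_def mv L2_set_def sum_nonneg e_def intro!: sum.cong)
  have "(?F has_real_derivative (\<Sum>i<N. \<Sum>r'<V. - 2 * (one_hot (y i) r' * e i r')) * (1 / (2 * real N))) (at 0)"
    unfolding F by (intro DERIV_cmult_right DERIV_sum) (auto intro!: derivative_eq_intros)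
  also have "(\<Sum>i<N. \<Sum>r'<V. - 2 * (one_hot (y i) r' * e i r'))
      = (if r < V \<and> j < n then - 2 * (\<Sum>i<N. one_hot (y i) r * x i j) else 0)"
  proof -
    have "(\<Sum>r'<V. - 2 * (one_hot (y i) r' * e i r'))
        = (\<Sum>r'<V. if r' = r then (if j < n then - 2 * (one_hot (y i) r * x i j) else 0) else 0)" for i
      by (intro sum.cong) (auto simp: e_def)
    also have "\<dots> i = (if r < V \<and> j < n then - 2 * (one_hot (y i) r * x i j) else 0)" for i
      by simp
    finally have "(\<Sum>r'<V. - 2 * (one_hot (y i) r' * e i r'))
        = (if r < V \<and> j < n then - 2 * (one_hot (y i) r * x i j) else 0)" for i .
    then show ?thesis by (cases "r < V \<and> j < n") (simp_all only: sum_distrib_left, simp_all)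
  qed
  finally have "deriv ?F 0 = (if r < V \<and> j < n then - 2 * (\<Sum>i<N. one_hot (y i) r * x i j) else 0) * (1 / (2 * real N))"
    by (rule DERIV_imp_deriv)
  then show "grad_descent (loss V n N 0 x y) 1 (Suc 0) r j
      = (if r < V \<and> j < n then (\<Sum>i<N. one_hot (y i) r * x i j) / real N else 0)"
    by (simp add: gradient_def)
qed

lemma sum_lessThan_double: "(\<Sum>i<2 * M. f i) = (\<Sum>j<M. f (2 * j) + f (2 * j + 1))" for f :: "nat \<Rightarrow> real"
  by (induction M) (simp_all add: add.assoc)

lemma rff_inner:
  fixes w :: freqs
  shows
  "(\<Sum>i<2 * M. rff M n (\<lambda>j r. w (l, j, r)) h i * rff M n (\<lambda>j r. w (l, j, r)) h' i)
    = empirical_kernel M n l w (\<lambda>r. h r - h' r)"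
proof -
  have "(\<Sum>i<2 * M. rff M n (\<lambda>j r. w (l, j, r)) h i * rff M n (\<lambda>j r. w (l, j, r)) h' i)
      = (\<Sum>j<M. cos ((\<Sum>r<n. w (l, j, r) * h r) - (\<Sum>r<n. w (l, j, r) * h' r)) / real M)"
    unfolding sum_lessThan_double
    by (intro sum.cong) (simp_all add: rff_def Let_def cos_diff add_divide_distrib)
  then show ?thesis
    by (simp add: empirical_kernel_def sum_subtractf right_diff_distrib sum_divide_distrib)
qed

lemma rff_norm:
  fixes w :: freqs
  shows "M > 0 \<Longrightarrow> (\<Sum>i<2 * M. (rff M n (\<lambda>j r. w (l, j, r)) h i)\<^sup>2) = 1"
  using rff_inner[of M n w l h h] by (simp add: power2_eq_square empirical_kernel_def)

text \<open>Here \<open>k z i\<close> is the kernel between query and sample, \<open>C\<close> the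
  samples counted as equal to the query, \<open>Q i\<close> the posterior of sample \<open>i\<close>
  and \<open>q\<close> that of the query. The total kernel mass is at least
  \<open>N * (c / 4)\<close>: mass \<open>1 / 2\<close> on a fraction \<open>c\<close> of the
  samples, less at most \<open>N * tol\<close> from the others. Samples in \<open>C\<close> have no
  bias, and the others contribute at most \<open>2 * tol\<close> each.\<close>

lemma nadaraya_watson:
  fixes x :: "nat \<Rightarrow> rvec" and Q :: "nat \<Rightarrow> rvec" and d :: nat and z :: rvec
  defines "k \<equiv> \<lambda>z i. \<Sum>j<d. x i j * z j"
  assumes N: "N > 0" and y: "\<And>i. i < N \<Longrightarrow> y i < V"
    and noise: "L2_set (\<lambda>(r, j). \<Sum>i<N. (one_hot (y i) r - Q i r) * x i j) ({..<V} \<times> {..<d}) \<le> real N * t"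
    and z: "(\<Sum>j<d. (z j)\<^sup>2) = 1"
    and inside: "\<And>i. i < N \<Longrightarrow> i \<in> C \<Longrightarrow> k z i \<ge> 1 / 2" "\<And>i r. i < N \<Longrightarrow> i \<in> C \<Longrightarrow> r < V \<Longrightarrow> Q i r = q r"
    and outside: "\<And>i. i < N \<Longrightarrow> i \<notin> C \<Longrightarrow> \<bar>k z i\<bar> \<le> tol"
    and Q: "\<And>i. i < N \<Longrightarrow> L2_set (\<lambda>r. Q i r - q r) {..<V} \<le> 2"
    and C: "real (card ({..<N} \<inter> C)) \<ge> c * N" and c: "c > 0" "tol \<ge> 0" "tol \<le> c / 4"
    and W: "\<And>r j. r < V \<Longrightarrow> j < d \<Longrightarrow> W r j = (\<Sum>i<N. one_hot (y i) r * x i j) / real N"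
  shows "L2_set (\<lambda>r. normalize_sum V (mat_vec d W z) r - q r) {..<V} \<le> (t + 2 * tol) / (c / 4)"
proof -
  define S where "S = (\<Sum>i<N. k z i)"
  have "S = (\<Sum>i\<in>{..<N} \<inter> C. k z i) + (\<Sum>i\<in>{..<N} - C. k z i)"
    unfolding S_def by (subst sum.Int_Diff[of _ _ C]) auto
  also have "\<dots> \<ge> (\<Sum>i\<in>{..<N} \<inter> C. 1 / 2) + (\<Sum>i\<in>{..<N} - C. - tol)"
    using inside(1) outside by (intro add_mono sum_mono) (auto simp: abs_le_iff minus_le_iff)
  also have "(\<Sum>i\<in>{..<N} \<inter> C. 1 / 2) + (\<Sum>i\<in>{..<N} - C. - tol) \<ge> c * N / 2 - N * tol"
  proof -
    have "real (card ({..<N} - C)) \<le> N" using card_mono[of "{..<N}" "{..<N} - C"] by auto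
    then have "real (card ({..<N} - C)) * tol \<le> N * tol" using c by (intro mult_right_mono) auto
    then show ?thesis using C by simp
  qed
  also have "c * N / 2 - N * tol \<ge> N * (c / 4)"
    using mult_left_mono[OF c(3), of "real N"] by (simp add: algebra_simps)
  finally have S: "S \<ge> N * (c / 4)" by simp
  moreover have "N * (c / 4) > 0" using N c by simp
  ultimately have S0: "S > 0" by linarith
  have mv: "mat_vec d W z r = (\<Sum>i<N. one_hot (y i) r * k z i) / N" if "r < V" for r
  proof -
    have "mat_vec d W z r = (\<Sum>j<d. \<Sum>i<N. one_hot (y i) r * x i j * z j / N)"
      unfolding mat_vec_def using W[OF that] by (intro sum.cong) (simp_all add: sum_divide_distrib sum_distrib_right)
    also have "\<dots> = (\<Sum>i<N. \<Sum>j<d. one_hot (y i) r * x i j * z j / N)" by (rule sum.swap)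
    finally show ?thesis by (simp add: k_def sum_distrib_left sum_divide_distrib mult.assoc)
  qed
  \<comment> \<open>One-hot labels have coordinate sum \<open>1\<close>, so the normaliser of the
    network is the mean kernel weight, exactly the Nadaraya-Watson denominator.\<close>
  have tot: "(\<Sum>r<V. mat_vec d W z r) = S / N"
  proof -
    have "(\<Sum>r<V. mat_vec d W z r) = (\<Sum>r<V. \<Sum>i<N. one_hot (y i) r * k z i) / N"
      by (simp add: mv sum_divide_distrib)
    also have "(\<Sum>r<V. \<Sum>i<N. one_hot (y i) r * k z i) = (\<Sum>i<N. (\<Sum>r<V. one_hot (y i) r) * k z i)"
      by (subst sum.swap) (simp add: sum_distrib_right)
    also have "\<dots> = S"
      unfolding S_def using y by (intro sum.cong) (auto simp: one_hot_def)
    finally show ?thesis .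
  qed
  \<comment> \<open>Splits the error into label noise, which is linear in \<open>z\<close>, and
    smoothing bias.\<close>
  have eq: "normalize_sum V (mat_vec d W z) r - q r = 1 / S *
      ((\<Sum>j<d. (\<Sum>i<N. (one_hot (y i) r - Q i r) * x i j) * z j) + (\<Sum>i<N. k z i * (Q i r - q r)))" if "r < V" for r
  proof -
    have "(\<Sum>j<d. (\<Sum>i<N. (one_hot (y i) r - Q i r) * x i j) * z j) = (\<Sum>i<N. (one_hot (y i) r - Q i r) * k z i)"
      unfolding k_def sum_distrib_right sum_distrib_left by (subst sum.swap) (simp add: mult.assoc)
    then have "(\<Sum>j<d. (\<Sum>i<N. (one_hot (y i) r - Q i r) * x i j) * z j) + (\<Sum>i<N. k z i * (Q i r - q r))
        = (\<Sum>i<N. one_hot (y i) r * k z i) - q r * S"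
      unfolding S_def by (simp add: sum_distrib_left algebra_simps flip: sum.distrib sum_subtractf)
    then show ?thesis
      unfolding normalize_sum_def tot mv[OF that] using S0 N by (simp add: field_simps)
  qed
  let ?a = "\<lambda>r. \<Sum>j<d. (\<Sum>i<N. (one_hot (y i) r - Q i r) * x i j) * z j" and ?b = "\<lambda>r. \<Sum>i<N. k z i * (Q i r - q r)"
  have a: "L2_set ?a {..<V} \<le> N * t"
    using order_trans[OF L2_set_matrix_vector_le[of "\<lambda>r j. \<Sum>i<N. (one_hot (y i) r - Q i r) * x i j" z "{..<d}" "{..<V}"]] noise z
    by (simp add: L2_set_def[of z])
  have b: "L2_set ?b {..<V} \<le> N * (2 * tol)"
  proof -
    have "L2_set ?b {..<V} \<le> (\<Sum>i<N. L2_set (\<lambda>r. k z i * (Q i r - q r)) {..<V})"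
      by (rule L2_set_sum_le) simp
    also have "\<dots> \<le> (\<Sum>i<N. 2 * tol)"
    proof (intro sum_mono)
      fix i assume i: "i \<in> {..<N}"
      show "L2_set (\<lambda>r. k z i * (Q i r - q r)) {..<V} \<le> 2 * tol"
      proof (cases "i \<in> C")
        case True
        then have "L2_set (\<lambda>r. k z i * (Q i r - q r)) {..<V} = 0"
          using inside(2) i by (simp add: L2_set_def)
        then show ?thesis using c by simp
      next
        case False
        then show ?thesis
          unfolding L2_set_mult_left
          using mult_mono[OF outside Q, of i i] i c by (simp add: L2_set_nonneg mult.commute)
      qed
    qed
    finally show ?thesis by simp
  qed
  have "L2_set (\<lambda>r. normalize_sum V (mat_vec d W z) r - q r) {..<V} = L2_set (\<lambda>r. 1 / S * (?a r + ?b r)) {..<V}"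
    by (intro L2_set_cong) (auto simp: eq)
  also have "\<dots> = 1 / S * L2_set (\<lambda>r. ?a r + ?b r) {..<V}"
    using S0 L2_set_mult_left[of "1 / S" "\<lambda>r. ?a r + ?b r" "{..<V}"] by simp
  also have "\<dots> \<le> 1 / S * (N * t + N * (2 * tol))"
    using S0 a b order_trans[OF L2_set_triangle_ineq[of ?a ?b "{..<V}"]] by (intro mult_left_mono) auto
  also have "\<dots> \<le> 1 / (N * (c / 4)) * (N * t + N * (2 * tol))"
  proof (intro mult_right_mono)
    show "1 / S \<le> 1 / (N * (c / 4))" using S N c S0 by (intro divide_left_mono) auto
    have "0 \<le> real N * t" using a L2_set_nonneg order_trans by blast
    then show "0 \<le> N * t + N * (2 * tol)" using c by simp
  qed
  also have "\<dots> = (t + 2 * tol) / (c / 4)"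
    using N c by (simp add: field_simps)
  finally show ?thesis .
qed

section \<open>The trained network\<close>

lemma sum_div_mod:
  fixes f :: "nat \<Rightarrow> nat \<Rightarrow> real"
  shows "(\<Sum>r<n * k. f (r div k) (r mod k)) = (\<Sum>q<n. \<Sum>j<k. f q j)"
proof -
  have "(\<Sum>r<n * k. f (r div k) (r mod k)) = (\<Sum>q<n. \<Sum>r\<in>{q * k..<q * k + k}. f (r div k) (r mod k))"
    by (rule sum.nat_group[symmetric])
  moreover have "(\<Sum>r\<in>{q * k..<q * k + k}. f (r div k) (r mod k)) = (\<Sum>j<k. f q j)" for q
  proof -
    have div: "r div k = q" if "q * k \<le> r" "r < q * k + k" for r
      using that by (intro div_nat_eqI) (auto simp: mult.commute)
    show ?thesis
    by (rule sum.reindex_bij_witness[of _ "\<lambda>j. q * k + j" "\<lambda>r. r - q * k"])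
      (auto simp: less_diff_conv2 div modulo_nat_def mult.commute)
  qed
  ultimately show ?thesis by simp
qed

lemma rff_cong: "(\<And>r. r < n \<Longrightarrow> h r = h' r) \<Longrightarrow> rff M n \<omega> h = rff M n \<omega> h'"
  by (simp add: rff_def)

lemma L2_set_swap: "L2_set (\<lambda>r. f r - g r) A = L2_set (\<lambda>r. g r - f r) A" for f g :: "'b \<Rightarrow> real"
  by (simp add: L2_set_def power2_commute)

lemma L2_set_diff_triangle:
  "L2_set (\<lambda>r. f r - h r) A \<le> L2_set (\<lambda>r. f r - g r) A + L2_set (\<lambda>r. g r - h r) A"
  using L2_set_triangle_ineq[of "\<lambda>r. f r - g r" "\<lambda>r. g r - h r" A] by simp

lemma embedding_cong_weights:
  assumes "n \<le> depth H" "\<And>l. depth H - n < l \<Longrightarrow> l \<le> depth H \<Longrightarrow> W l = W' l"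
  shows "embedding H encL p \<omega> W x n = embedding H encL p \<omega> W' x n"
  using assms
proof (induction n)
  case (Suc n)
  have "embedding H encL p \<omega> W x n = embedding H encL p \<omega> W' x n"
    using Suc by (intro Suc.IH) auto
  then show ?case using Suc.prems by (simp add: Let_def)
qed simp

text \<open>The network has the same tree structure as the grammar: the embedding at position
  \<open>k\<close> after \<open>n\<close> layers reads only the \<open>s ^ n\<close> inputs below
  that position.\<close>

lemma embedding_cong_input:
  assumes "branching H \<ge> 1"
    and "\<And>i. k * branching H ^ n \<le> i \<Longrightarrow> i < Suc k * branching H ^ n \<Longrightarrow> x ! i = x' ! i"
  shows "embedding H encL p \<omega> W x n k = embedding H encL p \<omega> W x' n k"
  using assms(2)
proof (induction n arbitrary: k)
  case (Suc n)
  let ?s = "branching H" and ?V = "card (vocab H 0)"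
  have "patch_features ?s ?V M \<omega>' (embedding H encL p \<omega> W x n) k
      = patch_features ?s ?V M \<omega>' (embedding H encL p \<omega> W x' n) k" for M \<omega>'
    unfolding patch_features_def
  proof (rule rff_cong)
    fix r assume r: "r < ?s * ?V"
    define q where "q = r div ?V"
    have q: "q < ?s" using r by (simp add: q_def less_mult_imp_div_less mult.commute)
    have "embedding H encL p \<omega> W x n (k * ?s + q) = embedding H encL p \<omega> W x' n (k * ?s + q)"
    proof (rule Suc.IH)
      fix i assume i: "(k * ?s + q) * ?s ^ n \<le> i" "i < Suc (k * ?s + q) * ?s ^ n"
      have "k * ?s ^ Suc n \<le> (k * ?s + q) * ?s ^ n" by (simp add: algebra_simps)
      moreover have "Suc (k * ?s + q) * ?s ^ n \<le> (Suc k * ?s) * ?s ^ n" using q by (intro mult_right_mono) auto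
      then have "Suc (k * ?s + q) * ?s ^ n \<le> Suc k * ?s ^ Suc n" by (simp only: power_Suc mult.assoc)
      ultimately show "x ! i = x' ! i"
        using i by (intro Suc.prems) linarith+
    qed
    then show "concat_patch ?s ?V (embedding H encL p \<omega> W x n) k r = concat_patch ?s ?V (embedding H encL p \<omega> W x' n) k r"
      by (simp add: concat_patch_def q_def)
  qed
  then show ?case by (simp add: Let_def)
qed simp

type_synonym samples = "nat \<times> nat \<Rightarrow> nat list \<times> nat"

locale learner = cfg_model H R V m for H :: "nat rhm" and R V m +
  fixes enc0 encL :: "nat \<Rightarrow> nat" and \<sigma> :: real and M N :: nat
  assumes enc0: "bij_betw enc0 (vocab H 0) {..<V}" and encL: "bij_betw encL (vocab H L) {..<V}"
    and \<sigma>_pos: "\<sigma> > 0" and M_pos: "M > 0" and N_pos: "N > 0"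
begin

definition hp :: hyperparams where
  "hp = \<lparr>bandwidth = \<lambda>_. \<sigma>, num_freqs = \<lambda>_. M, num_samples = \<lambda>_. N, num_steps = \<lambda>_. 1,
     step_size = \<lambda>_. 1, weight_decay = 0\<rparr>"

lemma hp_simps [simp]: "bandwidth hp l = \<sigma>" "num_freqs hp l = M" "num_samples hp l = N"
  "num_steps hp l = 1" "step_size hp l = 1" "weight_decay hp = 0"
  by (simp_all add: hp_def)

lemma card_vocab0: "card (vocab H 0) = V"
  by (simp add: card_vocab)

abbreviation weights :: "freqs \<Rightarrow> samples \<Rightarrow> nat \<Rightarrow> nat \<Rightarrow> rmat" where
  "weights w D n \<equiv> trained H enc0 encL hp (\<lambda>l j r. w (l, j, r)) D n"

text \<open>The weights are those available after \<open>n\<close> stages, so this visibly depends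
  only on the samples of earlier stages; \<open>embedding_weights_later\<close> shows that further
  training leaves the value unchanged.\<close>

definition emb :: "freqs \<Rightarrow> samples \<Rightarrow> nat \<Rightarrow> nat list \<Rightarrow> nat \<Rightarrow> rvec" where
  "emb w D n x = embedding H encL hp (\<lambda>l j r. w (l, j, r)) (weights w D n) x n"

definition feat :: "freqs \<Rightarrow> samples \<Rightarrow> nat \<Rightarrow> nat list \<Rightarrow> nat \<Rightarrow> rvec" where
  "feat w D n x k = rff M (s * V) (\<lambda>j r. w (L - n, j, r)) (concat_patch s V (emb w D n x) k)"

definition cross_cov :: "freqs \<Rightarrow> samples \<Rightarrow> nat \<Rightarrow> rmat" where
  "cross_cov w D n = (\<lambda>r j. if r < V \<and> j < 2 * M then
     (\<Sum>i<N. one_hot (enc0 (snd (D (L - n, i)))) r * feat w D n (fst (D (L - n, i))) 0 j) / real N else 0)"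

lemma weights_Suc: "weights w D (Suc n) = (weights w D n)(L - n := cross_cov w D n)"
proof -
  have "grad_descent (loss V (2 * M) N 0 x y) 1 1
      = (\<lambda>r j. if r < V \<and> j < 2 * M then (\<Sum>i<N. one_hot (y i) r * x i j) / real N else 0)" for x y
    unfolding One_nat_def by (rule one_gradient_step)
  then show ?thesis
    unfolding cross_cov_def feat_def emb_def
    by (simp add: Let_def card_vocab0 patch_features_def del: grad_descent.simps)
qed

lemma weights_later: "n \<le> n' \<Longrightarrow> L - n < l \<Longrightarrow> weights w D n' l = weights w D n l"
proof (induction n' rule: dec_induct)
  case (step n')
  then show ?case unfolding weights_Suc by auto
qed simp

lemma embedding_weights_later:
  "n \<le> n' \<Longrightarrow> n \<le> L \<Longrightarrow> embedding H encL hp (\<lambda>l j r. w (l, j, r)) (weights w D n') x n = emb w D n x"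
  unfolding emb_def using weights_later by (intro embedding_cong_weights) auto

lemma emb_0: "emb w D 0 x k = one_hot (encL (x ! k))"
  by (simp add: emb_def)

lemma emb_Suc:
  assumes "n < L"
  shows "emb w D (Suc n) x k = normalize_sum V (mat_vec (2 * M) (cross_cov w D n) (feat w D n x k))"
proof -
  have "emb w D (Suc n) x k = normalize_sum V (mat_vec (2 * M) (weights w D (Suc n) (L - n))
      (patch_features s V M (\<lambda>j r. w (L - n, j, r))
        (embedding H encL hp (\<lambda>l j r. w (l, j, r)) (weights w D (Suc n)) x n) k))"
    by (simp add: emb_def Let_def card_vocab0 del: trained.simps)
  also have "embedding H encL hp (\<lambda>l j r. w (l, j, r)) (weights w D (Suc n)) x n = emb w D n x"
    using assms by (intro embedding_weights_later) auto
  also have "weights w D (Suc n) (L - n) = cross_cov w D n"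
    unfolding weights_Suc by simp
  finally show ?thesis by (simp add: feat_def patch_features_def)
qed

lemma network_output_eq:
  "network_output H encL hp (\<lambda>l j r. w (l, j, r)) (weights w D L) x = emb w D L x 0"
  by (simp add: network_output_def emb_def)

lemma feat_inner:
  "(\<Sum>j<2 * M. feat w D n x k j * feat w D n x' k' j)
    = empirical_kernel M (s * V) (L - n) w
        (\<lambda>r. concat_patch s V (emb w D n x) k r - concat_patch s V (emb w D n x') k' r)"
  unfolding feat_def by (rule rff_inner)

lemma feat_norm: "(\<Sum>j<2 * M. (feat w D n x k j)\<^sup>2) = 1"
  unfolding feat_def by (rule rff_norm[OF M_pos])

text \<open>Locality brings the features into the form required by
  \<open>label_decorrelated\<close>, a function of the subtree below the first token of level
  \<open>L - Suc n\<close>.\<close>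

lemma feat_take: "feat w D n x 0 = feat w D n (take (s ^ Suc n) x) 0"
  unfolding feat_def
proof (rule rff_cong)
  fix r assume "r < s * V"
  then have r: "r div V < s" by (simp add: less_mult_imp_div_less mult.commute)
  have "emb w D n x (r div V) = emb w D n (take (s ^ Suc n) x) (r div V)"
    unfolding emb_def
  proof (rule embedding_cong_input[OF s_pos])
    fix i assume "i < Suc (r div V) * s ^ n"
    also have "\<dots> \<le> s * s ^ n" using r by (intro mult_right_mono) auto
    finally show "x ! i = take (s ^ Suc n) x ! i" by simp
  qed
  then show "concat_patch s V (emb w D n x) 0 r = concat_patch s V (emb w D n (take (s ^ Suc n) x)) 0 r"
    by (simp add: concat_patch_def)
qed

definition dec :: "nat \<Rightarrow> nat" where
  "dec = inv_into (vocab H 0) enc0"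

lemma dec_bij: "bij_betw dec {..<V} (vocab H 0)"
  unfolding dec_def using enc0 by (rule bij_betw_inv_into)

lemma dec_enc0: "\<zeta> \<in> vocab H 0 \<Longrightarrow> dec (enc0 \<zeta>) = \<zeta>"
  unfolding dec_def using enc0 by (simp add: bij_betw_def)

lemma enc0_dec: "r < V \<Longrightarrow> enc0 (dec r) = r"
  unfolding dec_def using enc0 by (simp add: bij_betw_def f_inv_into_f)

lemma one_hot_enc0: "\<zeta> \<in> vocab H 0 \<Longrightarrow> r < V \<Longrightarrow> one_hot (enc0 \<zeta>) r = of_bool (\<zeta> = dec r)"
  using dec_enc0 enc0_dec by (auto simp: one_hot_def)

lemma L2_set_dec: "L2_set (\<lambda>r. f (dec r)) {..<V} = L2_set f (vocab H 0)"
  unfolding L2_set_def using sum.reindex_bij_betw[OF dec_bij, of "\<lambda>\<zeta>. (f \<zeta>)\<^sup>2"] by simp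

text \<open>Stages are counted from the leaves: after \<open>n\<close> of them, the embedded tokens live at level \<open>L - n\<close>.\<close>

definition ideal :: "nat \<Rightarrow> nat \<Rightarrow> rvec" where
  "ideal n \<nu> = (if n = 0 then one_hot (encL \<nu>) else (\<lambda>r. post (L - n) \<nu> (dec r)))"

text \<open>Lets latent tokens be used as functions of a training input. On the support the choice
  is forced by non-ambiguity, see \<open>parse_eq\<close>.\<close>

definition parse :: "nat list \<Rightarrow> nat list list" where
  "parse x = (SOME ss. ss \<in> set_pmf (rhm_pmf H) \<and> ss ! L = x)"

lemma valid_rhm: "ss \<in> set_pmf (rhm_pmf H) \<Longrightarrow> valid L ss"
  by (rule valid_derivation) auto

lemma parse_eq:
  assumes "ss \<in> set_pmf (rhm_pmf H)"
  shows "parse (ss ! L) = ss"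
proof -
  have "parse (ss ! L) \<in> set_pmf (rhm_pmf H) \<and> parse (ss ! L) ! L = ss ! L"
    unfolding parse_def by (rule someI[of _ ss]) (use assms in auto)
  then show ?thesis using assms valid_rhm by (intro valid_unique[of L]) auto
qed

text \<open>The posterior of the first patch of level \<open>L - n\<close>; by
  \<open>label_posterior_eq\<close> it is the law of the label given the parent token, which lives
  one level higher.\<close>

definition posterior :: "nat \<Rightarrow> nat list \<Rightarrow> rvec" where
  "posterior n x r = post (L - Suc n) (hd (parse x ! (L - Suc n))) (dec r)"

text \<open>The coordinates of the centred sample average whose norm controls stage \<open>n\<close>: the label noise
  tensored with the features, and the deviations of the patch frequencies. The value \<open>0\<close> off the
  support makes the bound required by Hoeffding's inequality hold for every sample.\<close>

definition noise_coords :: "nat \<Rightarrow> (nat \<times> nat + nat list) set" where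
  "noise_coords n = ({..<V} \<times> {..<2 * M}) <+> patches H (L - n)"

definition noise :: "freqs \<Rightarrow> samples \<Rightarrow> nat \<Rightarrow> nat \<times> nat + nat list
    \<Rightarrow> nat list \<times> nat \<Rightarrow> real" where
  "noise w D n k z = (if z \<notin> set_pmf (sample_pmf H) then 0 else case k of
      Inl (r, j) \<Rightarrow> (one_hot (enc0 (snd z)) r - posterior n (fst z) r) * feat w D n (fst z) 0 j
    | Inr \<mu> \<Rightarrow> of_bool (first_patch H (L - n) (parse (fst z)) = \<mu>) - patch_prob H (L - n) \<mu>)"

end

section \<open>Accuracy on good samples and frequencies\<close>

lemma L2_set_le_2:
  fixes f g :: "'b \<Rightarrow> real"
  assumes "\<And>i. i \<in> A \<Longrightarrow> f i \<ge> 0" "\<And>i. i \<in> A \<Longrightarrow> g i \<ge> 0" "sum f A \<le> 1" "sum g A \<le> 1"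
  shows "L2_set (\<lambda>i. f i - g i) A \<le> 2"
proof -
  have "L2_set (\<lambda>i. f i - g i) A \<le> (\<Sum>i\<in>A. \<bar>f i - g i\<bar>)" by (rule L2_set_le_sum_abs)
  also have "\<dots> \<le> (\<Sum>i\<in>A. f i + g i)" using assms(1,2) by (intro sum_mono) (fastforce simp: abs_le_iff)
  also have "\<dots> \<le> 2" using assms by (simp add: sum.distrib)
  finally show ?thesis .
qed

lemma L2_set_mono_subset: "finite B \<Longrightarrow> A \<subseteq> B \<Longrightarrow> L2_set f A \<le> L2_set f B"
  unfolding L2_set_def by (intro real_sqrt_le_mono sum_mono2) auto

lemma abs_le_L2_set: "finite A \<Longrightarrow> i \<in> A \<Longrightarrow> \<bar>f i\<bar> \<le> L2_set f A"
  using member_le_L2_set[of A i "\<lambda>i. \<bar>f i\<bar>"] by (simp add: L2_set_def)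

text \<open>\<open>\<epsilon>\<close> is the embedding error, \<open>\<tau>\<close> the separation
  of symbols, \<open>p\<close> a lower bound for patch probabilities and \<open>tol\<close> the
  tolerance for noise and leakage. \<open>\<epsilon> \<le> \<tau> / 4\<close> leaves a separation of
  \<open>\<tau> / 2\<close> between perturbed embeddings;
  \<open>16 * real s * \<epsilon>\<^sup>2 \<le> \<sigma>\<^sup>2\<close> keeps equal patches close
  on the scale of the kernel; the exponential condition makes the kernel small between different
  patches; \<open>24 * tol \<le> p * \<epsilon>\<close> closes the induction. Separation concerns
  \<open>1 \<le> l < L\<close> because level \<open>L\<close> is one-hot and level \<open>0\<close>
  is output only.\<close>

locale calibrated_learner = learner +
  fixes \<epsilon> tol \<tau> p :: real
  assumes marg_ge: "\<And>n \<nu>. n < L \<Longrightarrow> \<nu> \<in> vocab H n \<Longrightarrow> marg n \<nu> / m \<ge> p" and p_pos: "p > 0"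
    and sep: "\<And>l \<nu> \<nu>'. 1 \<le> l \<Longrightarrow> l < L \<Longrightarrow> \<nu> \<in> vocab H l \<Longrightarrow> \<nu>' \<in> vocab H l \<Longrightarrow> \<nu> \<noteq> \<nu>' \<Longrightarrow>
        L2_set (\<lambda>\<zeta>. post l \<nu> \<zeta> - post l \<nu>' \<zeta>) (vocab H 0) \<ge> \<tau>"
    and \<tau>: "0 < \<tau>" "\<tau> \<le> 1" and \<epsilon>: "0 < \<epsilon>" "\<epsilon> \<le> \<tau> / 4" "16 * real s * \<epsilon>\<^sup>2 \<le> \<sigma>\<^sup>2"
    and \<sigma>tol: "exp (- (\<tau>\<^sup>2 / (8 * \<sigma>\<^sup>2))) \<le> tol / 2" and tol_pos: "tol > 0" and tol: "24 * tol \<le> p * \<epsilon>"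
begin

lemma marg_pos: "n < L \<Longrightarrow> \<nu> \<in> vocab H n \<Longrightarrow> marg n \<nu> > 0"
  using marg_ge[of n \<nu>] p_pos m_pos by (metis divide_pos_pos less_le_trans linorder_not_le divide_nonpos_pos not_gr_zero of_nat_0_less_iff not_one_le_zero order_less_le_trans)

lemma sum_post_dec: "n < L \<Longrightarrow> \<nu> \<in> vocab H n \<Longrightarrow> (\<Sum>r<V. post n \<nu> (dec r)) = 1"
  using sum.reindex_bij_betw[OF dec_bij, of "post n \<nu>"] sum_post[of n \<nu>] marg_pos[of n \<nu>] by simp

lemma p_le_1: "p \<le> 1"
proof -
  obtain \<nu> where "\<nu> \<in> vocab H 0" using vocab0_nonempty by auto
  then have "p \<le> marg 0 \<nu> / m" using marg_ge[of 0] L_pos by auto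
  also have "\<dots> \<le> 1" using m_pos pmf_le_1[of "map_pmf snd (token_law 0)" \<nu>] by (simp add: marg_def divide_le_eq)
  finally show ?thesis .
qed

lemma tol_small: "tol \<le> p / 96" "tol \<le> 1 / 96"
proof -
  have "p * \<epsilon> \<le> p * (1 / 4)" using p_pos \<epsilon> \<tau> by (intro mult_left_mono) auto
  then show "tol \<le> p / 96" using tol by simp
  then show "tol \<le> 1 / 96" using p_le_1 by simp
qed

lemma ideal_le_1:
  assumes "n \<le> L" "\<nu> \<in> vocab H (L - n)" "r < V" "n > 0"
  shows "ideal n \<nu> r \<le> 1"
proof -
  have "ideal n \<nu> r = post (L - n) \<nu> (dec r)" using assms by (simp add: ideal_def)
  also have "\<dots> \<le> (\<Sum>r<V. post (L - n) \<nu> (dec r))"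
    using assms by (intro member_le_sum) (auto simp: post_nonneg)
  also have "\<dots> = 1" using assms by (intro sum_post_dec) auto
  finally show ?thesis .
qed

lemma abs_ideal_le_1: "n \<le> L \<Longrightarrow> \<nu> \<in> vocab H (L - n) \<Longrightarrow> r < V \<Longrightarrow> \<bar>ideal n \<nu> r\<bar> \<le> 1"
  using ideal_le_1[of n \<nu> r] by (cases "n = 0") (auto simp: ideal_def one_hot_def post_nonneg)

text \<open>Two distinct one-hot input embeddings differ by at least \<open>1 \<ge> \<tau>\<close>;
  at the higher levels the separation of posteriors applies.\<close>

lemma ideal_separated:
  assumes n: "n < L" and \<nu>: "\<nu> \<in> vocab H (L - n)" "\<nu>' \<in> vocab H (L - n)" "\<nu> \<noteq> \<nu>'"
  shows "L2_set (\<lambda>r. ideal n \<nu> r - ideal n \<nu>' r) {..<V} \<ge> \<tau>"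
proof (cases "n = 0")
  case True
  have "encL \<nu> < V" "encL \<nu>' \<noteq> encL \<nu>"
    using encL \<nu> True by (auto simp: bij_betw_def inj_on_eq_iff)
  then have "1 \<le> L2_set (\<lambda>r. ideal n \<nu> r - ideal n \<nu>' r) {..<V}"
    using abs_le_L2_set[of "{..<V}" "encL \<nu>" "\<lambda>r. ideal n \<nu> r - ideal n \<nu>' r"] True
    by (simp add: ideal_def one_hot_def)
  then show ?thesis using \<tau> by simp
next
  case False
  then show ?thesis
    using sep[of "L - n" \<nu> \<nu>'] L2_set_dec[of "\<lambda>\<zeta>. post (L - n) \<nu> \<zeta> - post (L - n) \<nu>' \<zeta>"] assms
    by (simp add: ideal_def)
qed

section \<open>Kernel values between equal and between different patches\<close>

definition patch_at :: "nat \<Rightarrow> nat list list \<Rightarrow> nat \<Rightarrow> nat list" where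
  "patch_at n ss k = take s (drop (k * s) (ss ! (L - n)))"

text \<open>Quantified over all positions although training uses the first patch only: the next
  layer reads every position.\<close>

definition accurate :: "freqs \<Rightarrow> samples \<Rightarrow> nat \<Rightarrow> bool" where
  "accurate w D n \<longleftrightarrow> (\<forall>ss\<in>set_pmf (rhm_pmf H). \<forall>k<s ^ (L - n).
     L2_set (\<lambda>r. emb w D n (ss ! L) k r - ideal n (ss ! (L - n) ! k) r) {..<V} \<le> \<epsilon>)"

definition embedding_diff :: "freqs \<Rightarrow> samples \<Rightarrow> nat
    \<Rightarrow> nat list list \<Rightarrow> nat list list \<Rightarrow> nat \<Rightarrow> nat \<Rightarrow> rvec" where
  "embedding_diff w D n ss ss' k k' r
     = concat_patch s V (emb w D n (ss ! L)) k r - concat_patch s V (emb w D n (ss' ! L)) k' r"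

context
  fixes w D n
  assumes n: "n < L"
    and acc: "accurate w D n"
begin

lemma L_minus_n: "L - n = Suc (L - Suc n)"
  using n by simp

lemma patch_at_mem:
  assumes "ss \<in> set_pmf (rhm_pmf H)" "k < s ^ (L - Suc n)"
  shows "patch_at n ss k \<in> set_pmf (Q (L - Suc n) (ss ! (L - Suc n) ! k))" "length (patch_at n ss k) = s"
    "ss ! (L - Suc n) ! k \<in> vocab H (L - Suc n)"
proof -
  have v: "valid L ss" using valid_rhm[OF assms(1)] .
  show 1: "patch_at n ss k \<in> set_pmf (Q (L - Suc n) (ss ! (L - Suc n) ! k))"
    using v assms(2) n unfolding valid_def patch_at_def L_minus_n by auto
  show 2: "ss ! (L - Suc n) ! k \<in> vocab H (L - Suc n)"
    using token_in_vocab[OF v] assms(2) by simp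
  show "length (patch_at n ss k) = s"
    using patch_in_words[OF _ 2 1] n by auto
qed

lemma emb_patch:
  assumes "ss \<in> set_pmf (rhm_pmf H)" "k < s ^ (L - Suc n)" "q < s"
  shows "L2_set (\<lambda>r. emb w D n (ss ! L) (k * s + q) r - ideal n (patch_at n ss k ! q) r) {..<V} \<le> \<epsilon>"
    "patch_at n ss k ! q \<in> vocab H (L - n)"
proof -
  have "k * s + q < Suc k * s" using assms(3) by simp
  also have "\<dots> \<le> s ^ (L - Suc n) * s" using assms(2) by (intro mult_right_mono) auto
  finally have lt: "k * s + q < s ^ (L - n)" by (simp add: L_minus_n mult.commute)
  have len: "length (ss ! (L - n)) = s ^ (L - n)" using valid_rhm[OF assms(1)] by (simp add: valid_def)
  have eq: "patch_at n ss k ! q = ss ! (L - n) ! (k * s + q)"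
    using assms(3) lt len by (simp add: patch_at_def)
  show "L2_set (\<lambda>r. emb w D n (ss ! L) (k * s + q) r - ideal n (patch_at n ss k ! q) r) {..<V} \<le> \<epsilon>"
    unfolding eq using acc assms(1) lt by (simp add: accurate_def)
  show "patch_at n ss k ! q \<in> vocab H (L - n)"
    unfolding eq using token_in_vocab[OF valid_rhm[OF assms(1)] _ lt] by simp
qed

context
  fixes ss ss' k k'
  assumes ss: "ss \<in> set_pmf (rhm_pmf H)" "k < s ^ (L - Suc n)" "ss' \<in> set_pmf (rhm_pmf H)" "k' < s ^ (L - Suc n)"
begin

abbreviation "diff \<equiv> embedding_diff w D n ss ss' k k'"

text \<open>Embedding coordinates are at most \<open>1 + \<epsilon> \<le> 2\<close> in absolute
  value. This is the origin of the box of radius \<open>4\<close> on which the kernel approximation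
  is required.\<close>

lemma diff_bounded:
  assumes "r < s * V"
  shows "\<bar>diff r\<bar> \<le> 4"
proof -
  define q j where "q = r div V" and "j = r mod V"
  have q: "q < s" using assms by (simp add: q_def less_mult_imp_div_less mult.commute)
  have j: "j < V" using V_pos by (simp add: j_def)
  have "\<bar>emb w D n (ss ! L) (k * s + q) j\<bar> \<le> 2" if "ss \<in> set_pmf (rhm_pmf H)" "k < s ^ (L - Suc n)" for ss k
  proof -
    have "\<bar>emb w D n (ss ! L) (k * s + q) j - ideal n (patch_at n ss k ! q) j\<bar> \<le> \<epsilon>"
      using abs_le_L2_set[of "{..<V}" j] emb_patch(1)[OF that q] j by (meson finite_lessThan lessThan_iff order_trans)
    moreover have "\<bar>ideal n (patch_at n ss k ! q) j\<bar> \<le> 1"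
      using abs_ideal_le_1[OF _ emb_patch(2)[OF that q] j] n by simp
    ultimately show ?thesis using \<epsilon> \<tau> by linarith
  qed
  from this[OF ss(1,2)] this[OF ss(3,4)] show ?thesis
    unfolding embedding_diff_def concat_patch_def q_def[symmetric] j_def[symmetric] by linarith
qed

lemma sum_diff:
  "(\<Sum>r<s * V. (diff r)\<^sup>2)
    = (\<Sum>q<s. (L2_set (\<lambda>j. emb w D n (ss ! L) (k * s + q) j - emb w D n (ss' ! L) (k' * s + q) j) {..<V})\<^sup>2)"
  unfolding embedding_diff_def concat_patch_def
  using sum_div_mod[of "\<lambda>q j. (emb w D n (ss ! L) (k * s + q) j - emb w D n (ss' ! L) (k' * s + q) j)\<^sup>2" V s]
  by (simp add: L2_set_def sum_nonneg)

text \<open>Each of the \<open>s\<close> tokens moves by at most \<open>2 * \<epsilon>\<close>, so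
  the squared distance is at most \<open>\<sigma>\<^sup>2 / 4\<close> and the exponent at most
  \<open>1 / 8\<close>; then \<open>exp (- x) \<ge> 1 - x\<close>.\<close>

lemma rbf_same:
  assumes eq: "patch_at n ss k = patch_at n ss' k'"
  shows "rbf (s * V) \<sigma> diff \<ge> 7 / 8"
proof -
  have "L2_set (\<lambda>j. emb w D n (ss ! L) (k * s + q) j - emb w D n (ss' ! L) (k' * s + q) j) {..<V} \<le> 2 * \<epsilon>"
    if q: "q < s" for q
    using L2_set_diff_triangle[of "emb w D n (ss ! L) (k * s + q)" "emb w D n (ss' ! L) (k' * s + q)" "{..<V}"
        "ideal n (patch_at n ss k ! q)"]
      emb_patch(1)[OF ss(1,2) q] emb_patch(1)[OF ss(3,4) q, folded eq]
      L2_set_swap[of "ideal n (patch_at n ss k ! q)" "emb w D n (ss' ! L) (k' * s + q)" "{..<V}"] by linarith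
  then have "(\<Sum>r<s * V. (diff r)\<^sup>2) \<le> (\<Sum>q<s. (2 * \<epsilon>)\<^sup>2)"
    unfolding sum_diff by (intro sum_mono power_mono) (auto simp: L2_set_nonneg)
  also have "\<dots> \<le> \<sigma>\<^sup>2 / 4" using \<epsilon>(3) by (simp add: power_mult_distrib)
  finally have "(\<Sum>r<s * V. (diff r)\<^sup>2) / (2 * \<sigma>\<^sup>2) \<le> (\<sigma>\<^sup>2 / 4) / (2 * \<sigma>\<^sup>2)"
    by (intro divide_right_mono) auto
  also have "\<dots> = 1 / 8" using \<sigma>_pos by simp
  finally have "(\<Sum>r<s * V. (diff r)\<^sup>2) / (2 * \<sigma>\<^sup>2) \<le> 1 / 8" .
  then show ?thesis
    using exp_ge_add_one_self[of "- ((\<Sum>r<s * V. (diff r)\<^sup>2) / (2 * \<sigma>\<^sup>2))"] unfolding rbf_def by linarith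
qed

text \<open>A single differing position suffices: its embeddings are at distance at least
  \<open>\<tau> - 2 * \<epsilon> \<ge> \<tau> / 2\<close>.\<close>

lemma rbf_different:
  assumes ne: "patch_at n ss k \<noteq> patch_at n ss' k'"
  shows "rbf (s * V) \<sigma> diff \<le> tol / 2"
proof -
  have "length (patch_at n ss k) = s" "length (patch_at n ss' k') = s"
    using patch_at_mem(2) ss by auto
  then obtain q where q: "q < s" "patch_at n ss k ! q \<noteq> patch_at n ss' k' ! q"
    using ne by (metis nth_equalityI)
  let ?e = "emb w D n (ss ! L) (k * s + q)" and ?e' = "emb w D n (ss' ! L) (k' * s + q)"
  let ?c = "ideal n (patch_at n ss k ! q)" and ?c' = "ideal n (patch_at n ss' k' ! q)"
  have "\<tau> \<le> L2_set (\<lambda>r. ?c r - ?c' r) {..<V}"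
    using n q emb_patch(2)[OF ss(1,2)] emb_patch(2)[OF ss(3,4)] by (intro ideal_separated) auto
  also have "\<dots> \<le> L2_set (\<lambda>r. ?c r - ?e r) {..<V} + (L2_set (\<lambda>r. ?e r - ?e' r) {..<V} + L2_set (\<lambda>r. ?e' r - ?c' r) {..<V})"
    using L2_set_diff_triangle[of ?c ?c' "{..<V}" ?e] L2_set_diff_triangle[of ?e ?c' "{..<V}" ?e'] by linarith
  also have "\<dots> \<le> \<epsilon> + (L2_set (\<lambda>r. ?e r - ?e' r) {..<V} + \<epsilon>)"
    using emb_patch(1)[OF ss(1,2) q(1)] emb_patch(1)[OF ss(3,4) q(1)] L2_set_swap[of ?e ?c "{..<V}"] by linarith
  finally have "L2_set (\<lambda>r. ?e r - ?e' r) {..<V} \<ge> \<tau> / 2" using \<epsilon> by linarith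
  then have "(\<tau> / 2)\<^sup>2 \<le> (L2_set (\<lambda>r. ?e r - ?e' r) {..<V})\<^sup>2"
    using \<tau> by (intro power_mono) auto
  also have "\<dots> \<le> (\<Sum>r<s * V. (diff r)\<^sup>2)"
    unfolding sum_diff using q
    by (intro member_le_sum[of q _ "\<lambda>q. (L2_set (\<lambda>j. emb w D n (ss ! L) (k * s + q) j - emb w D n (ss' ! L) (k' * s + q) j) {..<V})\<^sup>2"]) auto
  finally have "\<tau>\<^sup>2 / 4 / (2 * \<sigma>\<^sup>2) \<le> (\<Sum>r<s * V. (diff r)\<^sup>2) / (2 * \<sigma>\<^sup>2)"
    by (intro divide_right_mono) (auto simp: power_divide)
  then have "rbf (s * V) \<sigma> diff \<le> exp (- (\<tau>\<^sup>2 / (8 * \<sigma>\<^sup>2)))"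
    unfolding rbf_def by simp
  then show ?thesis using \<sigma>tol by simp
qed

end

end

section \<open>Induction over the stages for fixed samples and frequencies\<close>

definition good_frequencies :: "freqs \<Rightarrow> nat \<Rightarrow> bool" where
  "good_frequencies w l \<longleftrightarrow> (\<forall>u. (\<forall>r<s * V. \<bar>u r\<bar> \<le> 4) \<longrightarrow>
     \<bar>empirical_kernel M (s * V) l w u - rbf (s * V) \<sigma> u\<bar> \<le> tol / 2)"

definition good_samples :: "freqs \<Rightarrow> samples \<Rightarrow> nat \<Rightarrow> bool" where
  "good_samples w D n \<longleftrightarrow> L2_set (\<lambda>c. \<Sum>i<N. noise w D n c (D (L - n, i))) (noise_coords n) \<le> real N * tol"

lemma finite_patches: "n < L \<Longrightarrow> finite (patches H (L - n))"
  using finite_vocab[of "L - n - 1"] finite_set_pmf_Q[of "L - n - 1"] by (auto simp: patches_def)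

lemma finite_noise_coords: "n < L \<Longrightarrow> finite (noise_coords n)"
  using finite_patches by (simp add: noise_coords_def)

text \<open>The kernel between a first patch and a patch at any position is decided by equality of
  the two patches, so \<open>nadaraya_watson\<close> applies with \<open>c = p / 2\<close> and
  \<open>t = tol\<close>. Its bound is
  \<open>(tol + 2 * tol) / (p / 8) = 24 * tol / p \<le> \<epsilon>\<close>.\<close>

lemma accuracy_step:
  assumes n: "n < L"
    and supp: "\<And>i. i < N \<Longrightarrow> D (L - n, i) \<in> set_pmf (sample_pmf H)"
    and freqs: "good_frequencies w (L - n)" and samples: "good_samples w D n"
    and acc: "accurate w D n"
  shows "accurate w D (Suc n)"
  unfolding accurate_def
proof (intro ballI allI impI)
  fix ss k assume ss: "ss \<in> set_pmf (rhm_pmf H)" and k: "k < s ^ (L - Suc n)"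
  let ?l = "L - Suc n"
  let ?x = "\<lambda>i. fst (D (L - n, i))" and ?\<mu> = "patch_at n ss k" and ?\<nu> = "ss ! ?l ! k"
  define pi where "pi i = parse (?x i)" for i
  have pi: "pi i \<in> set_pmf (rhm_pmf H)" "pi i ! L = ?x i" "snd (D (L - n, i)) = label_of (pi i)" if "i < N" for i
    using supp[OF that] parse_eq by (auto simp: sample_pmf_def pi_def)
  have s1: "0 < s ^ ?l" using s_pos by simp
  have first: "first_patch H (L - n) (pi i) = patch_at n (pi i) 0" for i
    by (simp add: first_patch_def patch_at_def)
  \<comment> \<open>Equality of patches, not synonymy: a synonym also has the right posterior, but
    its kernel value is already small, so it is counted with the others.\<close>
  define C where "C = {i. patch_at n (pi i) 0 = ?\<mu>}"
  note mem = patch_at_mem[OF n acc]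
  have \<mu>: "?\<mu> \<in> set_pmf (Q ?l ?\<nu>)" and \<nu>: "?\<nu> \<in> vocab H ?l" using mem[OF ss k] by auto
  have l: "?l < L" "Suc ?l = L - n" using n by auto
  have \<mu>_patch: "?\<mu> \<in> patches H (L - n)" using \<mu> \<nu> l by (auto simp: patches_def)
  have tok: "hd (pi i ! ?l) = pi i ! ?l ! 0" "pi i ! ?l ! 0 \<in> vocab H ?l" if "i < N" for i
    using hd_token[OF valid_rhm[OF pi(1)[OF that]], of ?l] mem(3)[OF pi(1)[OF that] s1] by auto
  have kern: "(\<Sum>j<2 * M. feat w D n (?x i) 0 j * feat w D n (ss ! L) k j)
      = empirical_kernel M (s * V) (L - n) w (diff w D n (pi i) ss 0 k)" if "i < N" for i
    unfolding feat_inner embedding_diff_def using pi(2)[OF that] by simp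
  have close: "\<bar>empirical_kernel M (s * V) (L - n) w (diff w D n (pi i) ss 0 k)
      - rbf (s * V) \<sigma> (diff w D n (pi i) ss 0 k)\<bar> \<le> tol / 2" if "i < N" for i
    using freqs diff_bounded[OF n acc pi(1)[OF that] s1 ss k] unfolding good_frequencies_def by blast
  have "L2_set (\<lambda>r. normalize_sum V (mat_vec (2 * M) (cross_cov w D n) (feat w D n (ss ! L) k)) r
      - ideal (Suc n) ?\<nu> r) {..<V} \<le> (tol + 2 * tol) / (p / 2 / 4)"
  proof (rule nadaraya_watson[where N = N and x = "\<lambda>i. feat w D n (?x i) 0" and C = C
        and y = "\<lambda>i. enc0 (snd (D (L - n, i)))" and Q = "\<lambda>i. posterior n (?x i)"])
    show "enc0 (snd (D (L - n, i))) < V" if "i < N" for i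
      using label_in_vocab[OF valid_rhm[OF pi(1)[OF that]]] enc0 pi(3)[OF that]
      by (auto simp: bij_betw_def)
    show "L2_set (\<lambda>(r, j). \<Sum>i<N. (one_hot (enc0 (snd (D (L - n, i)))) r - posterior n (?x i) r)
        * feat w D n (?x i) 0 j) ({..<V} \<times> {..<2 * M}) \<le> real N * tol"
    proof -
      have "L2_set (\<lambda>(r, j). \<Sum>i<N. (one_hot (enc0 (snd (D (L - n, i)))) r - posterior n (?x i) r)
          * feat w D n (?x i) 0 j) ({..<V} \<times> {..<2 * M})
          = L2_set (\<lambda>c. \<Sum>i<N. noise w D n c (D (L - n, i))) (Inl ` ({..<V} \<times> {..<2 * M}))"
        unfolding L2_set_def by (subst sum.reindex) (use supp in \<open>auto simp: noise_def case_prod_beta\<close>)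
      also have "\<dots> \<le> L2_set (\<lambda>c. \<Sum>i<N. noise w D n c (D (L - n, i))) (noise_coords n)"
        using finite_noise_coords[OF n] by (intro L2_set_mono_subset) (auto simp: noise_coords_def)
      finally show ?thesis using samples by (simp add: good_samples_def)
    qed
    show "(\<Sum>j<2 * M. feat w D n (?x i) 0 j * feat w D n (ss ! L) k j) \<ge> 1 / 2" if "i < N" "i \<in> C" for i
    proof -
      have "rbf (s * V) \<sigma> (diff w D n (pi i) ss 0 k) \<ge> 7 / 8"
        using rbf_same[OF n acc pi(1)[OF that(1)] s1 ss k] that(2) by (simp add: C_def)
      then show ?thesis unfolding kern[OF that(1)] using close[OF that(1)] tol_small(2) by linarith
    qed
    show "posterior n (?x i) r = ideal (Suc n) ?\<nu> r" if "i < N" "i \<in> C" "r < V" for i r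
    proof -
      have "pi i ! ?l ! 0 = ?\<nu>"
        using Q_unique[OF l(1) tok(2)[OF that(1)] \<nu> mem(1)[OF pi(1)[OF that(1)] s1]] \<mu> that(2) by (simp add: C_def)
      then show ?thesis
        using tok(1)[OF that(1)] by (simp add: posterior_def ideal_def pi_def)
    qed
    show "\<bar>\<Sum>j<2 * M. feat w D n (?x i) 0 j * feat w D n (ss ! L) k j\<bar> \<le> tol" if "i < N" "i \<notin> C" for i
    proof -
      have "rbf (s * V) \<sigma> (diff w D n (pi i) ss 0 k) \<ge> 0" by (simp add: rbf_def)
      moreover have "rbf (s * V) \<sigma> (diff w D n (pi i) ss 0 k) \<le> tol / 2"
        using rbf_different[OF n acc pi(1)[OF that(1)] s1 ss k] that(2) by (simp add: C_def)
      ultimately show ?thesis unfolding kern[OF that(1)] using close[OF that(1)] by linarith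
    qed
    show "L2_set (\<lambda>r. posterior n (?x i) r - ideal (Suc n) ?\<nu> r) {..<V} \<le> 2" if "i < N" for i
      using sum_post_dec[OF l(1) \<nu>] sum_post_dec[OF l(1) tok(2)[OF that]] tok(1)[OF that]
      by (intro L2_set_le_2) (auto simp: posterior_def ideal_def post_nonneg pi_def)
    \<comment> \<open>The frequency coordinate of the noise vector gives an empirical frequency of
      at least \<open>p - tol \<ge> p / 2\<close>.\<close>
    show "real (card ({..<N} \<inter> C)) \<ge> p / 2 * N"
    proof -
      have "(\<Sum>i<N. noise w D n (Inr ?\<mu>) (D (L - n, i))) = card ({..<N} \<inter> C) - N * patch_prob H (L - n) ?\<mu>"
      proof -
        have "(\<Sum>i<N. noise w D n (Inr ?\<mu>) (D (L - n, i)))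
            = (\<Sum>i<N. of_bool (i \<in> C) - patch_prob H (L - n) ?\<mu>)"
          by (intro sum.cong) (use supp in \<open>auto simp: noise_def C_def first[unfolded pi_def] pi_def\<close>)
        then show ?thesis by (simp add: sum_subtractf of_bool_def sum.If_cases)
      qed
      moreover have "\<bar>\<Sum>i<N. noise w D n (Inr ?\<mu>) (D (L - n, i))\<bar> \<le> N * tol"
        using abs_le_L2_set[OF finite_noise_coords[OF n], of "Inr ?\<mu>" "\<lambda>c. \<Sum>i<N. noise w D n c (D (L - n, i))"]
          samples \<mu>_patch unfolding good_samples_def noise_coords_def by (auto intro: order_trans)
      moreover have "patch_prob H (L - n) ?\<mu> \<ge> p"
        using patch_prob_eq[OF l(1) \<nu> \<mu>] marg_ge[OF l(1) \<nu>] l(2) by simp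
      then have "N * patch_prob H (L - n) ?\<mu> \<ge> N * p" by (intro mult_left_mono) auto
      moreover have "N * tol \<le> N * (p / 2)" using tol_small p_pos by (intro mult_left_mono) auto
      ultimately show ?thesis by (simp add: abs_le_iff algebra_simps)
    qed
    show "cross_cov w D n r j = (\<Sum>i<N. one_hot (enc0 (snd (D (L - n, i)))) r * feat w D n (?x i) 0 j) / real N"
      if "r < V" "j < 2 * M" for r j
      using that by (simp add: cross_cov_def)
  qed (use N_pos feat_norm p_pos tol_pos tol_small in auto)
  also have "(tol + 2 * tol) / (p / 2 / 4) \<le> \<epsilon>" using tol p_pos by (simp add: field_simps)
  finally show "L2_set (\<lambda>r. emb w D (Suc n) (ss ! L) k r - ideal (Suc n) ?\<nu> r) {..<V} \<le> \<epsilon>"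
    unfolding emb_Suc[OF n] .
qed

lemma accuracy:
  assumes supp: "\<And>n i. n < L \<Longrightarrow> i < N \<Longrightarrow> D (L - n, i) \<in> set_pmf (sample_pmf H)"
    and freqs: "\<And>n. n < L \<Longrightarrow> good_frequencies w (L - n)" and samples: "\<And>n. n < L \<Longrightarrow> good_samples w D n"
  shows "n \<le> L \<Longrightarrow> accurate w D n"
proof (induction n)
  case 0
  then show ?case using \<epsilon> by (simp add: accurate_def emb_0 ideal_def L2_set_def)
next
  case (Suc n)
  then show ?case by (intro accuracy_step supp freqs samples) auto
qed

text \<open>After all stages the target is the posterior at level \<open>0\<close>, which by
  \<open>post_0\<close> is the one-hot label. The label is the strict maximum because
  \<open>\<epsilon> \<le> 1 / 4\<close> gives \<open>1 - \<epsilon> > \<epsilon>\<close>.\<close>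

lemma training_succeeds:
  assumes supp: "\<And>n i. n < L \<Longrightarrow> i < N \<Longrightarrow> D (L - n, i) \<in> set_pmf (sample_pmf H)"
    and freqs: "\<And>n. n < L \<Longrightarrow> good_frequencies w (L - n)" and samples: "\<And>n. n < L \<Longrightarrow> good_samples w D n"
    and \<epsilon>': "\<epsilon> \<le> \<epsilon>'"
  shows "training_succeeds H enc0 encL hp \<epsilon>' (D, w)"
  unfolding training_succeeds_def learns_def Let_def prod.case network_output_eq card_vocab0
proof (intro ballI, clarify, intro conjI allI impI)
  fix x \<zeta> assume "(x, \<zeta>) \<in> set_pmf (sample_pmf H)"
  then obtain ss where ss: "ss \<in> set_pmf (rhm_pmf H)" "x = ss ! L" "\<zeta> = label_of ss"
    by (auto simp: sample_pmf_def)
  have \<zeta>: "\<zeta> \<in> vocab H 0" using label_in_vocab[OF valid_rhm[OF ss(1)]] ss by simp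
  have "ss ! 0 ! 0 = \<zeta>" using hd_token[OF valid_rhm[OF ss(1)], of 0] ss by (simp add: label_of_def)
  moreover have "L2_set (\<lambda>r. emb w D L (ss ! L) 0 r - ideal L (ss ! 0 ! 0) r) {..<V} \<le> \<epsilon>"
    using accuracy[of D w L] assms(1-3) ss(1) by (simp add: accurate_def)
  ultimately have "L2_set (\<lambda>r. emb w D L x 0 r - ideal L \<zeta> r) {..<V} \<le> \<epsilon>" using ss by simp
  also have "L2_set (\<lambda>r. emb w D L x 0 r - ideal L \<zeta> r) {..<V}
      = L2_set (\<lambda>r. emb w D L x 0 r - one_hot (enc0 \<zeta>) r) {..<V}"
    using post_0[OF \<zeta> marg_pos[OF _ \<zeta>]] L_pos \<zeta>
    by (intro L2_set_cong) (auto simp: ideal_def one_hot_enc0 of_bool_def)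
  finally have le: "L2_set (\<lambda>r. emb w D L x 0 r - one_hot (enc0 \<zeta>) r) {..<V} \<le> \<epsilon>" .
  then show "L2_set (\<lambda>r. emb w D L x 0 r - one_hot (enc0 \<zeta>) r) {..<V} \<le> \<epsilon>'" using \<epsilon>' by simp
  fix r assume r: "r < V" "r \<noteq> enc0 \<zeta>"
  have "enc0 \<zeta> < V" using enc0 \<zeta> by (auto simp: bij_betw_def)
  then have "\<bar>emb w D L x 0 (enc0 \<zeta>) - 1\<bar> \<le> \<epsilon>" "\<bar>emb w D L x 0 r\<bar> \<le> \<epsilon>"
    using le r abs_le_L2_set[of "{..<V}" "enc0 \<zeta>" "\<lambda>r. emb w D L x 0 r - one_hot (enc0 \<zeta>) r"]
      abs_le_L2_set[of "{..<V}" r "\<lambda>r. emb w D L x 0 r - one_hot (enc0 \<zeta>) r"]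
    by (auto simp: one_hot_def)
  then show "emb w D L x 0 r < emb w D L x 0 (enc0 \<zeta>)" using \<epsilon> \<tau> by linarith
qed

end

section \<open>Probability of success\<close>

context learner
begin

text \<open>The samples of level \<open>L - n\<close> do not influence the first \<open>n\<close>
  stages. Hence they are fresh for the features of stage \<open>n\<close>, which is the independence
  needed for Hoeffding's inequality.\<close>

lemma weights_cong:
  assumes "\<forall>l\<in>{L - n<..L}. \<forall>i<N. D (l, i) = D' (l, i)"
  shows "n \<le> L \<Longrightarrow> weights w D n = weights w D' n"
  using assms
proof (induction n)
  case (Suc n)
  have IH: "weights w D n = weights w D' n" using Suc by (intro Suc.IH) auto
  have "D (L - n, i) = D' (L - n, i)" if "i < N" for i
    using Suc.prems that by auto
  then show ?case unfolding weights_Suc IH cross_cov_def feat_def emb_def by (auto intro!: ext sum.cong)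
qed simp

lemma feat_cong:
  assumes "\<forall>l\<in>{L - n<..L}. \<forall>i<N. D (l, i) = D' (l, i)" "n \<le> L"
  shows "feat w D n = feat w D' n"
  using weights_cong[OF assms(1,2), of w] by (intro ext) (simp add: feat_def emb_def)

lemma noise_cong:
  assumes "\<forall>l\<in>{L - n<..L}. \<forall>i<N. D (l, i) = D' (l, i)" "n \<le> L"
  shows "noise w D n = noise w D' n"
  unfolding noise_def feat_cong[OF assms] ..

lemma sum_patch_prob_le_1: "finite A \<Longrightarrow> (\<Sum>\<mu>\<in>A. patch_prob H l \<mu>) \<le> 1"
proof -
  assume "finite A"
  then have "(\<Sum>\<mu>\<in>A. patch_prob H l \<mu>) = measure (map_pmf (first_patch H l) (rhm_pmf H)) A"
    by (subst measure_measure_pmf_finite) (simp_all add: patch_prob_def pmf_map vimage_def del: measure_map_pmf)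
  then show ?thesis by simp
qed

text \<open>Frequencies and earlier samples are fixed here. The label coordinates vanish by
  \<open>label_decorrelated\<close>, since the features read only the subtree below the first token;
  the frequency coordinates are centred by definition.\<close>

lemma expectation_noise:
  assumes n: "n < L" and c: "c \<in> noise_coords n"
  shows "measure_pmf.expectation (sample_pmf H) (noise w D n c) = 0"
proof -
  let ?l = "L - Suc n"
  have mem: "(ss ! L, label_of ss) \<in> set_pmf (sample_pmf H)" if "ss \<in> set_pmf (rhm_pmf H)" for ss
    using that by (auto simp: sample_pmf_def)
  have "measure_pmf.expectation (sample_pmf H) (noise w D n c)
      = measure_pmf.expectation (rhm_pmf H) (\<lambda>ss. noise w D n c (ss ! L, label_of ss))"
    by (simp add: sample_pmf_def)
  also have "\<dots> = 0"
  proof (cases c)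
    case (Inl a)
    obtain r j where a: "a = (r, j)" by (cases a)
    have r: "r < V" using c by (auto simp: noise_coords_def Inl a)
    have d: "dec r \<in> vocab H 0" using dec_bij r by (auto simp: bij_betw_def)
    have l: "L - ?l = Suc n" using n by simp
    have "measure_pmf.expectation (rhm_pmf H) (\<lambda>ss. noise w D n c (ss ! L, label_of ss))
        = measure_pmf.expectation (rhm_pmf H) (\<lambda>ss. (of_bool (label_of ss = dec r) - post ?l (hd (ss ! ?l)) (dec r))
            * (\<lambda>_ y. feat w D n y 0 j) (hd (ss ! ?l)) (take (s ^ (L - ?l)) (ss ! L)))"
    proof (intro integral_cong_AE)
      show "AE ss in rhm_pmf H. noise w D n c (ss ! L, label_of ss)
          = (of_bool (label_of ss = dec r) - post ?l (hd (ss ! ?l)) (dec r))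
            * (\<lambda>_ y. feat w D n y 0 j) (hd (ss ! ?l)) (take (s ^ (L - ?l)) (ss ! L))"
      proof (rule AE_pmfI)
        fix ss assume ss: "ss \<in> set_pmf (rhm_pmf H)"
        show "noise w D n c (ss ! L, label_of ss)
          = (of_bool (label_of ss = dec r) - post ?l (hd (ss ! ?l)) (dec r))
            * (\<lambda>_ y. feat w D n y 0 j) (hd (ss ! ?l)) (take (s ^ (L - ?l)) (ss ! L))"
          using mem[OF ss] parse_eq[OF ss] one_hot_enc0[OF label_in_vocab[OF valid_rhm[OF ss]] r]
          unfolding l feat_take[of w D n "ss ! L", symmetric]
          by (simp add: noise_def posterior_def Inl a)
      qed
    qed auto
    also have "\<dots> = 0" by (rule label_decorrelated) (use d in auto)
    finally show ?thesis .
  next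
    case (Inr \<mu>)
    have "measure_pmf.expectation (rhm_pmf H) (\<lambda>ss. noise w D n c (ss ! L, label_of ss))
        = measure_pmf.expectation (rhm_pmf H) (\<lambda>ss. indicator {ss. first_patch H (L - n) ss = \<mu>} ss - patch_prob H (L - n) \<mu>)"
      by (intro integral_cong_AE) (auto simp: noise_def Inr parse_eq mem AE_measure_pmf_iff)
    also have "\<dots> = measure_pmf.expectation (rhm_pmf H) (indicator {ss. first_patch H (L - n) ss = \<mu>}) - patch_prob H (L - n) \<mu>"
      by (subst Bochner_Integration.integral_diff)
        (auto intro!: measure_pmf.integrable_const_bound[where B = 1])
    also have "\<dots> = 0" by (simp add: patch_prob_def)
    finally show ?thesis .
  qed
  finally show ?thesis .
qed

end

context calibrated_learner
begin

text \<open>Feature vectors have norm \<open>1\<close>, so the tensor part has the norm of label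
  minus posterior. Both parts are differences of nonnegative vectors of sum at most
  \<open>1\<close>, hence of norm at most \<open>2\<close>, and
  \<open>2\<^sup>2 + 2\<^sup>2 \<le> 3\<^sup>2\<close>.\<close>

lemma L2_set_noise_le:
  assumes n: "n < L"
  shows "L2_set (\<lambda>c. noise w D n c z) (noise_coords n) \<le> 3"
proof (cases "z \<in> set_pmf (sample_pmf H)")
  case True
  then obtain ss where ss: "ss \<in> set_pmf (rhm_pmf H)" "z = (ss ! L, label_of ss)"
    by (auto simp: sample_pmf_def)
  have v: "valid L ss" using valid_rhm[OF ss(1)] .
  let ?l = "L - Suc n" and ?\<zeta> = "label_of ss" and ?P = "patches H (L - n)"
  have tok: "hd (ss ! ?l) \<in> vocab H ?l"
    using hd_token[OF v, of ?l] token_in_vocab[OF v, of ?l 0] s_pos by simp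
  have fin: "finite ?P" using finite_patches[OF n] .
  define b where "b r = one_hot (enc0 ?\<zeta>) r - posterior n (ss ! L) r" for r
  have \<zeta>: "enc0 ?\<zeta> < V" using label_in_vocab[OF v] enc0 by (auto simp: bij_betw_def)
  have "(\<Sum>c\<in>noise_coords n. (noise w D n c z)\<^sup>2)
      = (\<Sum>(r, j)\<in>{..<V} \<times> {..<2 * M}. (b r * feat w D n (ss ! L) 0 j)\<^sup>2)
        + (\<Sum>\<mu>\<in>?P. (of_bool (first_patch H (L - n) ss = \<mu>) - patch_prob H (L - n) \<mu>)\<^sup>2)"
    unfolding noise_coords_def using True fin
    by (subst sum.Plus) (auto simp: noise_def ss parse_eq b_def case_prod_beta)
  also have "(\<Sum>(r, j)\<in>{..<V} \<times> {..<2 * M}. (b r * feat w D n (ss ! L) 0 j)\<^sup>2) = (L2_set b {..<V})\<^sup>2"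
    unfolding sum.cartesian_product[symmetric] power_mult_distrib sum_distrib_left[symmetric] feat_norm
    by (simp add: L2_set_def sum_nonneg)
  also have "(\<Sum>\<mu>\<in>?P. (of_bool (first_patch H (L - n) ss = \<mu>) - patch_prob H (L - n) \<mu>)\<^sup>2)
      = (L2_set (\<lambda>\<mu>. of_bool (first_patch H (L - n) ss = \<mu>) - patch_prob H (L - n) \<mu>) ?P)\<^sup>2"
    by (simp add: L2_set_def sum_nonneg)
  also have "(L2_set b {..<V})\<^sup>2 + \<dots> \<le> 2\<^sup>2 + 2\<^sup>2"
  proof (intro add_mono power_mono)
    have "posterior n (ss ! L) = (\<lambda>r. post ?l (hd (ss ! ?l)) (dec r))"
      by (simp add: posterior_def[abs_def] parse_eq[OF ss(1)])
    then show "L2_set b {..<V} \<le> 2"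
      unfolding b_def using \<zeta> sum_post_dec[OF _ tok] n
      by (intro L2_set_le_2) (auto simp: one_hot_def post_nonneg)
    show "L2_set (\<lambda>\<mu>. of_bool (first_patch H (L - n) ss = \<mu>) - patch_prob H (L - n) \<mu>) ?P \<le> 2"
    proof (rule L2_set_le_2)
      show "(\<Sum>\<mu>\<in>?P. of_bool (first_patch H (L - n) ss = \<mu>)) \<le> (1 :: real)"
        using fin by (simp add: of_bool_def)
    qed (use sum_patch_prob_le_1[OF fin] in \<open>auto simp: patch_prob_def\<close>)
  qed (auto simp: L2_set_nonneg)
  finally have "(\<Sum>c\<in>noise_coords n. (noise w D n c z)\<^sup>2) \<le> 3\<^sup>2" by simp
  then show ?thesis unfolding L2_set_def by (intro real_le_lsqrt) (auto simp: sum_nonneg)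
qed (simp add: noise_def L2_set_def)

section \<open>The training measure and measurability of the events\<close>

definition "sample_index = {1..L} \<times> {..<N}"
definition "freq_index = {1..L} \<times> {..<M} \<times> {..<s * V}"
abbreviation "PD \<equiv> PiM sample_index (\<lambda>_. measure_pmf (sample_pmf H))"
abbreviation "PW \<equiv> PiM freq_index (\<lambda>_. density lborel (normal_density 0 (1 / \<sigma>)))"

abbreviation "PT \<equiv> PD \<Otimes>\<^sub>M PW"

lemma training_measure_eq: "training_measure H hp = PT"
proof -
  have "(\<lambda>(l, i). c) = (\<lambda>_ :: nat \<times> nat. c)" "(\<lambda>(l, j, r). c') = (\<lambda>_ :: nat \<times> nat \<times> nat. c')"
    for c :: "(nat list \<times> nat) measure" and c' :: "real measure"
    by auto
  then show ?thesis by (simp add: training_measure_def card_vocab0 sample_index_def freq_index_def)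
qed

lemma finite_sample_index: "finite sample_index" and finite_freq_index: "finite freq_index"
  by (auto simp: sample_index_def freq_index_def)

lemma prob_space_PD: "prob_space PD"
  by (intro prob_space_PiM prob_space_measure_pmf)

lemma prob_space_PW: "prob_space PW"
  using \<sigma>_pos by (intro prob_space_PiM prob_space_normal_density) simp

lemma prob_space_training: "prob_space PT"
  by (intro prob_space_pair prob_space_PD prob_space_PW)

lemma sets_PD: "sets PD = sets (count_space (PiE sample_index (\<lambda>_. UNIV)))"
proof -
  have "sets PD = sets (PiM sample_index (\<lambda>_. count_space UNIV))" by (intro sets_PiM_cong) auto
  also have "PiM sample_index (\<lambda>_. count_space UNIV :: (nat list \<times> nat) measure) = count_space (PiE sample_index (\<lambda>_. UNIV))"
    using finite_sample_index by (intro count_space_PiM_finite) auto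
  finally show ?thesis .
qed

text \<open>There are only countably many training sets: finitely many samples, each from a
  countable type. Measurability in the frequencies for each fixed training set is therefore
  enough.\<close>

lemma pred_pair:
  assumes "\<And>D. Measurable.pred PW (\<lambda>w. P (D, w))"
  shows "Measurable.pred PT P"
proof -
  have "Measurable.pred (count_space (PiE sample_index (\<lambda>_. UNIV)) \<Otimes>\<^sub>M PW) P"
    using assms finite_sample_index by (intro measurable_pair_measure_countable1 countable_PiE) auto
  then show ?thesis
    by (subst measurable_cong_sets[OF sets_pair_measure_cong[OF sets_PD refl] refl])
qed

text \<open>Outside \<open>freq_index\<close> the coordinate is the constant
  \<open>undefined\<close>. Covering this case spares the later measurability proofs all index
  bounds.\<close>

lemma measurable_frequency [measurable]: "(\<lambda>w. w i) \<in> borel_measurable PW"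
proof (cases "i \<in> freq_index")
  case True
  then show ?thesis
    using measurable_component_singleton[of i freq_index "\<lambda>_. density lborel (normal_density 0 (1 / \<sigma>))"] by simp
next
  case False
  then have "(\<lambda>w. w i) \<in> borel_measurable PW \<longleftrightarrow> (\<lambda>w. undefined :: real) \<in> borel_measurable PW"
    by (intro measurable_cong) (auto simp: space_PiM PiE_def extensional_def simp del: split_paired_All)
  then show ?thesis by simp
qed

lemma measurable_rff:
  assumes [measurable]: "\<And>r. (\<lambda>w. h w r) \<in> borel_measurable PW"
  shows "(\<lambda>w. rff M n (\<lambda>j r. w (l, j, r)) (h w) i) \<in> borel_measurable PW"
  unfolding rff_def Let_def by (cases "even i") simp_all

lemma measurable_feat_of_emb:
  assumes "\<And>x k r. (\<lambda>w. emb w D n x k r) \<in> borel_measurable PW"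
  shows "(\<lambda>w. feat w D n x k j) \<in> borel_measurable PW"
  unfolding feat_def concat_patch_def by (intro measurable_rff assms)

lemma measurable_emb: "n \<le> L \<Longrightarrow> (\<lambda>w. emb w D n x k r) \<in> borel_measurable PW"
proof (induction n arbitrary: x k r)
  case (Suc n)
  then have [measurable]: "(\<lambda>w. feat w D n x k j) \<in> borel_measurable PW" for x k j
    by (intro measurable_feat_of_emb) auto
  have [measurable]: "(\<lambda>w. cross_cov w D n r j) \<in> borel_measurable PW" for r j
    unfolding cross_cov_def by simp
  show ?case
    using Suc.prems unfolding normalize_sum_def mat_vec_def by (simp add: emb_Suc normalize_sum_def mat_vec_def)
qed (simp add: emb_0)

lemma measurable_feat: "n \<le> L \<Longrightarrow> (\<lambda>w. feat w D n x k j) \<in> borel_measurable PW"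
  by (intro measurable_feat_of_emb measurable_emb)

lemma pred_good_samples:
  assumes n: "n < L"
  shows "Measurable.pred PW (\<lambda>w. good_samples w D n)"
proof -
  have [measurable]: "(\<lambda>w. feat w D n x k j) \<in> borel_measurable PW" for x k j
    using n by (intro measurable_feat) auto
  have [measurable]: "(\<lambda>w. noise w D n c z) \<in> borel_measurable PW" for c z
    unfolding noise_def by (cases "z \<in> set_pmf (sample_pmf H)"; cases c) (auto split: prod.split)
  show ?thesis unfolding good_samples_def L2_set_def by measurable
qed

lemma pred_training_succeeds: "Measurable.pred PT (training_succeeds H enc0 encL hp e)"
proof (rule pred_pair)
  fix D
  have [measurable]: "(\<lambda>w. emb w D L x k r) \<in> borel_measurable PW" for x k r
    by (rule measurable_emb) simp
  have "countable (set_pmf (sample_pmf H))" by (rule countable_set_pmf)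
  then show "Measurable.pred PW (\<lambda>w. training_succeeds H enc0 encL hp e (D, w))"
    unfolding training_succeeds_def learns_def Let_def prod.case network_output_eq card_vocab0 case_prod_beta
    by (intro pred_intros_countable_bounded) (auto simp: L2_set_def)
qed

text \<open>By Fubini the samples of level \<open>L - n\<close> are integrated innermost. With the
  others fixed the summands are independent, centred and of norm at most \<open>3\<close>, and the
  exponent is \<open>(N * tol)\<^sup>2 / (2 * N * 9)\<close>.\<close>

lemma emeasure_bad_samples:
  assumes n: "n < L"
  shows "emeasure PD {D \<in> space PD. \<not> good_samples w D n} \<le> ennreal (2 * exp (- (N * tol\<^sup>2 / 18)))"
proof -
  define A where "A = {L - n} \<times> {..<N}"
  have A: "A \<subseteq> sample_index" "finite A" "card A = N" "A \<noteq> {}" using n N_pos by (auto simp: A_def sample_index_def)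
  have un: "(sample_index - A) \<union> A = sample_index" using A by auto
  interpret product_sigma_finite "\<lambda>_. measure_pmf (sample_pmf H)"
    by (intro product_sigma_finite.intro prob_space_imp_sigma_finite prob_space_measure_pmf)
  let ?P = "\<lambda>K. PiM K (\<lambda>_. measure_pmf (sample_pmf H))"
  let ?B = "{D \<in> space PD. \<not> good_samples w D n}"
  have B: "?B \<in> sets PD"
    unfolding sets_PD by (auto simp: space_PiM)
  have "emeasure PD ?B = (\<integral>\<^sup>+D. indicator ?B D \<partial>PD)" using B by simp
  also have "\<dots> = (\<integral>\<^sup>+x. (\<integral>\<^sup>+y. indicator ?B (merge (sample_index - A) A (x, y)) \<partial>?P A) \<partial>?P (sample_index - A))"
    using product_nn_integral_fold[of "sample_index - A" A "indicator ?B"] A B finite_sample_index Int_Diff_disjoint[of A sample_index]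
    unfolding un by (simp add: Int_commute)
  also have "\<dots> \<le> (\<integral>\<^sup>+x. ennreal (2 * exp (- (N * tol\<^sup>2 / 18))) \<partial>?P (sample_index - A))"
  proof (rule nn_integral_mono)
    fix x assume x: "x \<in> space (?P (sample_index - A))"
    define E where "E = {y \<in> space (?P A). L2_set (\<lambda>c. \<Sum>i\<in>A. noise w x n c (y i)) (noise_coords n) \<ge> N * tol}"
    have "indicator ?B (merge (sample_index - A) A (x, y)) \<le> (indicator E y :: ennreal)" if y: "y \<in> space (?P A)" for y
    proof -
      let ?D = "merge (sample_index - A) A (x, y)"
      \<comment> \<open>The noise function of stage \<open>n\<close> depends only on samples of
        levels above \<open>L - n\<close>, and these are all contained in \<open>x\<close>.\<close>
      have "noise w ?D n = noise w x n"
        using n by (intro noise_cong) (auto simp: merge_def A_def sample_index_def)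
      moreover have "?D (L - n, i) = y (L - n, i)" if "i < N" for i
        using that by (auto simp: merge_def A_def)
      moreover have "(\<Sum>i\<in>A. f i) = (\<Sum>i<N. f (L - n, i))" for f :: "_ \<Rightarrow> real"
      proof -
        have "A = Pair (L - n) ` {..<N}" by (auto simp: A_def)
        then show ?thesis by (simp add: sum.reindex inj_on_def)
      qed
      ultimately show ?thesis
        using y by (auto simp: good_samples_def E_def split: split_indicator)
    qed
    then have "(\<integral>\<^sup>+y. indicator ?B (merge (sample_index - A) A (x, y)) \<partial>?P A) \<le> (\<integral>\<^sup>+y. indicator E y \<partial>?P A)"
      by (intro nn_integral_mono)
    also have "\<dots> = emeasure (?P A) E"
    proof -
      have "(\<lambda>y. noise w x n c (y i)) \<in> borel_measurable (?P A)" if "i \<in> A" for c i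
        by (rule measurable_compose[OF measurable_component_singleton[OF that]]) simp
      then have "(\<lambda>y. L2_set (\<lambda>c. \<Sum>i\<in>A. noise w x n c (y i)) (noise_coords n)) \<in> borel_measurable (?P A)"
        unfolding L2_set_def
        by (intro measurable_compose[OF _ borel_measurable_sqrt] borel_measurable_sum borel_measurable_power)
      then have "E \<in> sets (?P A)" unfolding E_def by (intro borel_measurable_le) simp_all
      then show ?thesis by simp
    qed
    also have "\<dots> \<le> ennreal (2 * exp (- (N * tol)\<^sup>2 / (2 * real (card A) * 3\<^sup>2)))"
      unfolding E_def
    proof (rule vector_Hoeffding)
      show "finite (noise_coords n)" using finite_noise_coords[OF n] .
    qed (use A L2_set_noise_le[OF n] expectation_noise[OF n] tol_pos in \<open>auto intro: prob_space_measure_pmf\<close>)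
    also have "- (N * tol)\<^sup>2 / (2 * real (card A) * 3\<^sup>2) = - (N * tol\<^sup>2 / 18)"
      using N_pos A by (simp add: power2_eq_square)
    finally show "(\<integral>\<^sup>+y. indicator ?B (merge (sample_index - A) A (x, y)) \<partial>?P A) \<le> ennreal (2 * exp (- (N * tol\<^sup>2 / 18)))" .
  qed
  also have "\<dots> = ennreal (2 * exp (- (N * tol\<^sup>2 / 18)))"
  proof -
    interpret P: prob_space "?P (sample_index - A)" by (intro prob_space_PiM prob_space_measure_pmf)
    show ?thesis by (simp add: P.emeasure_space_1)
  qed
  finally show ?thesis .
qed

text \<open>A union bound with one frequency event and one sample event per level. The frequency
  events do not involve the samples; the sample bound holds for every fixed \<open>w\<close> and is
  then integrated over \<open>w\<close>.\<close>

theorem prob_training_succeeds: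
  fixes mesh \<rho> \<beta> :: real
  assumes \<epsilon>': "\<epsilon> \<le> \<epsilon>'" and mesh: "mesh > 0" and \<rho>: "\<rho> \<ge> real (s * V) / \<sigma>" "mesh * \<rho> \<le> tol / 8"
    and freq: "real (s * V) / (\<sigma> * \<rho>) + (2 * of_int \<lceil>4 / mesh\<rceil> + 1) ^ (s * V) * (2 * exp (- (real M * (tol / 2)\<^sup>2 / 8))) \<le> \<beta>"
    and samp: "2 * exp (- (N * tol\<^sup>2 / 18)) \<le> \<beta>"
  shows "\<P>(\<theta> in training_measure H hp. training_succeeds H enc0 encL hp \<epsilon>' \<theta>) \<ge> 1 - 2 * real L * \<beta>"
proof -
  interpret T: prob_space PT by (rule prob_space_training)
  interpret D: prob_space PD by (rule prob_space_PD)
  interpret W: prob_space PW by (rule prob_space_PW)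
  interpret DW: pair_prob_space PD PW ..
  have "\<exists>B. B \<in> sets PW \<and> W.prob B \<le> \<beta> \<and> (\<forall>w\<in>space PW - B. good_frequencies w l)" if l: "l \<in> {1..L}" for l
  proof -
    interpret G: gaussian_frequencies freq_index \<sigma> l M "s * V"
      using l M_pos \<sigma>_pos s_pos V_pos finite_freq_index by unfold_locales (auto simp: freq_index_def)
    obtain B where B: "B \<in> sets PW"
      "W.prob B \<le> real (s * V) / (\<sigma> * \<rho>) + (2 * of_int \<lceil>4 / mesh\<rceil> + 1) ^ (s * V) * (2 * exp (- (real M * (tol / 2)\<^sup>2 / 8)))"
      "\<And>w u. w \<in> space PW - B \<Longrightarrow> (\<And>r. r < s * V \<Longrightarrow> \<bar>u r\<bar> \<le> 4) \<Longrightarrow>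
       \<bar>empirical_kernel M (s * V) l w u - rbf (s * V) \<sigma> u\<bar> \<le> tol / 2"
      using G.uniform_kernel_approximation[of "tol / 2" mesh \<rho> 4] mesh \<rho> tol_pos by auto
    then show ?thesis using freq by (intro exI[of _ B]) (auto simp: good_frequencies_def)
  qed
  then obtain B where B: "\<And>l. l \<in> {1..L} \<Longrightarrow> B l \<in> sets PW" "\<And>l. l \<in> {1..L} \<Longrightarrow> W.prob (B l) \<le> \<beta>"
    "\<And>l w. l \<in> {1..L} \<Longrightarrow> w \<in> space PW - B l \<Longrightarrow> good_frequencies w l"
    by metis
  define E1 where "E1 l = space PD \<times> B l" for l
  define E2 where "E2 n = {\<theta> \<in> space PT. \<not> good_samples (snd \<theta>) (fst \<theta>) n}" for n
  \<comment> \<open>A null event, needed because accuracy is proved pointwise for training sets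
    inside the support.\<close>
  define E3 where "E3 = {D \<in> space PD. \<not> (\<forall>i\<in>sample_index. D i \<in> set_pmf (sample_pmf H))} \<times> space PW"
  have prob_times: "T.prob (A \<times> B) = D.prob A * W.prob B" if "A \<in> sets PD" "B \<in> sets PW" for A B
    using W.emeasure_pair_measure_Times[OF that]
    by (simp add: T.emeasure_eq_measure D.emeasure_eq_measure W.emeasure_eq_measure ennreal_mult[symmetric])
  have E1: "E1 l \<in> sets PT" "T.prob (E1 l) \<le> \<beta>" if "l \<in> {1..L}" for l
    using B(1,2)[OF that] by (auto simp: E1_def prob_times D.prob_space)
  have E2: "E2 n \<in> sets PT" "T.prob (E2 n) \<le> \<beta>" if n: "n < L" for n
  proof -
    have "Measurable.pred PT (\<lambda>\<theta>. \<not> good_samples (snd \<theta>) (fst \<theta>) n)"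
      using pred_good_samples[OF n] by (intro pred_pair) simp
    then show s: "E2 n \<in> sets PT" unfolding E2_def by measurable
    have "emeasure PT (E2 n) = (\<integral>\<^sup>+w. emeasure PD ((\<lambda>D. (D, w)) -` E2 n) \<partial>PW)"
      by (rule DW.emeasure_pair_measure_alt2[OF s])
    also have "\<dots> \<le> (\<integral>\<^sup>+w. ennreal \<beta> \<partial>PW)"
    proof (rule nn_integral_mono)
      fix w assume w: "w \<in> space PW"
      then have "(\<lambda>D. (D, w)) -` E2 n = {D \<in> space PD. \<not> good_samples w D n}"
        by (auto simp: E2_def space_pair_measure)
      then show "emeasure PD ((\<lambda>D. (D, w)) -` E2 n) \<le> ennreal \<beta>"
        using order_trans[OF emeasure_bad_samples[OF n, of w] ennreal_leI[OF samp]] by simp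
    qed
    also have "\<dots> = ennreal \<beta>" by (simp add: W.emeasure_space_1)
    finally show "T.prob (E2 n) \<le> \<beta>"
      using order_trans[OF _ samp, of 0] by (simp add: T.emeasure_eq_measure)
  qed
  have E3: "E3 \<in> sets PT" "T.prob E3 = 0"
  proof -
    let ?A = "{D \<in> space PD. \<not> (\<forall>i\<in>sample_index. D i \<in> set_pmf (sample_pmf H))}"
    have A: "?A \<in> sets PD" unfolding sets_PD by (auto simp: space_PiM)
    then show "E3 \<in> sets PT" by (auto simp: E3_def)
    have "AE D in PD. \<forall>i\<in>sample_index. D i \<in> set_pmf (sample_pmf H)"
      using finite_sample_index
      by (intro AE_finite_allI AE_PiM_component) (auto simp: prob_space_measure_pmf AE_measure_pmf)
    then have "D.prob ?A = 0" using A by (subst D.prob_eq_0) (auto simp: eventually_mono)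
    then show "T.prob E3 = 0" using A by (simp add: E3_def prob_times)
  qed
  define E where "E = (\<Union>l\<in>{1..L}. E1 l) \<union> (\<Union>n\<in>{..<L}. E2 n) \<union> E3"
  have E: "E \<in> sets PT" unfolding E_def using E1(1) E2(1) E3(1) by auto
  have "T.prob E \<le> (T.prob (\<Union>l\<in>{1..L}. E1 l) + T.prob (\<Union>n\<in>{..<L}. E2 n)) + T.prob E3"
    unfolding E_def using E1(1) E2(1) E3(1)
    by (intro order_trans[OF measure_Un_le] add_mono order_refl measure_Un_le sets.Un sets.finite_UN) auto
  also have "T.prob (\<Union>l\<in>{1..L}. E1 l) \<le> (\<Sum>l\<in>{1..L}. T.prob (E1 l))"
    using E1(1) by (intro T.finite_measure_subadditive_finite) auto
  also have "\<dots> \<le> (\<Sum>l\<in>{1..L}. \<beta>)" by (intro sum_mono E1(2))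
  also have "T.prob (\<Union>n\<in>{..<L}. E2 n) \<le> (\<Sum>n<L. T.prob (E2 n))"
    using E2(1) by (intro T.finite_measure_subadditive_finite) auto
  also have "\<dots> \<le> (\<Sum>n<L. \<beta>)" by (intro sum_mono E2(2)) auto
  finally have PE: "T.prob E \<le> 2 * real L * \<beta>" using E3(2) by (simp add: mult_ac)
  have "space PT - E \<subseteq> {\<theta> \<in> space PT. training_succeeds H enc0 encL hp \<epsilon>' \<theta>}"
  proof
    fix \<theta> assume \<theta>: "\<theta> \<in> space PT - E"
    obtain D w where Dw: "\<theta> = (D, w)" by (cases \<theta>)
    have sp: "D \<in> space PD" "w \<in> space PW" using \<theta> by (auto simp: Dw space_pair_measure)
    have "training_succeeds H enc0 encL hp \<epsilon>' (D, w)"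
    proof (rule training_succeeds[OF _ _ _ \<epsilon>'])
      show "D (L - n, i) \<in> set_pmf (sample_pmf H)" if "n < L" "i < N" for n i
      proof -
        have "(L - n, i) \<in> sample_index" using that by (auto simp: sample_index_def)
        then show ?thesis using \<theta> sp by (auto simp: Dw E_def E3_def)
      qed
      show "good_frequencies w (L - n)" if "n < L" for n
      proof -
        have l: "L - n \<in> {1..L}" using that by auto
        then have "w \<notin> B (L - n)" using \<theta> sp unfolding Dw E_def E1_def by blast
        then show ?thesis using B(3)[OF l] sp by auto
      qed
      show "good_samples w D n" if "n < L" for n
        using \<theta> that by (auto simp: Dw E_def E2_def)
    qed
    then show "\<theta> \<in> {\<theta> \<in> space PT. training_succeeds H enc0 encL hp \<epsilon>' \<theta>}" using \<theta> Dw by simp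
  qed
  then have "T.prob (space PT - E) \<le> \<P>(\<theta> in PT. training_succeeds H enc0 encL hp \<epsilon>' \<theta>)"
    using pred_training_succeeds by (intro T.finite_measure_mono) auto
  then show ?thesis
    using PE T.prob_compl[OF E] by (simp add: training_measure_eq mult_ac)
qed

end

section \<open>Choice of the parameters\<close>

lemma L2_set_nth: "L2_set (\<lambda>i. z ! i) {..<length z} = sqrt (\<Sum>x\<leftarrow>z. x\<^sup>2)"
  by (simp add: L2_set_def sum_list_sum_nth atLeast0LessThan)

lemma poly_bound_ge_power:
  assumes "L2_set (\<lambda>i. z ! i) {..<length z} \<ge> 1" "real k \<le> C"
  shows "L2_set (\<lambda>i. z ! i) {..<length z} ^ k \<le> poly_bound C z"
proof -
  let ?Z = "L2_set (\<lambda>i. z ! i) {..<length z}"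
  have "?Z ^ k = ?Z powr real k" using assms by (simp add: powr_realpow)
  also have "\<dots> \<le> ?Z powr C" using assms by (intro powr_mono) auto
  finally show ?thesis by (simp add: poly_bound_def)
qed

section \<open>Absorbing constants, sums and products into powers of one base\<close>

context
  fixes Z :: real
  assumes Z: "Z \<ge> 2"
begin

lemma power_bound_mult: "a \<le> Z ^ i \<Longrightarrow> b \<le> Z ^ j \<Longrightarrow> 0 \<le> b \<Longrightarrow> a * b \<le> Z ^ (i + j)"
  unfolding power_add using Z by (intro mult_mono) auto

lemma power_bound_add: "a \<le> Z ^ i \<Longrightarrow> b \<le> Z ^ i \<Longrightarrow> a + b \<le> Z ^ Suc i"
proof -
  assume "a \<le> Z ^ i" "b \<le> Z ^ i"
  then have "a + b \<le> 2 * Z ^ i" by simp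
  also have "\<dots> \<le> Z * Z ^ i" using Z by (intro mult_right_mono) auto
  finally show ?thesis by simp
qed

lemma power_bound_const: "c \<le> 2 ^ k \<Longrightarrow> c \<le> Z ^ k"
  using power_mono[OF Z, of k] by linarith

lemma small_power_bounds: "2 \<le> Z ^ 1" "4 \<le> Z ^ 2" "6 \<le> Z ^ 3" "8 \<le> Z ^ 3" "36 \<le> Z ^ 6" "64 \<le> Z ^ 6"
    "352 \<le> Z ^ 9" "Z \<le> Z ^ 1"
  using Z by (auto intro!: power_bound_const)

lemma power_bound_weaken: "a \<le> Z ^ i \<Longrightarrow> i \<le> j \<Longrightarrow> a \<le> Z ^ j"
  using power_increasing[of i j Z] Z by linarith

lemma power_bound_pow: "a \<le> Z ^ i \<Longrightarrow> 0 \<le> a \<Longrightarrow> a ^ k \<le> Z ^ (i * k)"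
  unfolding power_mult by (rule power_mono)

end

lemma ceiling_count_bound: "mesh > 0 \<Longrightarrow> mesh \<le> 1 \<Longrightarrow> 2 * of_int \<lceil>4 / mesh\<rceil> + 1 \<le> 11 / mesh" for mesh :: real
proof -
  assume mesh: "mesh > 0" "mesh \<le> 1"
  have "2 * of_int \<lceil>4 / mesh\<rceil> + 1 \<le> 2 * (4 / mesh + 1) + (1::real)"
    by (intro add_right_mono mult_left_mono of_int_ceiling_le_add_one) simp
  also have "\<dots> = 8 / mesh + 3" by simp
  also have "3 \<le> 3 / mesh" using mesh by (simp add: pos_le_divide_eq)
  finally show ?thesis by simp
qed

lemma le_exp: "x \<le> exp x" for x :: real
  using exp_ge_add_one_self[of x] by linarith

section \<open>Patch probabilities and separation from the two hypotheses\<close>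

context cfg_model
begin

lemma card_patches:
  assumes n: "n < L"
  shows "card (patches H (Suc n)) \<le> V * m" "patches H (Suc n) \<noteq> {}" "finite (patches H (Suc n))"
proof -
  have P: "patches H (Suc n) = (\<Union>\<nu>\<in>vocab H n. set_pmf (Q n \<nu>))" by (simp add: patches_def)
  have fin: "finite (vocab H n)" using n by (intro finite_vocab) auto
  have "card (patches H (Suc n)) \<le> (\<Sum>\<nu>\<in>vocab H n. card (set_pmf (Q n \<nu>)))"
    unfolding P by (rule card_UN_le[OF fin])
  also have "\<dots> = V * m" using n card_vocab[of n] rules(3) set_pmf_Q by simp
  finally show "card (patches H (Suc n)) \<le> V * m" .
  have "vocab H n \<noteq> {}" using V_pos card_vocab[of n] n by auto
  then show "patches H (Suc n) \<noteq> {}" unfolding P by (simp add: set_pmf_not_empty)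
  show "finite (patches H (Suc n))" unfolding P using fin n by (auto intro: finite_set_pmf_Q)
qed

lemma marg_lower_bound:
  assumes nd: "non_degenerate H \<kappa>" and \<kappa>: "\<kappa> > 0" and n: "n < L" and \<nu>: "\<nu> \<in> vocab H n"
  shows "marg n \<nu> / m \<ge> 1 / (\<kappa> * V * m)"
proof -
  obtain \<mu> where \<mu>: "\<mu> \<in> set_pmf (Q n \<nu>)" using set_pmf_not_empty[of "Q n \<nu>"] by auto
  then have "\<mu> \<in> patches H (Suc n)" using \<nu> by (auto simp: patches_def)
  then have "1 / (\<kappa> * card (patches H (Suc n))) \<le> patch_prob H (Suc n) \<mu>"
    using nd n unfolding non_degenerate_def by auto
  moreover have "1 / (\<kappa> * V * m) \<le> 1 / (\<kappa> * card (patches H (Suc n)))"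
  proof -
    have "real (card (patches H (Suc n))) \<le> real (V * m)" using card_patches(1)[OF n] by (rule of_nat_mono)
    moreover have "card (patches H (Suc n)) > 0" using card_patches[OF n] by (simp add: card_gt_0_iff)
    ultimately show ?thesis
      using \<kappa> V_pos m_pos unfolding mult.assoc by (intro divide_left_mono mult_left_mono) auto
  qed
  ultimately show ?thesis using patch_prob_eq[OF n \<nu> \<mu>] by simp
qed

text \<open>By non-ambiguity, patches produced by different tokens are never synonyms, so the signal
  condition transfers from patches to their parents.\<close>

lemma posterior_distance:
  assumes ns: "nontrivial_signal H m K" and n: "n < L"
    and \<nu>: "\<nu> \<in> vocab H n" "\<nu>' \<in> vocab H n" "\<nu> \<noteq> \<nu>'"
  shows "L2_set (\<lambda>\<zeta>. post n \<nu> \<zeta> - post n \<nu>' \<zeta>) (vocab H 0) \<ge> K * real m powr (- (real (Suc n) / 2))"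
proof -
  obtain \<mu> where \<mu>: "\<mu> \<in> set_pmf (Q n \<nu>)" using set_pmf_not_empty[of "Q n \<nu>"] by auto
  obtain \<mu>' where \<mu>': "\<mu>' \<in> set_pmf (Q n \<nu>')" using set_pmf_not_empty[of "Q n \<nu>'"] by auto
  have "\<mu> \<in> patches H (Suc n)" "\<mu>' \<in> patches H (Suc n)" using \<nu> \<mu> \<mu>' by (auto simp: patches_def)
  moreover have "\<not> synonyms H (Suc n) \<mu> \<mu>'"
  proof
    assume "synonyms H (Suc n) \<mu> \<mu>'"
    then obtain \<nu>'' where \<nu>'': "\<nu>'' \<in> vocab H n" "\<mu> \<in> set_pmf (Q n \<nu>'')" "\<mu>' \<in> set_pmf (Q n \<nu>'')"
      by (auto simp: synonyms_def)
    then show False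
      using Q_unique[OF n \<nu>(1) \<nu>''(1) \<mu> \<nu>''(2)] Q_unique[OF n \<nu>(2) \<nu>''(1) \<mu>' \<nu>''(3)] \<nu>(3) by simp
  qed
  ultimately have "L2_set (\<lambda>\<zeta>. label_posterior H (Suc n) \<mu> \<zeta> - label_posterior H (Suc n) \<mu>' \<zeta>) (vocab H 0)
      \<ge> K * real m powr (- (real (Suc n) / 2))"
    using ns[unfolded nontrivial_signal_def, rule_format, of "Suc n" \<mu> \<mu>'] n
    by (simp del: of_nat_Suc)
  then show ?thesis by (simp add: label_posterior_eq[OF n \<nu>(1) \<mu>] label_posterior_eq[OF n \<nu>(2) \<mu>'])
qed

text \<open>The second bound, from the rationality of the posteriors, keeps the logarithm of the inverse
  separation polynomial in \<open>V\<close>, \<open>m\<close> and \<open>L\<close> however small \<open>K\<close> is.\<close>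

definition separation :: "real \<Rightarrow> real" where
  "separation K = max (K * real m powr (- (real L / 2))) (1 / (real V * real m ^ L)\<^sup>2) / 2"

context
  fixes \<kappa> K :: real
  assumes \<kappa>: "\<kappa> > 0" and K: "K > 0" and V1: "V = 1 \<longrightarrow> K \<le> 1"
    and nd: "non_degenerate H \<kappa>" and ns: "nontrivial_signal H m K"
begin

lemma marg_gt_0: "n < L \<Longrightarrow> \<nu> \<in> vocab H n \<Longrightarrow> marg n \<nu> > 0"
proof -
  assume a: "n < L" "\<nu> \<in> vocab H n"
  have "0 < 1 / (\<kappa> * V * m)" using \<kappa> V_pos m_pos by simp
  also have "\<dots> \<le> marg n \<nu> / m" by (rule marg_lower_bound[OF nd \<kappa> a])
  finally show ?thesis using m_pos by (simp add: zero_less_divide_iff)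
qed

lemma K_powr_le:
  assumes "n < L"
  shows "K * real m powr (- (real L / 2)) \<le> K * real m powr (- (real (Suc n) / 2))"
  using assms m_pos K by (intro mult_left_mono powr_mono) auto

text \<open>Both entries of the maximum in \<open>separation\<close> are lower bounds: the signal at
  level \<open>Suc n \<le> L\<close>, and \<open>post_gap\<close> at one coordinate where the
  posteriors differ. The halving in \<open>separation\<close> serves to keep it at most
  \<open>1\<close>.\<close>

lemma separated:
  assumes n: "n < L" and \<nu>: "\<nu> \<in> vocab H n" "\<nu>' \<in> vocab H n" "\<nu> \<noteq> \<nu>'"
  shows "L2_set (\<lambda>\<zeta>. post n \<nu> \<zeta> - post n \<nu>' \<zeta>) (vocab H 0) \<ge> 2 * separation K"
proof -
  let ?d = "L2_set (\<lambda>\<zeta>. post n \<nu> \<zeta> - post n \<nu>' \<zeta>) (vocab H 0)"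
  note pd = posterior_distance[OF ns n \<nu>]
  have "K * real m powr (- (real (Suc n) / 2)) > 0" using K m_pos by simp
  then have "?d > 0" using pd by linarith
  then have "\<exists>\<zeta>\<in>vocab H 0. post n \<nu> \<zeta> \<noteq> post n \<nu>' \<zeta>"
    by (rule contrapos_pp) (simp add: L2_set_def)
  then obtain \<zeta> where \<zeta>: "\<zeta> \<in> vocab H 0" "post n \<nu> \<zeta> \<noteq> post n \<nu>' \<zeta>" by blast
  have "1 / (real V * real m ^ L)\<^sup>2 \<le> 1 / (real V * real m ^ n)\<^sup>2"
    using V_pos m_pos n by (intro divide_left_mono power_mono mult_left_mono power_increasing) auto
  also have "\<dots> \<le> \<bar>post n \<nu> \<zeta> - post n \<nu>' \<zeta>\<bar>"
    using n \<nu> \<zeta> by (intro post_gap marg_gt_0) auto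
  also have "\<dots> \<le> ?d" using \<zeta>(1) finite_vocab[of 0] by (intro abs_le_L2_set) auto
  finally have "max (K * real m powr (- (real L / 2))) (1 / (real V * real m ^ L)\<^sup>2) \<le> ?d"
    using order_trans[OF K_powr_le[OF n] pd] by (rule max.boundedI[rotated])
  then show ?thesis unfolding separation_def field_sum_of_halves mult_2 .
qed

lemma separation_pos: "separation K > 0"
proof -
  have "0 < K * real m powr (- (real L / 2))" using K m_pos by simp
  then have "0 < max (K * real m powr (- (real L / 2))) (1 / (real V * real m ^ L)\<^sup>2)"
    by (rule less_le_trans[OF _ max.cobounded1])
  then show ?thesis unfolding separation_def by (rule half_gt_zero)
qed

text \<open>Two label posteriors are at distance at most \<open>2\<close>, which bounds the signal
  as soon as there are two symbols. With a single symbol there are no non-synonyms and the signal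
  condition is vacuous, hence the assumption on \<open>K\<close> for \<open>V = 1\<close>.\<close>

lemma separation_le_1: "separation K \<le> 1"
proof -
  have "1 / (real V * real m ^ L)\<^sup>2 \<le> 2"
  proof -
    have "1 \<le> real V * real m ^ L" using V_pos m_pos mult_mono[of 1 "real V" 1 "real m ^ L"] by simp
    then have "1 \<le> (real V * real m ^ L)\<^sup>2" by (rule one_le_power)
    then have "1 / (real V * real m ^ L)\<^sup>2 \<le> 1 / 1" using V_pos m_pos by (intro divide_left_mono) auto
    then show ?thesis by simp
  qed
  moreover have "K * real m powr (- (real L / 2)) \<le> 2"
  proof (cases "V = 1")
    case True
    have "real m powr (- (real L / 2)) \<le> 1" using powr_mono[of "- (real L / 2)" 0 "real m"] m_pos by simp
    then have "K * real m powr (- (real L / 2)) \<le> 1 * 1" using V1 True K by (intro mult_mono) auto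
    then show ?thesis by simp
  next
    case False
    have L0: "0 < L" using L_pos by simp
    have "\<not> card (vocab H 0) \<le> Suc 0" using False V_pos card_vocab[of 0] by simp
    then obtain \<nu> \<nu>' where \<nu>: "\<nu> \<in> vocab H 0" "\<nu>' \<in> vocab H 0" "\<nu> \<noteq> \<nu>'"
      using finite_vocab[of 0] by (auto simp: card_le_Suc0_iff_eq)
    have "L2_set (\<lambda>\<zeta>. post 0 \<nu> \<zeta> - post 0 \<nu>' \<zeta>) (vocab H 0) \<le> 2"
      using \<nu> L0 by (intro L2_set_le_2) (auto simp: post_nonneg sum_post marg_gt_0)
    then show ?thesis using posterior_distance[OF ns L0 \<nu>] K_powr_le[OF L0] by linarith
  qed
  ultimately have "max (K * real m powr (- (real L / 2))) (1 / (real V * real m ^ L)\<^sup>2) \<le> 2"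
    by (rule max.boundedI[rotated])
  then show ?thesis unfolding separation_def by (simp only: divide_le_eq_1_pos zero_less_numeral)
qed

lemma inverse_separation_le: "1 / separation K \<le> 2 * (real V * real m ^ L)\<^sup>2"
proof -
  have c: "(real V * real m ^ L)\<^sup>2 > 0" using V_pos m_pos by simp
  have "1 / (2 * (real V * real m ^ L)\<^sup>2) \<le> separation K"
    unfolding separation_def using max.cobounded2[of "1 / (real V * real m ^ L)\<^sup>2"] by simp
  then have "1 / separation K \<le> 1 / (1 / (2 * (real V * real m ^ L)\<^sup>2))"
    using separation_pos c by (intro divide_left_mono) auto
  then show ?thesis by simp
qed

text \<open>The origin of \<open>m ^ L / K\<^sup>2\<close> in the sample bound: the square of the
  weakest signal, that of level \<open>L\<close>.\<close>

lemma inverse_separation_square_le: "1 / (separation K)\<^sup>2 \<le> 4 * (1 / K\<^sup>2) * real m ^ L"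
proof -
  have m: "real m > 0" using m_pos by simp
  have "(K * real m powr (- (real L / 2)) / 2)\<^sup>2 \<le> (separation K)\<^sup>2"
    unfolding separation_def using K by (intro power_mono divide_right_mono max.cobounded1) auto
  moreover have "(K * real m powr (- (real L / 2)) / 2)\<^sup>2 = K\<^sup>2 / (4 * real m ^ L)"
  proof -
    have "(real m powr (- (real L / 2)))\<^sup>2 = real m powr (- real L)"
      using m by (simp add: power2_eq_square powr_add[symmetric])
    also have "\<dots> = 1 / real m ^ L" using m by (simp add: powr_minus powr_realpow inverse_eq_divide)
    finally show ?thesis by (simp add: power_mult_distrib power_divide)
  qed
  ultimately have "1 / (separation K)\<^sup>2 \<le> 1 / (K\<^sup>2 / (4 * real m ^ L))"
    using K m separation_pos by (intro divide_left_mono) auto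
  then show ?thesis by simp
qed

end

end

text \<open>Chooses the parameters. \<open>A\<close> dominates all model parameters, and the scales
  are \<open>\<tau>\<close> over powers of \<open>A\<close>. The exponent \<open>200\<close> leaves
  slack over what the estimates produce: \<open>93\<close> for the samples and \<open>174\<close>
  for the width.\<close>

theorem learnable:
  fixes H :: "nat rhm"
  assumes "cfg_model H R V m"
    and enc0: "bij_betw enc0 (vocab H 0) {..<V}" and encL: "bij_betw encL (vocab H (depth H)) {..<V}"
    and \<kappa>: "\<kappa> > 0" and K: "K > 0" and V1: "V = 1 \<longrightarrow> K \<le> 1"
    and nd: "non_degenerate H \<kappa>" and ns: "nontrivial_signal H m K"
    and \<delta>: "0 < \<delta>" "\<delta> < 1"
    and \<epsilon>': "1 / (real (branching H) + real (depth H)) \<le> \<epsilon>'"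
  shows "\<exists>p. valid_hyperparams (depth H) p \<and>
     \<P>(\<theta> in training_measure H p. training_succeeds H enc0 encL p \<epsilon>' \<theta>) \<ge> 1 - \<delta> \<and>
     real (\<Sum>l\<in>{1..depth H}. num_samples p l)
       \<le> poly_bound 200 [\<kappa>, real m, real V, real (branching H), real (depth H), ln (1 / \<delta>)] * (1 / K\<^sup>2) * real m ^ depth H \<and>
     (\<forall>l\<in>{1..depth H}. real (num_freqs p l)
       \<le> poly_bound 200 [1 / K, \<kappa>, real V, real (branching H), real (depth H), ln (1 / \<delta>), real m ^ depth H]) \<and>
     real (\<Sum>l\<in>{1..depth H}. num_steps p l)
       \<le> poly_bound 200 [1 / K, \<kappa>, real V, real (branching H), real (depth H), ln (1 / \<delta>), real m ^ depth H]"
proof -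
  interpret cfg_model H R V m by fact
  note sp = separation_pos[OF \<kappa> K V1 nd ns] separation_le_1[OF \<kappa> K V1 nd ns]
  define \<tau> where "\<tau> = separation K"
  define A where "A = 1 + \<kappa> + real V + real m + real s + real L"
  \<comment> \<open>The exponents solve the conditions of \<open>calibrated_learner\<close>:
    \<open>\<epsilon> * A\<^sup>2 = \<sigma>\<close> with \<open>16 * s \<le> A ^ 4\<close>, and
    \<open>tol * A ^ 5 = \<epsilon>\<close> with \<open>24 * \<kappa> * V * m \<le> A ^ 5\<close>.
    Moreover \<open>\<tau>\<^sup>2 / (8 * \<sigma>\<^sup>2) = A ^ 6 / 8\<close>.\<close>
  define \<sigma> where "\<sigma> = \<tau> / A ^ 3"
  define \<epsilon> where "\<epsilon> = \<tau> / A ^ 5"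
  define tol where "tol = \<tau> / A ^ 10"
  define p where "p = 1 / (\<kappa> * V * m)"
  define lg where "lg = ln (1 / \<delta>)"
  define n where "n = real (s * V)"
  \<comment> \<open>Each level may fail with probability \<open>\<delta> / (2 * L)\<close> for the
    samples and again for the frequencies. \<open>\<rho>\<close> gives the Markov term half of the
    latter, \<open>Y\<close> gives the grid term the other half, and \<open>X\<close> matches the
    Hoeffding bound for the samples.\<close>
  define \<rho> where "\<rho> = 4 * real L * n / (\<sigma> * \<delta>)"
  define mesh where "mesh = tol / (8 * \<rho>)"
  define X where "X = 18 / tol\<^sup>2 * ln (4 * real L / \<delta>)"
  define N where "N = nat \<lceil>X\<rceil>"
  define Y where "Y = 32 / tol\<^sup>2 * (n * ln (11 / mesh) + ln (8 * real L / \<delta>))"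
  define M where "M = nat \<lceil>Y\<rceil>"
  have \<tau>: "\<tau> > 0" "\<tau> \<le> 1" using sp by (simp_all add: \<tau>_def)
  have ge1: "real V \<ge> 1" "real m \<ge> 1" "real s \<ge> 1" "real L \<ge> 1"
    using V_pos m_pos s_pos L_pos by auto
  have A5: "A \<ge> 5" using ge1 \<kappa> by (simp add: A_def)
  have leA: "\<kappa> \<le> A" "real V \<le> A" "real m \<le> A" "real s \<le> A" "real L \<le> A" "real s + real L \<le> A"
    using ge1 \<kappa> by (simp_all add: A_def)
  have Apos: "A > 0" "A ^ k > 0" for k using A5 by auto
  have \<sigma>_pos: "\<sigma> > 0" and \<epsilon>_pos: "\<epsilon> > 0" and tol_pos: "tol > 0" and p_pos: "p > 0"
    using \<tau> Apos \<kappa> ge1 by (auto simp: \<sigma>_def \<epsilon>_def tol_def p_def)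
  have Apow: "A ^ i \<le> A ^ j" if "i \<le> j" for i j using A5 that by (intro power_increasing) auto
  have A1: "1 \<le> A ^ k" for k using A5 by (intro one_le_power) auto
  have \<sigma>1: "\<sigma> \<le> 1" and tol1: "tol \<le> 1"
    using \<tau> A1[of 3] A1[of 10] Apos by (auto simp: \<sigma>_def tol_def divide_le_eq)
  have lg: "lg > 0" using \<delta> by (simp add: lg_def)
  have n1: "n \<ge> 1" using ge1 mult_mono[of 1 "real s" 1 "real V"] by (simp add: n_def)
  have L\<delta>: "1 \<le> real L / \<delta>" using ge1 \<delta> by (simp add: le_divide_eq)
  have \<rho>_pos: "\<rho> > 0" using ge1 n1 \<sigma>_pos \<delta> by (simp add: \<rho>_def)
  have \<rho>n: "n / \<sigma> \<le> \<rho>"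
  proof -
    have "n / \<sigma> * 1 \<le> n / \<sigma> * (4 * (real L / \<delta>))" using L\<delta> n1 \<sigma>_pos by (intro mult_left_mono) auto
    then show ?thesis by (simp add: \<rho>_def mult_ac)
  qed
  have \<rho>1: "\<rho> \<ge> 1"
  proof -
    have "1 \<le> n / \<sigma>" using n1 \<sigma>1 \<sigma>_pos by (simp add: le_divide_eq)
    then show ?thesis using \<rho>n by simp
  qed
  have mesh: "mesh > 0" "mesh \<le> 1" using tol_pos tol1 \<rho>1 by (auto simp: mesh_def divide_le_eq)
  have ln4: "ln (4 * real L / \<delta>) \<ge> 1"
  proof -
    have "exp 1 \<le> (4 :: real)" using exp_le by simp
    also have "\<dots> \<le> 4 * real L / \<delta>" using L\<delta> by simp
    finally show ?thesis using ge1 \<delta> by (simp add: ln_ge_iff)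
  qed
  have tol2: "1 / tol\<^sup>2 \<ge> 1" using tol_pos tol1 power_le_one[of tol 2] by (simp add: le_divide_eq)
  have X1: "X \<ge> 1"
  proof -
    have "1 * 1 \<le> (18 / tol\<^sup>2) * ln (4 * real L / \<delta>)" using tol2 ln4 by (intro mult_mono) auto
    then show ?thesis by (simp add: X_def)
  qed
  then have N: "real N \<ge> X" "real N \<le> 2 * X" "N > 0"
    by (auto simp: N_def) linarith+
  have ln8: "ln (8 * real L / \<delta>) \<ge> 1"
  proof -
    have "ln (4 * real L / \<delta>) \<le> ln (8 * real L / \<delta>)" using ge1 \<delta> by (intro ln_mono) (auto intro!: divide_right_mono)
    then show ?thesis using ln4 by simp
  qed
  have ln11: "ln (11 / mesh) \<ge> 0" using mesh by (intro ln_ge_zero) (simp add: le_divide_eq)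
  have Y1: "Y \<ge> 1"
  proof -
    have "1 * 1 \<le> (32 / tol\<^sup>2) * (n * ln (11 / mesh) + ln (8 * real L / \<delta>))"
      using tol2 ln8 ln11 n1 by (intro mult_mono) (auto intro: add_nonneg_nonneg add_increasing)
    then show ?thesis by (simp add: Y_def)
  qed
  then have M: "real M \<ge> Y" "real M \<le> 2 * Y" "M > 0"
    by (auto simp: M_def) linarith+
  \<comment> \<open>Here the bound on \<open>1 / \<tau>\<close> by \<open>V\<close> and
    \<open>m ^ L\<close> enters: it makes \<open>2 / tol\<close> at most the exponential of a
    quadratic polynomial in \<open>A\<close>, which \<open>A ^ 6 / 8\<close> exceeds for
    \<open>A \<ge> 5\<close>.\<close>
  have exp_bound: "exp (- (\<tau>\<^sup>2 / (8 * \<sigma>\<^sup>2))) \<le> tol / 2"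
  proof -
    have "2 / tol = 2 * A ^ 10 * (1 / \<tau>)" by (simp add: tol_def)
    also have "\<dots> \<le> 2 * A ^ 10 * (2 * (real V * real m ^ L)\<^sup>2)"
      using inverse_separation_le[OF \<kappa> K V1 nd ns] Apos by (intro mult_left_mono) (auto simp: \<tau>_def)
    also have "\<dots> = 4 * (A ^ 10 * (real V * real m ^ L)\<^sup>2)" by simp
    also have "\<dots> \<le> exp 2 * (exp A ^ 10 * (exp A * exp A ^ L)\<^sup>2)"
    proof (intro mult_mono power_mono)
      show "4 \<le> exp (2 :: real)"
      proof -
        have "2 \<le> exp (1 :: real)" using exp_ge_add_one_self[of 1] by simp
        then have "2 * 2 \<le> exp (1 :: real) * exp 1" by (intro mult_mono) auto
        then show ?thesis by (simp add: exp_add[symmetric])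
      qed
      show "A \<le> exp A" by (rule le_exp)
      show "real V \<le> exp A" "real m \<le> exp A" using leA le_exp[of A] by linarith+
    qed (use Apos in auto)
    also have "\<dots> = exp (2 + 10 * A + 2 * (A + L * A))"
      unfolding power2_eq_square exp_of_nat_mult[symmetric] exp_add[symmetric] by (simp add: algebra_simps)
    also have "\<dots> \<le> exp (A ^ 6 / 8)"
    proof -
      have arith: "2 + 10 * a + 2 * (a + x) \<le> c / 8" if "x \<le> b" "5 * a \<le> b" "625 * b \<le> c" "5 \<le> a"
        for a b c x :: real
        using that unfolding distrib_left by linarith
      have "L * A \<le> A * A" using leA Apos by (intro mult_right_mono) auto
      moreover have "5 * A \<le> A * A" using A5 by (intro mult_right_mono) auto
      moreover have "625 * (A * A) \<le> A ^ 4 * (A * A)"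
        using power_mono[OF A5, of 4] Apos by (intro mult_right_mono) auto
      moreover have "A ^ 4 * (A * A) = A ^ 6" by (simp add: eval_nat_numeral)
      ultimately have "2 + 10 * A + 2 * (A + L * A) \<le> A ^ 6 / 8" using A5 by (intro arith) auto
      then show ?thesis by (simp only: exp_le_cancel_iff)
    qed
    finally have "2 / tol \<le> exp (A ^ 6 / 8)" .
    then have "1 / exp (A ^ 6 / 8) \<le> 1 / (2 / tol)" using tol_pos by (intro divide_left_mono) auto
    then have "exp (- (A ^ 6 / 8)) \<le> tol / 2" by (simp add: exp_minus inverse_eq_divide)
    moreover have "\<tau>\<^sup>2 / (8 * \<sigma>\<^sup>2) = A ^ 6 / 8"
      using \<tau> Apos by (simp add: \<sigma>_def power_divide power_mult[symmetric])
    ultimately show ?thesis by (simp only:)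
  qed
  interpret learner: calibrated_learner H R V m enc0 encL \<sigma> M N \<epsilon> tol \<tau> p
  proof
    show "marg k \<nu> / m \<ge> p" if "k < L" "\<nu> \<in> vocab H k" for k \<nu>
      using marg_lower_bound[OF nd \<kappa> that] by (simp add: p_def)
    show "\<tau> \<le> L2_set (\<lambda>\<zeta>. post l \<nu> \<zeta> - post l \<nu>' \<zeta>) (vocab H 0)"
      if "1 \<le> l" "l < L" "\<nu> \<in> vocab H l" "\<nu>' \<in> vocab H l" "\<nu> \<noteq> \<nu>'" for l \<nu> \<nu>'
      using separated[OF \<kappa> K V1 nd ns that(2-5)] \<tau> by (simp add: \<tau>_def)
    show "\<epsilon> \<le> \<tau> / 4"
    proof -
      have "4 \<le> A ^ 5" using A5 Apow[of 1 5] by simp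
      then show ?thesis using \<tau> unfolding \<epsilon>_def using Apos by (intro divide_left_mono) auto
    qed
    show "16 * real s * \<epsilon>\<^sup>2 \<le> \<sigma>\<^sup>2"
    proof -
      have "16 * real s \<le> A ^ 3 * A" using power_mono[OF A5, of 3] leA ge1 by (intro mult_mono) auto
      also have "\<dots> = A ^ 4" by (simp add: eval_nat_numeral)
      finally have "16 * real s * \<epsilon>\<^sup>2 \<le> A ^ 4 * \<epsilon>\<^sup>2" by (intro mult_right_mono) auto
      also have "\<dots> = \<sigma>\<^sup>2"
      proof -
        have "\<epsilon> * A ^ 2 = \<sigma>" using Apos by (simp add: \<epsilon>_def \<sigma>_def field_simps flip: power_add)
        then have "\<sigma>\<^sup>2 = \<epsilon>\<^sup>2 * (A ^ 2) ^ 2" by (metis power_mult_distrib)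
        then show ?thesis by (simp add: mult.commute flip: power_mult)
      qed
      finally show ?thesis .
    qed
    show "24 * tol \<le> p * \<epsilon>"
    proof -
      have "24 * (\<kappa> * real V * real m) \<le> A ^ 2 * (A * A * A)"
        using power_mono[OF A5, of 2] leA ge1 \<kappa> Apos by (intro mult_mono) auto
      also have "\<dots> = A ^ 5" by (simp add: eval_nat_numeral)
      finally have "24 * (\<kappa> * real V * real m) * tol \<le> A ^ 5 * tol" using tol_pos by (intro mult_right_mono) auto
      also have "A ^ 5 * tol = \<epsilon>" using Apos by (simp add: \<epsilon>_def tol_def field_simps flip: power_add)
      finally show ?thesis using \<kappa> ge1 by (simp add: p_def field_simps)
    qed
  qed (use enc0 encL \<sigma>_pos M(3) N(3) p_pos \<tau> \<epsilon>_pos tol_pos exp_bound in simp_all)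
  have "1 - 2 * real L * (\<delta> / (2 * real L)) \<le>
    \<P>(\<theta> in training_measure H learner.hp. training_succeeds H enc0 encL learner.hp \<epsilon>' \<theta>)"
  proof (rule learner.prob_training_succeeds[of \<epsilon>' mesh \<rho>])
    show "\<epsilon> \<le> \<epsilon>'"
    proof -
      have "\<epsilon> \<le> 1 / A ^ 1" unfolding \<epsilon>_def using \<tau> Apow[of 1 5] Apos by (intro frac_le) auto
      also have "\<dots> \<le> 1 / (real s + real L)" using leA ge1 Apos by (intro divide_left_mono) auto
      finally show ?thesis using \<epsilon>' by simp
    qed
    show "mesh * \<rho> \<le> tol / 8" using \<rho>_pos by (simp add: mesh_def)
    show "real (s * V) / \<sigma> \<le> \<rho>" using \<rho>n by (simp only: n_def)
    show "2 * exp (- (real N * tol\<^sup>2 / 18)) \<le> \<delta> / (2 * real L)"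
    proof -
      have "ln (4 * real L / \<delta>) = X * tol\<^sup>2 / 18" using tol_pos by (simp add: X_def)
      also have "\<dots> \<le> N * tol\<^sup>2 / 18" using N by (intro divide_right_mono mult_right_mono) auto
      finally have "exp (- (real N * tol\<^sup>2 / 18)) \<le> exp (- ln (4 * real L / \<delta>))" by simp
      also have "\<dots> = \<delta> / (4 * real L)" using ge1 \<delta> by (simp add: exp_minus)
      finally show ?thesis by simp
    qed
    show "real (s * V) / (\<sigma> * \<rho>) + (2 * of_int \<lceil>4 / mesh\<rceil> + 1) ^ (s * V) * (2 * exp (- (real M * (tol / 2)\<^sup>2 / 8)))
        \<le> \<delta> / (2 * real L)"
    proof -
      have "real (s * V) / (\<sigma> * \<rho>) = \<delta> / (4 * real L)"
        using \<sigma>_pos n1 \<delta> ge1 unfolding n_def[symmetric] by (simp add: \<rho>_def)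
      moreover have "(2 * of_int \<lceil>4 / mesh\<rceil> + 1) ^ (s * V) * (2 * exp (- (real M * (tol / 2)\<^sup>2 / 8))) \<le> \<delta> / (4 * real L)"
      proof -
        have "0 \<le> \<lceil>4 / mesh\<rceil>" using mesh
          by (metis ceiling_mono ceiling_zero divide_nonneg_pos zero_le_numeral)
        then have "(2 * of_int \<lceil>4 / mesh\<rceil> + 1) ^ (s * V) \<le> (11 / mesh) ^ (s * V)"
          using ceiling_count_bound[OF mesh] by (intro power_mono) auto
        also have "\<dots> = exp (n * ln (11 / mesh))"
          using mesh by (simp add: n_def exp_of_nat_mult del: of_nat_mult)
        finally have G: "(2 * of_int \<lceil>4 / mesh\<rceil> + 1) ^ (s * V) \<le> exp (n * ln (11 / mesh))" .
        have "n * ln (11 / mesh) + ln (8 * real L / \<delta>) = Y * tol\<^sup>2 / 32" using tol_pos by (simp add: Y_def)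
        also have "\<dots> \<le> M * tol\<^sup>2 / 32" using M by (intro divide_right_mono mult_right_mono) auto
        also have "\<dots> = real M * (tol / 2)\<^sup>2 / 8" by (simp add: power_divide)
        finally have E: "exp (- (real M * (tol / 2)\<^sup>2 / 8)) \<le> exp (- (n * ln (11 / mesh) + ln (8 * real L / \<delta>)))" by simp
        have "(2 * of_int \<lceil>4 / mesh\<rceil> + 1) ^ (s * V) * (2 * exp (- (real M * (tol / 2)\<^sup>2 / 8)))
            \<le> exp (n * ln (11 / mesh)) * (2 * exp (- (n * ln (11 / mesh) + ln (8 * real L / \<delta>))))"
          using G E by (intro mult_mono) auto
        also have "\<dots> = 2 * exp (- ln (8 * real L / \<delta>))" by (simp add: exp_add[symmetric])
        also have "\<dots> = \<delta> / (4 * real L)" using ge1 \<delta> by (simp add: exp_minus)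
        finally show ?thesis .
      qed
      ultimately show ?thesis using ge1 by (simp add: field_simps)
    qed
  qed (use mesh in auto)
  then have prob: "1 - \<delta> \<le> \<P>(\<theta> in training_measure H learner.hp. training_succeeds H enc0 encL learner.hp \<epsilon>' \<theta>)"
    using ge1 by simp
  have ln_le: "ln (a / \<delta>) \<le> a + lg" if "a > 0" for a
  proof -
    have "ln (a / \<delta>) = ln a + lg" using that \<delta> by (simp add: lg_def ln_div)
    then show ?thesis using ln_le_minus_one[OF that] by simp
  qed
  have four: "(2 :: real)\<^sup>2 = 4" by simp
  have samples: "real (\<Sum>l\<in>{1..L}. num_samples learner.hp l)
      \<le> poly_bound 200 [\<kappa>, real m, real V, real s, real L, lg] * (1 / K\<^sup>2) * real m ^ L"
  proof -
    define z where "z = [\<kappa>, real m, real V, real s, real L, lg]"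
    define Z where "Z = L2_set (\<lambda>i. z ! i) {..<length z}"
    have Z_eq: "Z = sqrt (\<kappa>\<^sup>2 + (real m)\<^sup>2 + (real V)\<^sup>2 + (real s)\<^sup>2 + (real L)\<^sup>2 + lg\<^sup>2)"
      unfolding Z_def L2_set_nth by (simp add: z_def add.assoc)
    have sq: "1 \<le> (real m)\<^sup>2" "1 \<le> (real V)\<^sup>2" "1 \<le> (real s)\<^sup>2" "1 \<le> (real L)\<^sup>2"
      using ge1 by (auto intro!: one_le_power)
    have Z2: "Z \<ge> 2"
      unfolding Z_eq by (rule real_le_rsqrt) (use sq four zero_le_power2[of \<kappa>] zero_le_power2[of lg] in linarith)
    have Zge: "\<kappa> \<le> Z ^ 1" "real m \<le> Z ^ 1" "real V \<le> Z ^ 1" "real s \<le> Z ^ 1" "real L \<le> Z ^ 1" "lg \<le> Z ^ 1"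
      unfolding power_one_right Z_eq by (rule real_le_rsqrt; simp)+
    note pb = power_bound_mult[OF Z2] power_bound_add[OF Z2]
    note wk = power_bound_weaken[OF Z2] and num = small_power_bounds[OF Z2]
    have A: "A \<le> Z ^ 4"
    proof -
      have "A \<le> 6 * Z" using Zge Z2 by (simp add: A_def)
      also have "\<dots> \<le> Z ^ (3 + 1)" using Z2 by (intro pb(1) num) auto
      finally show ?thesis by simp
    qed
    have ln_b: "ln (4 * real L / \<delta>) \<le> Z ^ 4"
    proof -
      have "ln (4 * real L / \<delta>) \<le> 4 * real L + lg" using ge1 by (intro ln_le) auto
      also have "\<dots> \<le> 8 * Z" using Zge Z2 by simp
      also have "\<dots> \<le> Z ^ (3 + 1)" using Z2 by (intro pb(1) num) auto
      finally show ?thesis by simp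
    qed
    have "real (\<Sum>l\<in>{1..L}. num_samples learner.hp l) = real L * real N" by simp
    also have "\<dots> \<le> real L * (2 * X)" using N by (intro mult_left_mono) auto
    also have "\<dots> = (real L * (36 * (A ^ 20 * ln (4 * real L / \<delta>)))) * (1 / \<tau>\<^sup>2)"
      by (simp add: X_def tol_def power_divide flip: power_mult)
    also have "\<dots> \<le> (real L * (36 * (A ^ 20 * ln (4 * real L / \<delta>)))) * (4 * (1 / K\<^sup>2) * real m ^ L)"
      using inverse_separation_square_le[OF \<kappa> K V1 nd ns] ln4 Apos by (intro mult_left_mono) (auto simp: \<tau>_def)
    also have "\<dots> = (4 * (real L * (36 * (A ^ 20 * ln (4 * real L / \<delta>))))) * ((1 / K\<^sup>2) * real m ^ L)"
      by simp
    \<comment> \<open>The exponent mirrors the product: \<open>4\<close>, \<open>L\<close>,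
      \<open>36\<close>, \<open>A ^ 20\<close> and the logarithm contribute \<open>2\<close>,
      \<open>1\<close>, \<open>6\<close>, \<open>4 * 20\<close> and \<open>4\<close>.\<close>
    also have "\<dots> \<le> Z ^ (2 + (1 + (6 + (4 * 20 + 4)))) * ((1 / K\<^sup>2) * real m ^ L)"
      using ln4 Apos
      by (intro mult_right_mono pb(1) num Zge ln_b A power_bound_pow[OF Z2]) auto
    also have "\<dots> \<le> poly_bound 200 z * ((1 / K\<^sup>2) * real m ^ L)"
      unfolding Z_def using Z2 by (intro mult_right_mono poly_bound_ge_power) (auto simp: Z_def)
    finally show ?thesis by (simp add: z_def mult.assoc)
  qed
  define z where "z = [1 / K, \<kappa>, real V, real s, real L, lg, real m ^ L]"
  define Z where "Z = L2_set (\<lambda>i. z ! i) {..<length z}"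
  have Z_eq: "Z = sqrt ((1 / K)\<^sup>2 + \<kappa>\<^sup>2 + (real V)\<^sup>2 + (real s)\<^sup>2 + (real L)\<^sup>2 + lg\<^sup>2 + (real m ^ L)\<^sup>2)"
    unfolding Z_def L2_set_nth by (simp add: z_def add.assoc)
  have mL: "1 \<le> real m ^ L" using ge1 by (intro one_le_power)
  have sq: "1 \<le> (real V)\<^sup>2" "1 \<le> (real s)\<^sup>2" "1 \<le> (real L)\<^sup>2" "1 \<le> (real m ^ L)\<^sup>2"
    using ge1 mL by (auto intro!: one_le_power)
  have Z2: "Z \<ge> 2"
    unfolding Z_eq
    by (rule real_le_rsqrt) (use sq four zero_le_power2[of \<kappa>] zero_le_power2[of lg] zero_le_power2[of "1 / K"] in linarith)
  have Zge: "\<kappa> \<le> Z ^ 1" "real V \<le> Z ^ 1" "real s \<le> Z ^ 1" "real L \<le> Z ^ 1" "lg \<le> Z ^ 1" "real m ^ L \<le> Z ^ 1"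
    unfolding power_one_right Z_eq by (rule real_le_rsqrt; simp)+
  \<comment> \<open>The second argument list contains \<open>m ^ L\<close> in place of
    \<open>m\<close>; since \<open>L \<ge> 1\<close>, it dominates \<open>m\<close>.\<close>
  have "real m \<le> real m ^ L" using ge1(2) L_pos by (intro self_le_power) auto
  then have Zm: "real m \<le> Z ^ 1" using Zge by linarith
  note pb = power_bound_mult[OF Z2] power_bound_add[OF Z2]
  note wk = power_bound_weaken[OF Z2] and num = small_power_bounds[OF Z2]
  have poly: "Z ^ k \<le> poly_bound 200 z" if "k \<le> 200" for k
    unfolding Z_def using that Z2 by (intro poly_bound_ge_power) (auto simp: Z_def)
  have A: "A \<le> Z ^ 4"
  proof -
    have "A \<le> 6 * Z" using Zge Zm Z2 by (simp add: A_def)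
    also have "\<dots> \<le> Z ^ (3 + 1)" using Z2 by (intro pb(1) num) auto
    finally show ?thesis by simp
  qed
  \<comment> \<open>The rationality bound is already polynomial in \<open>V\<close> and
    \<open>m ^ L\<close>, both of which are arguments of this bound.\<close>
  have \<tau>_b: "1 / \<tau> \<le> Z ^ 5"
  proof -
    have "1 / \<tau> \<le> 2 * (real V * real m ^ L)\<^sup>2"
      using inverse_separation_le[OF \<kappa> K V1 nd ns] by (simp add: \<tau>_def)
    also have "\<dots> \<le> Z ^ (1 + (1 + 1) * 2)"
      by (intro pb(1) num Zge power_bound_pow[OF Z2]) auto
    finally show ?thesis by simp
  qed
  have tol_b: "1 / tol \<le> Z ^ 45"
  proof -
    have "1 / tol = A ^ 10 * (1 / \<tau>)" by (simp add: tol_def)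
    also have "\<dots> \<le> Z ^ (4 * 10 + 5)" using \<tau> Apos by (intro pb(1) A \<tau>_b power_bound_pow[OF Z2]) auto
    finally show ?thesis by simp
  qed
  have \<sigma>_b: "1 / \<sigma> \<le> Z ^ 17"
  proof -
    have "1 / \<sigma> = A ^ 3 * (1 / \<tau>)" by (simp add: \<sigma>_def)
    also have "\<dots> \<le> Z ^ (4 * 3 + 5)" using \<tau> Apos by (intro pb(1) A \<tau>_b power_bound_pow[OF Z2]) auto
    finally show ?thesis by simp
  qed
  have n_b: "n \<le> Z ^ 2"
  proof -
    have "n \<le> Z ^ (1 + 1)" using pb(1)[OF Zge(3) Zge(2)] by (simp add: n_def)
    then show ?thesis by (simp add: numeral_2_eq_2)
  qed
  have ln_b: "ln (11 / mesh) \<le> Z ^ 75"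
  proof -
    have "11 / mesh = 352 * (real L * (n * (1 / \<sigma> * (1 / tol)))) / \<delta>" by (simp add: mesh_def \<rho>_def)
    then have "ln (11 / mesh) = ln (352 * (real L * (n * (1 / \<sigma> * (1 / tol)))) / \<delta>)" by (rule arg_cong)
    also have "\<dots> \<le> 352 * (real L * (n * (1 / \<sigma> * (1 / tol)))) + lg"
      using ge1 n1 \<sigma>_pos tol_pos by (intro ln_le) (auto intro!: mult_pos_pos)
    also have "\<dots> \<le> Z ^ Suc (9 + (1 + (2 + (17 + 45))))"
      using n1 \<sigma>_pos tol_pos
      by (intro pb(1) pb(2) num Zge(4) n_b \<sigma>_b tol_b wk[OF Zge(5)]) auto
    finally show ?thesis by simp
  qed
  have ln8_b: "ln (8 * real L / \<delta>) \<le> Z ^ (2 + 75)"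
  proof -
    have "ln (8 * real L / \<delta>) \<le> 8 * real L + lg" using ge1 by (intro ln_le) auto
    also have "\<dots> \<le> Z ^ Suc (3 + 1)" by (intro pb(1) pb(2) num Zge(4) wk[OF Zge(5)]) auto
    finally show ?thesis by (rule wk) simp
  qed
  have freqs: "real M \<le> poly_bound 200 z"
  proof -
    have "real M \<le> 2 * Y" by (rule M)
    also have "\<dots> = 64 * ((1 / tol)\<^sup>2 * (n * ln (11 / mesh) + ln (8 * real L / \<delta>)))"
      by (simp add: Y_def power_divide)
    also have "\<dots> \<le> Z ^ (6 + (45 * 2 + Suc (2 + 75)))"
      using ln11 ln8 n1 tol_pos
      by (intro pb(1) pb(2) num tol_b n_b ln_b ln8_b power_bound_pow[OF Z2]) auto
    also have "\<dots> \<le> poly_bound 200 z" by (rule poly) simp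
    finally show ?thesis .
  qed
  have steps: "real L \<le> poly_bound 200 z" using Zge(4) poly[of 1] by simp
  show ?thesis
  proof (intro exI[of _ learner.hp] conjI ballI)
    show "valid_hyperparams L learner.hp"
      using \<sigma>_pos M N by (simp add: valid_hyperparams_def)
  qed (use prob samples freqs steps in \<open>simp_all add: z_def lg_def\<close>)
qed

text \<open>What remains after \<open>learnable\<close> is to express the accuracy as a null
  sequence in \<open>d\<close> alone, common to all models with the same input length.\<close>

theorem theorem4p1:
  shows "\<exists>C>0. \<forall>(C0::real) (g :: nat \<Rightarrow> real). g \<longlonglongrightarrow> 0 \<longrightarrow>
    (\<exists>\<epsilon> :: nat \<Rightarrow> real. \<epsilon> \<longlonglongrightarrow> 0 \<and>
      (\<forall>(H :: nat rhm) R L s d V m (\<kappa>::real) (K\<rho>::real) (\<delta>::real) enc0 encL.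
        is_rhm H \<and> L = depth H \<and> s = branching H \<and> d = s ^ L \<and>
        induced_by_cfg H R \<and> uniform_cfg H R V m \<and> non_ambiguous H R \<and>
        bij_betw enc0 (vocab H 0) {..<V} \<and> bij_betw encL (vocab H L) {..<V} \<and>
        \<kappa> > 0 \<and> K\<rho> > 0 \<and> (V = 1 \<longrightarrow> K\<rho> \<le> 1) \<and>
        non_degenerate H \<kappa> \<and>
        nontrivial_signal H m K\<rho> \<and>
        K\<rho> \<ge> 1 / poly_bound C0 [real m, real V, real L, real s, \<kappa>, real d powr g d] \<and>
        0 < \<delta> \<and> \<delta> < 1
        \<longrightarrow>
        (\<exists>p. valid_hyperparams L p \<and>
           \<P>(\<theta> in training_measure H p. training_succeeds H enc0 encL p (\<epsilon> d) \<theta>) \<ge> 1 - \<delta> \<and>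
           real (\<Sum>l\<in>{1..L}. num_samples p l)
             \<le> poly_bound C [\<kappa>, real m, real V, real s, real L, ln (1 / \<delta>)] * (1 / K\<rho>\<^sup>2) * real m ^ L \<and>
           (\<forall>l\<in>{1..L}. real (num_freqs p l)
             \<le> poly_bound C [1 / K\<rho>, \<kappa>, real V, real s, real L, ln (1 / \<delta>), real m ^ L]) \<and>
           real (\<Sum>l\<in>{1..L}. num_steps p l)
             \<le> poly_bound C [1 / K\<rho>, \<kappa>, real V, real s, real L, ln (1 / \<delta>), real m ^ L])))"
proof (intro exI[of _ 200] conjI allI impI)
  fix C0 :: real and g :: "nat \<Rightarrow> real"
  have "filterlim (\<lambda>d. ln (real d)) at_top sequentially"
    by (intro filterlim_compose[OF ln_at_top] filterlim_real_sequentially)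
  then have "filterlim (\<lambda>d. sqrt (1 + ln (real d))) at_top sequentially"
    by (intro filterlim_compose[OF sqrt_at_top] filterlim_tendsto_add_at_top[OF tendsto_const])
  then have lim: "(\<lambda>d. 1 / sqrt (1 + ln (real d))) \<longlonglongrightarrow> 0"
    by (intro tendsto_divide_0[OF tendsto_const] filterlim_at_top_imp_at_infinity)
  \<comment> \<open>\<open>learnable\<close> reaches accuracy \<open>1 / (s + L)\<close>. Since
    \<open>ln d = L * ln s \<le> L * s\<close>, the quantity \<open>1 + ln d\<close> is at most
    \<open>(s + L)\<^sup>2\<close>, which explains the choice
    \<open>1 / sqrt (1 + ln d)\<close>.\<close>
  have le: "1 / (real (branching H) + real (depth H)) \<le> 1 / sqrt (1 + ln (real (branching H ^ depth H)))"
    if "is_rhm H" for H :: "nat rhm"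
  proof (rule divide_left_mono)
    let ?s = "real (branching H)" and ?L = "real (depth H)"
    have ge1: "?s \<ge> 1" "?L \<ge> 1" using that by (auto simp: is_rhm_def)
    have ln_nonneg: "ln ?s \<ge> 0" using ge1 by simp
    have "ln (real (branching H ^ depth H)) = ?L * ln ?s" using ge1 by (simp add: ln_realpow)
    also have "\<dots> \<le> ?L * ?s" using ge1 ln_le_minus_one[of ?s] by (intro mult_left_mono) auto
    finally have ln_le: "ln (real (branching H ^ depth H)) \<le> ?L * ?s" .
    have nonneg: "ln (real (branching H ^ depth H)) \<ge> 0" using ge1 ln_nonneg by (simp add: ln_realpow)
    have "1 \<le> ?s\<^sup>2" using ge1 by (intro one_le_power)
    moreover have "0 \<le> ?L * ?s" "0 \<le> ?L\<^sup>2" by auto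
    moreover have "(?s + ?L)\<^sup>2 = ?s\<^sup>2 + 2 * (?L * ?s) + ?L\<^sup>2" by (simp add: power2_sum mult_ac)
    ultimately have "1 + ln (real (branching H ^ depth H)) \<le> (?s + ?L)\<^sup>2" using ln_le by linarith
    then show "sqrt (1 + ln (real (branching H ^ depth H))) \<le> ?s + ?L" by (intro real_le_lsqrt) auto
    have "sqrt (1 + ln (real (branching H ^ depth H))) > 0" using nonneg by simp
    then show "0 < (?s + ?L) * sqrt (1 + ln (real (branching H ^ depth H)))" using ge1 by simp
  qed simp
  show "(\<exists>\<epsilon> :: nat \<Rightarrow> real. \<epsilon> \<longlonglongrightarrow> 0 \<and>
      (\<forall>(H :: nat rhm) R L s d V m (\<kappa>::real) (K\<rho>::real) (\<delta>::real) enc0 encL.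
        is_rhm H \<and> L = depth H \<and> s = branching H \<and> d = s ^ L \<and>
        induced_by_cfg H R \<and> uniform_cfg H R V m \<and> non_ambiguous H R \<and>
        bij_betw enc0 (vocab H 0) {..<V} \<and> bij_betw encL (vocab H L) {..<V} \<and>
        \<kappa> > 0 \<and> K\<rho> > 0 \<and> (V = 1 \<longrightarrow> K\<rho> \<le> 1) \<and>
        non_degenerate H \<kappa> \<and>
        nontrivial_signal H m K\<rho> \<and>
        K\<rho> \<ge> 1 / poly_bound C0 [real m, real V, real L, real s, \<kappa>, real d powr g d] \<and>
        0 < \<delta> \<and> \<delta> < 1
        \<longrightarrow>
        (\<exists>p. valid_hyperparams L p \<and>
           \<P>(\<theta> in training_measure H p. training_succeeds H enc0 encL p (\<epsilon> d) \<theta>) \<ge> 1 - \<delta> \<and>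
           real (\<Sum>l\<in>{1..L}. num_samples p l)
             \<le> poly_bound 200 [\<kappa>, real m, real V, real s, real L, ln (1 / \<delta>)] * (1 / K\<rho>\<^sup>2) * real m ^ L \<and>
           (\<forall>l\<in>{1..L}. real (num_freqs p l)
             \<le> poly_bound 200 [1 / K\<rho>, \<kappa>, real V, real s, real L, ln (1 / \<delta>), real m ^ L]) \<and>
           real (\<Sum>l\<in>{1..L}. num_steps p l)
             \<le> poly_bound 200 [1 / K\<rho>, \<kappa>, real V, real s, real L, ln (1 / \<delta>), real m ^ L])))"
  proof (rule exI[of _ "\<lambda>d. 1 / sqrt (1 + ln (real d))"], intro conjI lim allI impI, elim conjE, goal_cases)
    case (1 H R L s d V m \<kappa> K\<rho> \<delta> enc0 encL)
    then have "cfg_model H R V m" by unfold_locales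
    then show ?case
      using learnable[of H R V m enc0 encL \<kappa> K\<rho> \<delta> "1 / sqrt (1 + ln (real d))"] 1 le[of H] by simp
  qed
qed simp

end
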